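(* The following decision problem (the decision version of \textsf{Int-Min-Max-Delay}) is NP-complete in the strong sense: given a directed graph $G=(V,E)$ in which every edge $e$ has a non-negative integer capacity $c_e$ and a non-negative integer delay $d_e$, a source $s\in V$, a sink $t\in V\setminus\{s\}$, a positive integer rate requirement $R$, and a number $D$, decide whether there exists a feasible integer flow $f$ with maximum delay $\mathcal{D}(f)\le D$.
   Context: Let $P$ be the set of all directed $s$-$t$ paths in $G$; for $p\in P$ its delay is $d^p=\sum_{e\in p} d_e$. An integer flow is an assignment $f=\{f^p\in\mathbb{Z}_{\ge 0}: p\in P\}$ of non-negative integer rates to paths; its edge rates are $f_e=\sum_{p\in P: e\in p} f^p$. It is feasible if $\sum_{p\in P} f^p=R$ and $f_e\le c_e$ for every $e\in E$. The maximum delay of $f$ is $\mathcal{D}(f)=\max_{p\in P: f^p>0} d^p$. The problem \textsf{Int-Min-Max-Delay} asks for a feasible integer flow minimizing $\mathcal{D}(f)$. *)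

theory Defs
  imports
    "HOL-Computational_Algebra.Polynomial"
    "Graph_Theory.Arc_Walk"
begin

section \<open>Deterministic multi-tape Turing machines\<close>

datatype move = Move_Left | Stay | Move_Right

text \<open>
  States and tape symbols are initial segments of the natural numbers; the start state
  is \<open>0\<close> and the blank is symbol \<open>0\<close>. The machine halts where \<open>delta\<close> is undefined.
\<close>

record tm =
  tapes :: nat
  symbols :: nat
  states :: nat
  delta :: "nat \<Rightarrow> nat list \<Rightarrow> (nat \<times> (nat \<times> move) list) option"

definition wf_tm :: "tm \<Rightarrow> bool" where
  "wf_tm M \<longleftrightarrow> tapes M \<ge> 1 \<and> symbols M \<ge> 3 \<and> states M \<ge> 1 \<and>
     (\<forall>q as q' acts. q < states M \<longrightarrow> length as = tapes M \<longrightarrow> set as \<subseteq> {..<symbols M} \<longrightarrow>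
        delta M q as = Some (q', acts) \<longrightarrow>
        q' < states M \<and> length acts = tapes M \<and> fst ` set acts \<subseteq> {..<symbols M})"

text \<open>A tape is two-way infinite: the head position together with the contents of the cells.\<close>

type_synonym tape = "int \<times> (int \<Rightarrow> nat)"
type_synonym config = "nat \<times> tape list"

fun tape_read :: "tape \<Rightarrow> nat" where
  "tape_read (h, c) = c h"

fun shift :: "move \<Rightarrow> int" where
  "shift Move_Left = -1"
| "shift Stay = 0"
| "shift Move_Right = 1"

fun tape_act :: "nat \<times> move \<Rightarrow> tape \<Rightarrow> tape" where
  "tape_act (a, m) (h, c) = (h + shift m, c(h := a))"

fun halted :: "tm \<Rightarrow> config \<Rightarrow> bool" where
  "halted M (q, ts) \<longleftrightarrow> delta M q (map tape_read ts) = None"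

fun step :: "tm \<Rightarrow> config \<Rightarrow> config" where
  "step M (q, ts) =
     (case delta M q (map tape_read ts) of
        None \<Rightarrow> (q, ts)
      | Some (q', acts) \<Rightarrow> (q', map2 tape_act acts ts))"

definition sym :: "bool \<Rightarrow> nat" where
  "sym b = (if b then 2 else 1)"

definition tape_of :: "bool list \<Rightarrow> tape" where
  "tape_of x = (0, \<lambda>i. if 0 \<le> i \<and> i < int (length x) then sym (x ! nat i) else 0)"

definition init :: "tm \<Rightarrow> bool list \<Rightarrow> config" where
  "init M x = (0, tape_of x # replicate (tapes M - 1) (tape_of []))"

text \<open>The string on a tape is read from the head position rightwards up to the first blank.\<close>

fun tape_holds :: "tape \<Rightarrow> bool list \<Rightarrow> bool" where
  "tape_holds (h, c) y \<longleftrightarrow>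
     (\<forall>i < length y. c (h + int i) = sym (y ! i)) \<and> c (h + int (length y)) = 0"

text \<open>Input and output are both on the first tape.\<close>

definition computes_within :: "tm \<Rightarrow> bool list \<Rightarrow> bool list \<Rightarrow> nat \<Rightarrow> bool" where
  "computes_within M x y T \<longleftrightarrow>
     (\<exists>k \<le> T. halted M ((step M ^^ k) (init M x)) \<and>
              tape_holds (hd (snd ((step M ^^ k) (init M x)))) y)"


section \<open>Polynomial time, NP, and strong NP-completeness\<close>

type_synonym lang = "bool list set"

definition poly_time_computable :: "(bool list \<Rightarrow> bool list) \<Rightarrow> bool" where
  "poly_time_computable f \<longleftrightarrow>
     (\<exists>M (p :: nat poly). wf_tm M \<and> (\<forall>x. computes_within M x (f x) (poly p (length x))))"

definition class_P :: "lang set" where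
  "class_P = {L. poly_time_computable (\<lambda>x. [x \<in> L])}"

text \<open>
  The prefix-free code \<open>1 b\<^sub>1 1 b\<^sub>2 \<dots> 1 b\<^sub>n 0\<close> of the string \<open>b\<^sub>1 b\<^sub>2 \<dots> b\<^sub>n\<close>.
\<close>

definition self_delim :: "bool list \<Rightarrow> bool list" where
  "self_delim x = concat (map (\<lambda>b. [True, b]) x) @ [False]"

definition pair_code :: "bool list \<Rightarrow> bool list \<Rightarrow> bool list" where
  "pair_code x y = self_delim x @ y"

definition class_NP :: "lang set" where
  "class_NP = {L. \<exists>V \<in> class_P. \<exists>p :: nat poly. \<forall>x.
     x \<in> L \<longleftrightarrow> (\<exists>y. length y \<le> poly p (length x) \<and> pair_code x y \<in> V)}"

definition poly_time_reducible :: "lang \<Rightarrow> lang \<Rightarrow> bool" where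
  "poly_time_reducible L L' \<longleftrightarrow>
     (\<exists>f. poly_time_computable f \<and> (\<forall>x. x \<in> L \<longleftrightarrow> f x \<in> L'))"

definition NP_hard :: "lang \<Rightarrow> bool" where
  "NP_hard L \<longleftrightarrow> (\<forall>L' \<in> class_NP. poly_time_reducible L' L)"

definition NP_complete :: "lang \<Rightarrow> bool" where
  "NP_complete L \<longleftrightarrow> L \<in> class_NP \<and> NP_hard L"

text \<open>
  Strong NP-completeness in the sense of Garey and Johnson: the problem is in NP, and for some
  polynomial \<open>p\<close> its restriction to the instances whose largest number is at most \<open>p\<close> of the
  instance length is NP-complete. Here \<open>Y\<close> is the set of yes-instances, \<open>enc\<close> the encoding
  (with numbers in binary) and \<open>mx\<close> the largest number occurring in an instance.
\<close>

definition strongly_NP_complete ::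
  "'i set \<Rightarrow> ('i \<Rightarrow> bool list) \<Rightarrow> ('i \<Rightarrow> nat) \<Rightarrow> bool" where
  "strongly_NP_complete Y enc mx \<longleftrightarrow>
     enc ` Y \<in> class_NP \<and>
     (\<exists>p :: nat poly. NP_complete (enc ` {I \<in> Y. mx I \<le> poly p (length (enc I))}))"


section \<open>The decision version of Int-Min-Max-Delay\<close>

text \<open>
  The vertices are \<open>0, \<dots>, nverts - 1\<close>. The edges form an association list
  mapping \<open>(u, v)\<close> to the capacity and the delay of the edge from \<open>u\<close> to \<open>v\<close>.
\<close>

record instance_data =
  nverts :: nat
  edges :: "((nat \<times> nat) \<times> (nat \<times> nat)) list"
  source :: nat
  sink :: nat
  rate :: nat
  bound :: int

definition graph :: "instance_data \<Rightarrow> (nat, nat \<times> nat) pre_digraph" where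
  "graph I = \<lparr>verts = {..<nverts I}, arcs = fst ` set (edges I), tail = fst, head = snd\<rparr>"

definition cap :: "instance_data \<Rightarrow> nat \<times> nat \<Rightarrow> nat" where
  "cap I e = fst (the (map_of (edges I) e))"

definition delay :: "instance_data \<Rightarrow> nat \<times> nat \<Rightarrow> nat" where
  "delay I e = snd (the (map_of (edges I) e))"

definition valid_instance :: "instance_data \<Rightarrow> bool" where
  "valid_instance I \<longleftrightarrow>
     wf_digraph (graph I) \<and> distinct (map fst (edges I)) \<and>
     source I \<in> verts (graph I) \<and> sink I \<in> verts (graph I) - {source I} \<and> rate I > 0"

definition st_paths :: "instance_data \<Rightarrow> (nat \<times> nat) list set" where
  "st_paths I = {p. pre_digraph.apath (graph I) (source I) p (sink I)}"

definition path_delay :: "instance_data \<Rightarrow> (nat \<times> nat) list \<Rightarrow> nat" where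
  "path_delay I p = (\<Sum>e \<in> set p. delay I e)"

definition edge_rate :: "instance_data \<Rightarrow> ((nat \<times> nat) list \<Rightarrow> nat) \<Rightarrow> nat \<times> nat \<Rightarrow> nat" where
  "edge_rate I f e = (\<Sum>p \<in> {p \<in> st_paths I. e \<in> set p}. f p)"

definition feasible_flow :: "instance_data \<Rightarrow> ((nat \<times> nat) list \<Rightarrow> nat) \<Rightarrow> bool" where
  "feasible_flow I f \<longleftrightarrow>
     (\<Sum>p \<in> st_paths I. f p) = rate I \<and> (\<forall>e \<in> arcs (graph I). edge_rate I f e \<le> cap I e)"

definition max_delay :: "instance_data \<Rightarrow> ((nat \<times> nat) list \<Rightarrow> nat) \<Rightarrow> nat" where
  "max_delay I f = Max (path_delay I ` {p \<in> st_paths I. f p > 0})"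

definition int_min_max_delay :: "instance_data set" where
  "int_min_max_delay =
     {I. valid_instance I \<and> (\<exists>f. feasible_flow I f \<and> int (max_delay I f) \<le> bound I)}"

text \<open>Sums and maxima over paths are taken over finite, and for \<open>Max\<close> nonempty, sets.\<close>

lemma finite_st_paths:
  assumes "valid_instance I"
  shows "finite (st_paths I)"
proof -
  interpret wf_digraph "graph I"
    using assms by (simp add: valid_instance_def)
  interpret fin_digraph "graph I"
    by unfold_locales (simp_all add: graph_def)
  show ?thesis
    unfolding st_paths_def by (rule apaths_finite)
qed

lemma feasible_flow_support_nonempty:
  assumes "valid_instance I" "feasible_flow I f"
  shows "{p \<in> st_paths I. f p > 0} \<noteq> {}"
proof
  assume "{p \<in> st_paths I. f p > 0} = {}"
  then have "(\<Sum>p \<in> st_paths I. f p) = 0" by (intro sum.neutral) auto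
  with assms show False by (simp add: feasible_flow_def valid_instance_def)
qed


section \<open>Encoding of instances\<close>

text \<open>Binary expansion, least significant bit first, without leading zeros.\<close>

fun bits :: "nat \<Rightarrow> bool list" where
  "bits n = (if n = 0 then [] else odd n # bits (n div 2))"

declare bits.simps [simp del]

definition enc_nat :: "nat \<Rightarrow> bool list" where
  "enc_nat n = self_delim (bits n)"

definition enc_int :: "int \<Rightarrow> bool list" where
  "enc_int k = (k < 0) # enc_nat (nat \<bar>k\<bar>)"

definition enc_list :: "('a \<Rightarrow> bool list) \<Rightarrow> 'a list \<Rightarrow> bool list" where
  "enc_list enc xs = concat (map (\<lambda>x. True # enc x) xs) @ [False]"

fun enc_edge :: "(nat \<times> nat) \<times> (nat \<times> nat) \<Rightarrow> bool list" where
  "enc_edge ((u, v), (c, d)) = enc_nat u @ enc_nat v @ enc_nat c @ enc_nat d"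

text \<open>
  The number of vertices is written in unary, so that the length of the encoding is at least
  the number of vertices, as when the vertices are listed; all other numbers are in binary.
\<close>

definition enc_instance :: "instance_data \<Rightarrow> bool list" where
  "enc_instance I =
     replicate (nverts I) True @ [False] @ enc_list enc_edge (edges I) @
     enc_nat (source I) @ enc_nat (sink I) @ enc_nat (rate I) @ enc_int (bound I)"

text \<open>Vertex names are not counted as numbers of the instance.\<close>

definition max_number :: "instance_data \<Rightarrow> nat" where
  "max_number I =
     Max ({rate I, nat \<bar>bound I\<bar>} \<union> (\<Union>e \<in> arcs (graph I). {cap I e, delay I e}))"

lemma self_delim_append_eq_iff:
  "self_delim x @ r = self_delim y @ s \<longleftrightarrow> x = y \<and> r = s"
proof (induction x arbitrary: y)
  case Nil
  then show ?case by (cases y) (auto simp: self_delim_def)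
next
  case (Cons a x)
  then show ?case by (cases y) (auto simp: self_delim_def)
qed

lemma bits_inject: "bits m = bits n \<longleftrightarrow> m = n"
proof (induction m arbitrary: n rule: less_induct)
  case (less m)
  show ?case
  proof (cases "m = 0 \<or> n = 0")
    case True
    then show ?thesis by (auto simp: bits.simps[of m] bits.simps[of n])
  next
    case False
    then have "bits m = bits n \<longleftrightarrow> odd m = odd n \<and> m div 2 = n div 2"
      using less[of "m div 2" "n div 2"] by (simp add: bits.simps[of m] bits.simps[of n])
    also have "\<dots> \<longleftrightarrow> m = n" by presburger
    finally show ?thesis .
  qed
qed

lemma enc_nat_append_eq_iff: "enc_nat m @ r = enc_nat n @ s \<longleftrightarrow> m = n \<and> r = s"
  by (simp add: enc_nat_def self_delim_append_eq_iff bits_inject)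

lemma enc_int_inject: "enc_int k = enc_int l \<longleftrightarrow> k = l"
  using enc_nat_append_eq_iff[of "nat \<bar>k\<bar>" "[]" "nat \<bar>l\<bar>" "[]"] by (auto simp: enc_int_def)

lemma enc_edge_append_eq_iff: "enc_edge e @ r = enc_edge e' @ s \<longleftrightarrow> e = e' \<and> r = s"
  by (cases e rule: enc_edge.cases, cases e' rule: enc_edge.cases)
    (auto simp: enc_nat_append_eq_iff)

lemma enc_list_append_eq_iff:
  assumes "\<And>x y r s. enc x @ r = enc y @ s \<longleftrightarrow> x = y \<and> r = s"
  shows "enc_list enc xs @ r = enc_list enc ys @ s \<longleftrightarrow> xs = ys \<and> r = s"
proof (induction xs arbitrary: ys)
  case Nil
  then show ?case by (cases ys) (auto simp: enc_list_def)
next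
  case (Cons a xs)
  then show ?case by (cases ys) (auto simp: enc_list_def assms)
qed

lemma unary_append_eq_iff:
  "replicate m True @ False # r = replicate n True @ False # s \<longleftrightarrow> m = n \<and> r = s"
proof (induction m arbitrary: n)
  case 0
  then show ?case by (cases n) auto
next
  case (Suc m)
  then show ?case by (cases n) auto
qed

lemma inj_enc_instance: "inj enc_instance"
proof (rule injI)
  fix I J :: instance_data
  assume "enc_instance I = enc_instance J"
  then show "I = J"
    by (cases I, cases J)
      (simp add: enc_instance_def unary_append_eq_iff enc_nat_append_eq_iff enc_int_inject
        enc_list_append_eq_iff[OF enc_edge_append_eq_iff])
qed

end

theory Submission
  imports Defs "HOL-Library.FuncSet"
begin

text \<open>
  Every unit of flow can be forced to connect a prescribed pair of terminals: give the
      \<open>m\<close>-th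
  edge leaving the source delay \<open>m\<close>, the \<open>m\<close>-th edge entering the sink
      delay \<open>R - m\<close>, capacity \<open>1\<close> to
  all edges and bound the delay by \<open>R\<close>. Integral flows thus express edge-disjoint
      paths with
  given terminals, and these express satisfiability: a variable is routed along the chain of its
  false literal, and a clause needs a free edge on the chain of one of its literals. All
  numbers are at most the number of vertices. Satisfiability in turn expresses the runs
  of a Turing machine that checks certificates, by Horn clauses that
  force the facts of the run.

  For membership in NP, a flow supported on few paths suffices: two distinct sets of paths of the
  support with the same incidence vector allow to move weight so that the support shrinks, and by
  counting such sets exist unless the support is quadratic in the number of edges.

  Polynomial running times are obtained uniformly. Formulas of arithmetic with
  quantifiers bounded by polynomials, over the length and the bits of the input, are evaluated
  by nested loops on counters, and so are lists printed by such loops. The reduction is of this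
  form, and a certificate for an instance is a family of relations that satisfies such a
  formula and from which the instance can be printed.
\<close>

section \<open>Counter programs on Turing machines\<close>

text \<open>Complexity refers to concrete Turing machines, and the obstacle is to program and time
  one machine per algorithm. Here only counter programs are simulated on tapes, and what remains to
  be checked for each algorithm is that a printing loop is definable. Quantified values are
  polynomially bounded, with two consequences. Powers of two must be recognised by divisibility, and
  capacities, delays and rates may be exponential, so a certificate carries their bits together with
  partial sums and carries. There may also be exponentially many paths, hence the interest in small
  supports. An input string is never parsed: it is accepted if the certificate makes the program
  print exactly this string, so malformed strings are rejected without further work. One flag
  decides whether all numbers must also be at most the length of the string; the two values give the
  two memberships in NP that strong completeness asks for. Terminals are prescribed by arithmetic:
  if the unit starting at \<open>m\<close> ends at \<sigma>\<open>(m)\<close>, the delay bound gives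
  \<open>m\<close> \<le> \<sigma>\<open>(m)\<close>, and a permutation with this property is the
  identity.\<close>

datatype test = NZ nat | BT nat | NB nat

datatype cmd =
    Skip
  | Inc nat
  | Dec nat
  | Emit bool
  | Seq cmd cmd
  | Ite test cmd cmd
  | Whl test cmd

type_synonym regs = "nat \<Rightarrow> nat"

fun tval :: "bool list \<Rightarrow> test \<Rightarrow> regs \<Rightarrow> bool" where
  "tval z (NZ r) s \<longleftrightarrow> s r \<noteq> 0"
| "tval z (BT r) s \<longleftrightarrow> s r < length z \<and> z ! s r"
| "tval z (NB r) s \<longleftrightarrow> s r < length z"

text \<open>The number is an upper bound on the machine steps of the compiled program: a branch and
  a jump account for the \<open>2\<close> of conditionals and loop rounds, the final branch for the
  \<open>1\<close> of a loop exit. \<open>exec_weaken\<close> allows bounds to be rounded up to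
  polynomials. A counter at \<open>0\<close> is unchanged by \<open>Dec\<close>.\<close>

inductive exec :: "bool list \<Rightarrow> cmd \<Rightarrow> regs \<Rightarrow> bool list
    \<Rightarrow> nat \<Rightarrow> regs \<Rightarrow> bool list \<Rightarrow> bool"
  for z where
  exec_Skip: "exec z Skip s w 0 s w"
| exec_Inc: "exec z (Inc r) s w 1 (s(r := s r + 1)) w"
| exec_Dec: "exec z (Dec r) s w 1 (s(r := s r - 1)) w"
| exec_Emit: "exec z (Emit b) s w 1 s (w @ [b])"
| exec_Seq: "exec z c1 s w t1 s1 w1 \<Longrightarrow> exec z c2 s1 w1 t2 s2 w2 \<Longrightarrow>
    exec z (Seq c1 c2) s w (t1 + t2) s2 w2"
| exec_IteT: "tval z b s \<Longrightarrow> exec z c1 s w t s1 w1 \<Longrightarrow> exec z (Ite b c1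
    c2) s w (t + 2) s1 w1"
| exec_IteF: "\<not> tval z b s \<Longrightarrow> exec z c2 s w t s1 w1 \<Longrightarrow> exec z
    (Ite b c1 c2) s w (t + 2) s1 w1"
| exec_WhlF: "\<not> tval z b s \<Longrightarrow> exec z (Whl b c) s w 1 s w"
| exec_WhlT: "tval z b s \<Longrightarrow> exec z c s w t1 s1 w1 \<Longrightarrow> exec z (Whl b c)
    s1 w1 t2 s2 w2 \<Longrightarrow>
    exec z (Whl b c) s w (t1 + t2 + 2) s2 w2"
| exec_weaken: "exec z c s w t s1 w1 \<Longrightarrow> t \<le> t' \<Longrightarrow> exec z c s w t'
    s1 w1"

lemma exec_length: "exec z c s w t s1 w1 \<Longrightarrow> length w1 \<le> length w + t"
  by (induction rule: exec.induct) auto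

section \<open>Compilation to jump code and the machine that runs it\<close>

datatype instr = IInc nat | IDec nat | IEmit bool | IBr test nat | IJmp nat

text \<open>Jump targets are absolute, so the address \<open>q\<close> of the first instruction is a
  parameter. \<open>IBr\<close> falls through if its test holds and jumps otherwise; every block is
  left at the address right behind it.\<close>

fun compile :: "cmd \<Rightarrow> nat \<Rightarrow> instr list" where
  "compile Skip q = []"
| "compile (Inc r) q = [IInc r]"
| "compile (Dec r) q = [IDec r]"
| "compile (Emit b) q = [IEmit b]"
| "compile (Seq c1 c2) q = compile c1 q @ compile c2 (q + length (compile c1 q))"
| "compile (Ite b c1 c2) q =
     (let A = compile c1 (q + 1); B = compile c2 (q + length A + 2)
      in IBr b (q + length A + 2) # A @ IJmp (q + length A + 2 + length B) # B)"
| "compile (Whl b c) q = (let A = compile c (q + 1) in IBr b (q + length A + 2) # A @ [IJmp q])"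

fun regs_below :: "nat \<Rightarrow> cmd \<Rightarrow> bool" where
  "regs_below K Skip \<longleftrightarrow> True"
| "regs_below K (Inc r) \<longleftrightarrow> r < K"
| "regs_below K (Dec r) \<longleftrightarrow> r < K"
| "regs_below K (Emit b) \<longleftrightarrow> True"
| "regs_below K (Seq c1 c2) \<longleftrightarrow> regs_below K c1 \<and> regs_below K c2"
| "regs_below K (Ite b c1 c2) \<longleftrightarrow> (case b of NZ r \<Rightarrow> r | BT r
    \<Rightarrow> r | NB r \<Rightarrow> r) < K \<and>
     regs_below K c1 \<and> regs_below K c2"
| "regs_below K (Whl b c) \<longleftrightarrow> (case b of NZ r \<Rightarrow> r | BT r
    \<Rightarrow> r | NB r \<Rightarrow> r) < K \<and> regs_below K c"

lemma regs_below_mono: "regs_below K c \<Longrightarrow> K \<le> K' \<Longrightarrow> regs_below K'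
    c"
  by (induction c) auto

lemma regs_below_exists: "\<exists>K \<ge> 1. regs_below K c"
proof (induction c)
  case (Seq c1 c2)
  then obtain K1 K2 where "K1 \<ge> 1" "regs_below K1 c1" "regs_below K2 c2" by blast
  then show ?case
    by (intro exI[of _ "max K1 K2"]) (auto intro: regs_below_mono)
next
  case (Ite b c1 c2)
  then obtain K1 K2 where K: "K1 \<ge> 1" "regs_below K1 c1" "regs_below K2 c2" by blast
  let ?K = "max (Suc (case b of NZ r \<Rightarrow> r | BT r \<Rightarrow> r | NB r \<Rightarrow>
      r)) (max K1 K2)"
  show ?case
    by (intro exI[of _ ?K]) (use K in \<open>auto intro: regs_below_mono\<close>)
next
  case (Whl b c)
  then obtain K1 where K: "K1 \<ge> 1" "regs_below K1 c" by blast
  let ?K = "max (Suc (case b of NZ r \<Rightarrow> r | BT r \<Rightarrow> r | NB r \<Rightarrow>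
      r)) K1"
  show ?case
    by (intro exI[of _ ?K]) (use K in \<open>auto intro: regs_below_mono\<close>)
qed (auto intro: exI[of _ "Suc _"])

text \<open>
  Tape \<open>0\<close> is the output tape; tape \<open>r + 1\<close> represents register
      \<open>r\<close> by its head position. All
  register tapes carry a read-only copy of the input in which the symbol of cell \<open>0\<close>
      is increased
  by \<open>3\<close>, so that the zero test and the access to the input bit addressed by a
      register are both
  decided by the scanned symbol.
\<close>

definition reg_cell :: "bool list \<Rightarrow> int \<Rightarrow> nat" where
  "reg_cell z i = (if i = 0 then 3 else 0) +
     (if 0 \<le> i \<and> i < int (length z) then sym (z ! nat i) else 0)"

text \<open>Erasing the input leaves the head of tape \<open>0\<close> at cell
  \<open>length z\<close>, where the output starts. The blank to the left of this cell is what stops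
  the final rewind.\<close>

definition out_tape :: "bool list \<Rightarrow> bool list \<Rightarrow> tape" where
  "out_tape z w = (int (length z + length w),
     \<lambda>i. if int (length z) \<le> i \<and> i < int (length z + length w)
         then sym (w ! nat (i - int (length z))) else 0)"

definition reg_tapes :: "nat \<Rightarrow> bool list \<Rightarrow> regs \<Rightarrow> tape list"
    where
  "reg_tapes K z s = map (\<lambda>r. (int (s r), reg_cell z)) [0..<K]"

definition act_at :: "nat \<Rightarrow> (nat \<Rightarrow> nat \<times> move) \<Rightarrow> nat
    list \<Rightarrow> (nat \<times> move) list" where
  "act_at k f as = map (\<lambda>i. if i = k then f (as ! i) else (as ! i, Stay)) [0..<length as]"

text \<open>The symbols \<open>0\<close>, \<open>1\<close>, \<open>2\<close> are blank,
  \<open>False\<close> and \<open>True\<close>; \<open>3\<close>, \<open>4\<close>, \<open>5\<close>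
  are the same symbols in cell \<open>0\<close>. A register beyond the input scans a blank, so a bit
  test there fails.\<close>

fun sym_test :: "test \<Rightarrow> nat list \<Rightarrow> bool" where
  "sym_test (NZ r) as \<longleftrightarrow> as ! Suc r < 3"
| "sym_test (BT r) as \<longleftrightarrow> as ! Suc r \<in> {2, 5}"
| "sym_test (NB r) as \<longleftrightarrow> as ! Suc r \<notin> {0, 3}"

fun instr_delta :: "instr \<Rightarrow> nat \<Rightarrow> nat list \<Rightarrow> nat \<times> (nat
    \<times> move) list" where
  "instr_delta (IInc r) q as = (q + 1, act_at (Suc r) (\<lambda>a. (a, Move_Right)) as)"
| "instr_delta (IDec r) q as =
     (q + 1, act_at (Suc r) (\<lambda>a. (a, if a < 3 then Move_Left else Stay)) as)"
| "instr_delta (IEmit b) q as = (q + 1, act_at 0 (\<lambda>a. (sym b, Move_Right)) as)"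
| "instr_delta (IBr b l) q as =
     (if sym_test b as then q + 1 else l, act_at 0 (\<lambda>a. (a, Stay)) as)"
| "instr_delta (IJmp l) q as = (l, act_at 0 (\<lambda>a. (a, Stay)) as)"

text \<open>
  States \<open>0\<close>, \<open>1\<close>, \<open>2\<close> move the input from tape
      \<open>0\<close> to the register tapes and rewind these; the last
  states rewind the output. Jumps are cut off at the end of the program to keep the machine
  well-formed for arbitrary \<open>P\<close>.
\<close>

definition machine_delta ::
  "nat \<Rightarrow> instr list \<Rightarrow> nat \<Rightarrow> nat list \<Rightarrow> (nat
      \<times> (nat \<times> move) list) option" where
  "machine_delta K P q as =
    (if q = 0 then
       (let m = (if hd as = 0 then Stay else Move_Right)
        in Some (if hd as = 0 then 2 else 1,
                 (0, m) # replicate K (if hd as < 3 then 3 + hd as else 3, m)))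
     else if q = 1 then
       (if hd as = 0 then Some (2, map (\<lambda>a. (a, Stay)) as)
        else Some (1, (0, Move_Right) # replicate K (hd as, Move_Right)))
     else if q = 2 then
       (if as ! 1 \<ge> 3 then Some (3, map (\<lambda>a. (a, Stay)) as)
        else Some (2, (hd as, Stay) # map (\<lambda>a. (a, Move_Left)) (tl as)))
     else if q < 3 + length P then
       (case instr_delta (P ! (q - 3)) q as of (q', acts) \<Rightarrow> Some (min q' (3 + length
           P), acts))
     else if q = 3 + length P then Some (q + 1, act_at 0 (\<lambda>a. (a, Move_Left)) as)
     else if q = 4 + length P then
       (if hd as = 0 then Some (q + 1, act_at 0 (\<lambda>a. (a, Move_Right)) as)
        else Some (q, act_at 0 (\<lambda>a. (a, Move_Left)) as))
     else None)"

definition machine :: "nat \<Rightarrow> instr list \<Rightarrow> tm" where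
  "machine K P = \<lparr>tapes = K + 1, symbols = 6, states = length P + 6, delta = machine_delta K
      P\<rparr>"

lemma length_act_at [simp]: "length (act_at k f as) = length as"
  by (simp add: act_at_def)

lemma fst_act_at:
  assumes "\<And>a. a < n \<Longrightarrow> fst (f a) < n" "set as \<subseteq> {..<n}"
  shows "fst ` set (act_at k f as) \<subseteq> {..<n}"
proof -
  have "as ! i < n" if "i < length as" for i
    using assms(2) that nth_mem by blast
  then show ?thesis using assms(1) by (auto simp: act_at_def)
qed

lemma fst_instr_delta:
  assumes "set as \<subseteq> {..<6}"
  shows "fst ` set (snd (instr_delta i q as)) \<subseteq> {..<6}"
proof (cases i)
  case (IInc r)
  then show ?thesis using fst_act_at[OF _ assms] by simp
next
  case (IDec r)
  then show ?thesis using fst_act_at[OF _ assms] by simp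
next
  case (IEmit b)
  have "fst ` set (act_at 0 (\<lambda>a. (sym b, Move_Right)) as) \<subseteq> {..<6}"
    by (rule fst_act_at[OF _ assms]) (simp add: sym_def)
  with IEmit show ?thesis by simp
next
  case (IBr b l)
  then show ?thesis using fst_act_at[OF _ assms] by simp
next
  case (IJmp l)
  then show ?thesis using fst_act_at[OF _ assms] by simp
qed

lemma length_instr_delta: "length (snd (instr_delta i q as)) = length as"
  by (cases i) auto

lemma wf_machine: "K \<ge> 1 \<Longrightarrow> wf_tm (machine K P)"
proof -
  assume K: "K \<ge> 1"
  have "q' < length P + 6 \<and> length acts = K + 1 \<and> fst ` set acts \<subseteq> {..<6}"
    if as: "length as = K + 1" "set as \<subseteq> {..<6}" and d: "machine_delta K P q as = Some
        (q', acts)"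
    for q as q' acts
  proof -
    have hd: "hd as < 6" using as by (cases as) auto
    have tl: "set (tl as) \<subseteq> {..<6}" using as by (cases as) auto
    consider "q \<le> 2" | "3 \<le> q" "q < 3 + length P" | "q = 3 + length P" | "q = 4 + length P"
      | "q > 4 + length P" by linarith
    then show ?thesis
    proof cases
      case 1
      then consider "q = 0" | "q = 1" | "q = 2" by linarith
      then show ?thesis
        using d as hd tl by cases (auto simp: machine_delta_def Let_def split: if_splits)
    next
      case 2
      then have "q' = min (fst (instr_delta (P ! (q - 3)) q as)) (3 + length P)"
        "acts = snd (instr_delta (P ! (q - 3)) q as)"
        using d by (auto simp: machine_delta_def split: prod.splits)
      then show ?thesis
        using fst_instr_delta[OF as(2)] as(1) by (simp add: length_instr_delta)
    next
      case 3
      then have "q' = q + 1" "acts = act_at 0 (\<lambda>a. (a, Move_Left)) as"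
        using d by (auto simp: machine_delta_def)
      then show ?thesis using 3 as fst_act_at[of 6 _ as 0] by simp
    next
      case 4
      then have "q' \<le> q + 1" "\<exists>m. acts = act_at 0 (\<lambda>a. (a, m)) as"
        using d by (auto simp: machine_delta_def split: if_splits)
      then obtain m where "acts = act_at 0 (\<lambda>a. (a, m)) as" by blast
      moreover have "fst ` set (act_at 0 (\<lambda>a. (a, m)) as) \<subseteq> {..<6}"
        by (rule fst_act_at[OF _ as(2)]) simp
      ultimately show ?thesis using 4 as \<open>q' \<le> q + 1\<close> by simp
    next
      case 5
      then show ?thesis using d by (auto simp: machine_delta_def)
    qed
  qed
  with K show ?thesis by (auto simp: wf_tm_def machine_def)
qed

section \<open>Simulation of single instructions and of programs\<close>

lemma map2_act_at:
  assumes "k < length ts"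
  shows "map2 tape_act (act_at k f (map tape_read ts)) ts =
    ts[k := tape_act (f (tape_read (ts ! k))) (ts ! k)]"
proof (rule nth_equalityI)
  fix i assume "i < length (map2 tape_act (act_at k f (map tape_read ts)) ts)"
  then have i: "i < length ts" by simp
  obtain h c where "ts ! i = (h, c)" by (cases "ts ! i")
  then show "map2 tape_act (act_at k f (map tape_read ts)) ts ! i =
      ts[k := tape_act (f (tape_read (ts ! k))) (ts ! k)] ! i"
    using i assms by (auto simp: act_at_def nth_list_update)
qed simp

lemma reg_tapes_update:
  "r < K \<Longrightarrow> (reg_tapes K z s)[r := (int v, reg_cell z)] = reg_tapes K z (s(r := v))"
  by (rule nth_equalityI) (auto simp: reg_tapes_def nth_list_update)

lemma reg_tapes_nth: "r < K \<Longrightarrow> reg_tapes K z s ! r = (int (s r), reg_cell z)"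
  by (simp add: reg_tapes_def)

lemma length_reg_tapes [simp]: "length (reg_tapes K z s) = K"
  by (simp add: reg_tapes_def)

lemma sym_test_tval:
  assumes "(case b of NZ r \<Rightarrow> r | BT r \<Rightarrow> r | NB r \<Rightarrow> r) < K"
  shows "sym_test b (a # map tape_read (reg_tapes K z s)) = tval z b s"
  using assms by (cases b) (auto simp: reg_tapes_nth reg_cell_def sym_def)

lemma step_act_at:
  assumes "machine_delta K P q (map tape_read ts) = Some (q', act_at k f (map tape_read ts))"
    and "k < length ts"
  shows "step (machine K P) (q, ts) = (q', ts[k := tape_act (f (tape_read (ts ! k))) (ts ! k)])"
proof -
  have "step (machine K P) (q, ts) = (q', map2 tape_act (act_at k f (map tape_read ts)) ts)"
    using assms(1) by (simp add: machine_def)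
  then show ?thesis using map2_act_at[OF assms(2)] by simp
qed

definition conf :: "nat \<Rightarrow> bool list \<Rightarrow> nat \<Rightarrow> regs \<Rightarrow>
    bool list \<Rightarrow> config" where
  "conf K z q s w = (q, out_tape z w # reg_tapes K z s)"

lemma machine_delta_instr:
  assumes "P = A @ i # B" "q = length A + 3" "instr_delta i q as = (q', acts)"
    "q' \<le> length P + 3"
  shows "machine_delta K P q as = Some (q', acts)"
  using assms by (simp add: machine_delta_def)

lemma step_program:
  assumes "P = A @ i # B" "q = length A + 3"
    "instr_delta i q (map tape_read ts) = (q', act_at k f (map tape_read ts))"
    "q' \<le> length P + 3" "k < length ts"
  shows "step (machine K P) (q, ts) = (q', ts[k := tape_act (f (tape_read (ts ! k))) (ts ! k)])"
  by (rule step_act_at[OF machine_delta_instr[OF assms(1-4)] assms(5)])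

lemma step_conf_IInc:
  assumes "P = A @ IInc r # B" "q = length A + 3" "r < K"
  shows "step (machine K P) (conf K z q s w) = conf K z (q + 1) (s(r := s r + 1)) w"
proof -
  have [simp]: "(reg_cell z)(int (s r) := reg_cell z (int (s r))) = reg_cell z" by auto
  show ?thesis
    unfolding conf_def
    using step_program[OF assms(1,2), of "out_tape z w # reg_tapes K z s" "q + 1" "Suc r"
        "\<lambda>a. (a, Move_Right)" K] assms reg_tapes_update[of r K z s "s r + 1"]
    by (simp add: reg_tapes_nth add.commute)
qed

lemma step_conf_IDec:
  assumes "P = A @ IDec r # B" "q = length A + 3" "r < K"
  shows "step (machine K P) (conf K z q s w) = conf K z (q + 1) (s(r := s r - 1)) w"
proof -
  have [simp]: "(reg_cell z)(int (s r) := reg_cell z (int (s r))) = reg_cell z" by auto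
  \<comment> \<open>Only the marked cell \<open>0\<close> carries a symbol of at least
    \<open>3\<close>, so the head moves left exactly if the register is positive. This is truncated
    subtraction.\<close>
  have lt: "\<not> reg_cell z 0 < 3" "reg_cell z (1 + int k) < 3" for k
    by (auto simp: reg_cell_def sym_def)
  show ?thesis
    unfolding conf_def
    using step_program[OF assms(1,2), of "out_tape z w # reg_tapes K z s" "q + 1" "Suc r"
        "\<lambda>a. (a, if a < 3 then Move_Left else Stay)" K] assms reg_tapes_update[of r K z s
            "s r - 1"]
    by (cases "s r") (auto simp: reg_tapes_nth lt)
qed

lemma tape_act_out_tape:
  "tape_act (sym b, Move_Right) (out_tape z w) = out_tape z (w @ [b])"
  by (auto simp: out_tape_def nth_append fun_eq_iff)

lemma step_conf_IEmit:
  assumes "P = A @ IEmit b # B" "q = length A + 3"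
  shows "step (machine K P) (conf K z q s w) = conf K z (q + 1) s (w @ [b])"
  unfolding conf_def
  using step_program[OF assms, of "out_tape z w # reg_tapes K z s" "q + 1" 0
      "\<lambda>a. (sym b, Move_Right)" K] assms
  by (simp add: tape_act_out_tape)

lemma tape_act_stay: "tape_act (tape_read tp, Stay) tp = tp"
  by (cases tp) auto

lemma step_conf_IJmp:
  assumes "P = A @ IJmp l # B" "q = length A + 3" "l \<le> length P + 3"
  shows "step (machine K P) (conf K z q s w) = conf K z l s w"
  unfolding conf_def
  using step_program[OF assms(1,2), of "out_tape z w # reg_tapes K z s" l 0
      "\<lambda>a. (a, Stay)" K] assms
  by (simp add: tape_act_stay)

lemma step_conf_IBr:
  assumes "P = A @ IBr b l # B" "q = length A + 3" "l \<le> length P + 3"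
    "(case b of NZ r \<Rightarrow> r | BT r \<Rightarrow> r | NB r \<Rightarrow> r) < K"
  shows "step (machine K P) (conf K z q s w) = conf K z (if tval z b s then q + 1 else l) s w"
  unfolding conf_def
  using step_program[OF assms(1,2), of "out_tape z w # reg_tapes K z s"
      "if tval z b s then q + 1 else l" 0 "\<lambda>a. (a, Stay)" K] assms
  by (simp add: tape_act_stay sym_test_tval)

text \<open>The surrounding code \<open>A\<close> and \<open>B\<close> is arbitrary because
  subprograms are executed in place, without relocation. The offset \<open>3\<close> skips the
  states of the prelude.\<close>

lemma exec_machine:
  assumes "exec z c s w t s' w'"
  shows "P = A @ compile c q @ B \<Longrightarrow> q = length A + 3 \<Longrightarrow> regs_below K
      c \<Longrightarrow>
    \<exists>k \<le> t. (step (machine K P) ^^ k) (conf K z q s w) = conf K z (q + length (compile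
        c q)) s' w'"
  using assms
proof (induction arbitrary: A B q rule: exec.induct)
  case (exec_Skip s w)
  then show ?case by simp
next
  case (exec_Inc r s w)
  then show ?case using step_conf_IInc[of P A r B q K z s w] by (intro exI[of _ 1]) (simp del:
      fun_upd_apply)
next
  case (exec_Dec r s w)
  then show ?case using step_conf_IDec[of P A r B q K z s w] by (intro exI[of _ 1]) (simp del:
      fun_upd_apply)
next
  case (exec_Emit b s w)
  then show ?case using step_conf_IEmit[of P A b B q K z s w] by (intro exI[of _ 1]) simp
next
  case (exec_Seq c1 s w t1 s1 w1 c2 t2 s2 w2)
  let ?f = "step (machine K P)" and ?q = "q + length (compile c1 q)"
  obtain k1 where k1: "k1 \<le> t1" "(?f ^^ k1) (conf K z q s w) = conf K z ?q s1 w1"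
  proof -
    have "P = A @ compile c1 q @ (compile c2 ?q @ B)" "regs_below K c1"
      using exec_Seq.prems(1,3) by auto
    from exec_Seq.IH(1)[OF this(1) exec_Seq.prems(2) this(2)] that show thesis by blast
  qed
  obtain k2 where k2: "k2 \<le> t2"
    "(?f ^^ k2) (conf K z ?q s1 w1) = conf K z (?q + length (compile c2 ?q)) s2 w2"
  proof -
    have "P = (A @ compile c1 q) @ compile c2 ?q @ B" "?q = length (A @ compile c1 q) + 3"
        "regs_below K c2"
      using exec_Seq.prems by auto
    from exec_Seq.IH(2)[OF this] that show thesis by blast
  qed
  have "(?f ^^ (k2 + k1)) (conf K z q s w) = conf K z (?q + length (compile c2 ?q)) s2 w2"
    by (simp add: funpow_add k1 k2)
  then show ?case using k1(1) k2(1) by (intro exI[of _ "k2 + k1"]) (simp add: add.assoc)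
next
  case (exec_IteT b s c1 w t s1 w1 c2)
  let ?f = "step (machine K P)" and ?a = "compile c1 (q + 1)"
  let ?b = "compile c2 (q + length ?a + 2)"
  let ?e = "q + length ?a + 2 + length ?b"
  have P: "P = A @ IBr b (q + length ?a + 2) # ?a @ IJmp ?e # ?b @ B"
    using exec_IteT.prems by (simp add: Let_def add.assoc)
  have e: "q + length ?a + 2 \<le> length P + 3" "?e \<le> length P + 3"
    using exec_IteT.prems(2) by (simp_all add: P)
  have s1: "?f (conf K z q s w) = conf K z (q + 1) s w"
    using step_conf_IBr[OF P exec_IteT.prems(2) e(1), of K z s w] exec_IteT.hyps(1)
        exec_IteT.prems(3) by simp
  obtain k where k: "k \<le> t" "(?f ^^ k) (conf K z (q + 1) s w) = conf K z (q + 1 + length ?a) s1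
      w1"
  proof -
    have "P = (A @ [IBr b (q + length ?a + 2)]) @ ?a @ IJmp ?e # ?b @ B"
      "q + 1 = length (A @ [IBr b (q + length ?a + 2)]) + 3" "regs_below K c1"
      using P exec_IteT.prems(2,3) by auto
    from exec_IteT.IH[OF this] that show thesis by blast
  qed
  have s2: "?f (conf K z (q + 1 + length ?a) s1 w1) = conf K z ?e s1 w1"
    using step_conf_IJmp[of P "A @ IBr b (q + length ?a + 2) # ?a" ?e "?b @ B"
        "q + 1 + length ?a" K z s1 w1] P e exec_IteT.prems(2) by simp
  have "(?f ^^ (1 + (k + 1))) (conf K z q s w) = conf K z ?e s1 w1"
    unfolding funpow_add comp_apply using s1 s2 k by simp
  then show ?case using k(1) by (intro exI[of _ "1 + (k + 1)"]) (simp add: Let_def add.assoc)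
next
  case (exec_IteF b s c2 w t s1 w1 c1)
  let ?f = "step (machine K P)" and ?a = "compile c1 (q + 1)"
  let ?b = "compile c2 (q + length ?a + 2)"
  let ?e = "q + length ?a + 2 + length ?b"
  have P: "P = A @ IBr b (q + length ?a + 2) # ?a @ IJmp ?e # ?b @ B"
    using exec_IteF.prems by (simp add: Let_def add.assoc)
  have e: "q + length ?a + 2 \<le> length P + 3" "?e \<le> length P + 3"
    using exec_IteF.prems(2) by (simp_all add: P)
  have s1: "?f (conf K z q s w) = conf K z (q + length ?a + 2) s w"
    using step_conf_IBr[OF P exec_IteF.prems(2) e(1), of K z s w] exec_IteF.hyps(1)
        exec_IteF.prems(3) by simp
  obtain k where k: "k \<le> t" "(?f ^^ k) (conf K z (q + length ?a + 2) s w) = conf K z ?e s1 w1"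
  proof -
    have "P = (A @ IBr b (q + length ?a + 2) # ?a @ [IJmp ?e]) @ ?b @ B"
      "q + length ?a + 2 = length (A @ IBr b (q + length ?a + 2) # ?a @ [IJmp ?e]) + 3"
      "regs_below K c2"
      using P exec_IteF.prems(2,3) by auto
    from exec_IteF.IH[OF this] that show thesis by blast
  qed
  have "(?f ^^ (k + 1)) (conf K z q s w) = conf K z ?e s1 w1"
    unfolding funpow_add comp_apply using s1 k by simp
  then show ?case using k(1) by (intro exI[of _ "k + 1"]) (simp add: Let_def add.assoc)
next
  case (exec_WhlF b s c w)
  let ?f = "step (machine K P)" and ?a = "compile c (q + 1)"
  have P: "P = A @ IBr b (q + length ?a + 2) # ?a @ IJmp q # B"
    using exec_WhlF.prems by (simp add: Let_def add.assoc)
  have e: "q + length ?a + 2 \<le> length P + 3"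
    using exec_WhlF.prems(2) by (simp_all add: P)
  have s1: "?f (conf K z q s w) = conf K z (q + length ?a + 2) s w"
    using step_conf_IBr[OF P exec_WhlF.prems(2) e(1), of K z s w] exec_WhlF.hyps(1)
        exec_WhlF.prems(3) by simp
  then show ?case by (intro exI[of _ 1]) (simp add: Let_def add.assoc)
next
  case (exec_WhlT b s c w t1 s1 w1 t2 s2 w2)
  let ?f = "step (machine K P)" and ?a = "compile c (q + 1)"
  have P: "P = A @ IBr b (q + length ?a + 2) # ?a @ IJmp q # B"
    using exec_WhlT.prems by (simp add: Let_def add.assoc)
  have e: "q + length ?a + 2 \<le> length P + 3"
    using exec_WhlT.prems(2) by (simp_all add: P)
  have s1: "?f (conf K z q s w) = conf K z (q + 1) s w"
    using step_conf_IBr[OF P exec_WhlT.prems(2) e(1), of K z s w] exec_WhlT.hyps(1)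
        exec_WhlT.prems(3) by simp
  obtain k where k: "k \<le> t1" "(?f ^^ k) (conf K z (q + 1) s w) = conf K z (q + 1 + length ?a)
      s1 w1"
  proof -
    have "P = (A @ [IBr b (q + length ?a + 2)]) @ ?a @ IJmp q # B"
      "q + 1 = length (A @ [IBr b (q + length ?a + 2)]) + 3" "regs_below K c"
      using P exec_WhlT.prems(2,3) by auto
    from exec_WhlT.IH(1)[OF this] that show thesis by blast
  qed
  have s2: "?f (conf K z (q + 1 + length ?a) s1 w1) = conf K z q s1 w1"
    using step_conf_IJmp[of P "A @ IBr b (q + length ?a + 2) # ?a" q B
        "q + 1 + length ?a" K z s1 w1] P e exec_WhlT.prems(2) by simp
  obtain k' where k': "k' \<le> t2"
    "(?f ^^ k') (conf K z q s1 w1) = conf K z (q + length (compile (Whl b c) q)) s2 w2"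
    using exec_WhlT.IH(2)[OF exec_WhlT.prems] by blast
  have "(?f ^^ (k' + (1 + (k + 1)))) (conf K z q s w) =
      conf K z (q + length (compile (Whl b c) q)) s2 w2"
    unfolding funpow_add comp_apply using s1 s2 k k' by simp
  then show ?case using k(1) k'(1) by (intro exI[of _ "k' + (1 + (k + 1))"]) auto
next
  case (exec_weaken c s w t s1 w1 t')
  from exec_weaken.IH[OF exec_weaken.prems] exec_weaken.hyps(2) show ?case by (meson le_trans)
qed

section \<open>Loading the input and rewinding the output\<close>

lemma conf_zero: "reg_tapes K z (\<lambda>_. 0) = replicate K (0, reg_cell z)"
  by (simp add: reg_tapes_def map_replicate_const)

lemma map2_replicate:
  "map2 f (x # replicate K a) (y # replicate K b) = f x y # replicate K (f a b)"
  by (simp add: zip_replicate)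

lemma map2_stay: "map2 tape_act (map (\<lambda>a. (a, Stay)) (map tape_read ts)) ts = ts"
  by (induction ts) (auto simp: tape_act_stay)

lemma tape_of_Nil: "tape_of [] = (0, \<lambda>i. 0)"
  by (auto simp: tape_of_def)

text \<open>The configuration after \<open>j\<close> cells have been moved. It occurs from
  \<open>j = 1\<close> on, since the first cell is handled in state \<open>0\<close>, which also
  writes the mark.\<close>

definition copy_conf :: "nat \<Rightarrow> bool list \<Rightarrow> nat \<Rightarrow> config" where
  "copy_conf K z j = (1, (int j, \<lambda>i. if int j \<le> i \<and> i < int (length z) then sym (z
      ! nat i) else 0) #
     replicate K (int j, \<lambda>i. if i < int j then reg_cell z i else 0))"

lemma copy_start:
  assumes "z \<noteq> []"
  shows "step (machine K P) (init (machine K P) z) = copy_conf K z 1"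
proof -
  have a: "sym (z ! 0) \<noteq> 0" "sym (z ! 0) < 3" by (auto simp: sym_def)
  have "(\<lambda>i. if 0 \<le> i \<and> i < int (length z) then sym (z ! nat i) else 0)(0 := 0) =
      (\<lambda>i. if 1 \<le> i \<and> i < int (length z) then sym (z ! nat i) else 0)"
    by auto
  moreover have "(\<lambda>i. 0)(0 := 3 + sym (z ! 0)) = (\<lambda>i. if i < 1 then reg_cell z i
      else 0)"
    using assms by (auto simp: reg_cell_def fun_eq_iff)
  ultimately show ?thesis
    using assms a
    by (simp add: init_def copy_conf_def machine_def machine_delta_def tape_of_def[of z] tape_of_Nil
        map2_replicate Let_def)
qed

lemma copy_step:
  assumes "1 \<le> j" "j < length z"
  shows "step (machine K P) (copy_conf K z j) = copy_conf K z (Suc j)"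
proof -
  have a: "sym (z ! j) \<noteq> 0" by (auto simp: sym_def)
  have "(\<lambda>i. if int j \<le> i \<and> i < int (length z) then sym (z ! nat i) else 0)(int j
      := 0) =
      (\<lambda>i. if int (Suc j) \<le> i \<and> i < int (length z) then sym (z ! nat i) else 0)"
    by auto
  moreover have "(\<lambda>i. if i < int j then reg_cell z i else 0)(int j := sym (z ! j)) =
      (\<lambda>i. if i < int (Suc j) then reg_cell z i else 0)"
    using assms by (auto simp: reg_cell_def fun_eq_iff)
  ultimately show ?thesis
    using assms a
    by (simp add: copy_conf_def machine_def machine_delta_def map2_replicate add.commute)
qed

definition rewind_conf :: "nat \<Rightarrow> bool list \<Rightarrow> nat \<Rightarrow> config" where
  "rewind_conf K z j = (2, out_tape z [] # replicate K (int j, reg_cell z))"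

lemma copy_end:
  assumes "z \<noteq> []"
  shows "step (machine K P) (copy_conf K z (length z)) = rewind_conf K z (length z)"
proof -
  have "(\<lambda>i. if int (length z) \<le> i \<and> i < int (length z) then sym (z ! nat i) else
      0) = (\<lambda>i. 0)"
    by auto
  moreover have "(\<lambda>i. if i < int (length z) then reg_cell z i else 0) = reg_cell z"
    using assms by (auto simp: reg_cell_def fun_eq_iff)
  moreover have "out_tape z [] = (int (length z), \<lambda>i. 0)"
    by (auto simp: out_tape_def)
  ultimately show ?thesis
    using map2_stay[of "out_tape z [] # replicate K (int (length z), reg_cell z)"]
    by (simp add: copy_conf_def rewind_conf_def machine_def machine_delta_def)
qed

lemma rewind_start_empty:
  "step (machine K P) (init (machine K P) []) = rewind_conf K [] 0"
proof -
  have "(\<lambda>i. 0)(0 := 3) = reg_cell []" by (auto simp: reg_cell_def fun_eq_iff)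
  moreover have "out_tape [] [] = (0, \<lambda>i. 0)" "(\<lambda>i::int. 0::nat)(0 := 0) =
      (\<lambda>i. 0)"
    by (auto simp: out_tape_def)
  ultimately show ?thesis
    by (simp add: init_def rewind_conf_def machine_def machine_delta_def tape_of_Nil map2_replicate
        Let_def)
qed

lemma rewind_step:
  assumes "K \<ge> 1"
  shows "step (machine K P) (rewind_conf K z (Suc j)) = rewind_conf K z j"
proof -
  have [simp]: "(reg_cell z)(i := reg_cell z i) = reg_cell z" for i by auto
  have lt: "reg_cell z (1 + int j) < 3" by (auto simp: reg_cell_def sym_def)
  have "map2 tape_act ((tape_read t0, Stay) # replicate K (reg_cell z (1 + int j), Move_Left))
      (t0 # replicate K (1 + int j, reg_cell z)) = t0 # replicate K (int j, reg_cell z)" for t0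
    by (simp add: map2_replicate tape_act_stay)
  then show ?thesis
    using assms lt
    by (simp add: rewind_conf_def machine_def machine_delta_def)
qed

lemma rewind_end:
  assumes "K \<ge> 1"
  shows "step (machine K P) (rewind_conf K z 0) = conf K z 3 (\<lambda>_. 0) []"
proof -
  have "reg_cell z 0 \<ge> 3" by (auto simp: reg_cell_def)
  then show ?thesis
    using assms map2_stay[of "out_tape z [] # replicate K (0, reg_cell z)"]
    by (simp add: rewind_conf_def machine_def machine_delta_def conf_def conf_zero)
qed

lemma funpow_steps:
  assumes "\<And>j. a \<le> j \<Longrightarrow> j < b \<Longrightarrow> f (g j) = g (Suc j)" "a
      \<le> b"
  shows "(f ^^ (b - a)) (g a) = g b"
proof -
  have "(f ^^ k) (g a) = g (a + k)" if "a + k \<le> b" for k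
    using that by (induction k) (use assms(1) in auto)
  from this[of "b - a"] show ?thesis using assms(2) by simp
qed

lemma rewind_steps:
  assumes "K \<ge> 1"
  shows "(step (machine K P) ^^ j) (rewind_conf K z j) = rewind_conf K z 0"
  by (induction j) (simp_all add: rewind_step[OF assms] funpow_swap1 del: funpow.simps
      add: funpow_Suc_right)

lemma prelude_steps:
  assumes "K \<ge> 1"
  shows "\<exists>k \<le> 2 * length z + 2. (step (machine K P) ^^ k) (init (machine K P) z) = conf
      K z 3 (\<lambda>_. 0) []"
proof -
  let ?f = "step (machine K P)"
  have "\<exists>k \<le> length z + 1. (?f ^^ k) (init (machine K P) z) = rewind_conf K z (length
      z)"
  proof (cases "z = []")
    case True
    then show ?thesis using rewind_start_empty by (intro exI[of _ 1]) simp
  next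
    case False
    then have "1 \<le> length z" by (cases z) auto
    from funpow_steps[of 1 "length z" ?f "copy_conf K z", OF copy_step this]
    have "(?f ^^ (1 + ((length z - 1) + 1))) (init (machine K P) z) = rewind_conf K z (length z)"
      unfolding funpow_add comp_apply using copy_start[OF False] copy_end[OF False] by simp
    then show ?thesis using \<open>1 \<le> length z\<close> by (intro exI[of _ "1 + ((length z - 1)
        + 1)"]) simp
  qed
  then obtain k where k: "k \<le> length z + 1"
    "(?f ^^ k) (init (machine K P) z) = rewind_conf K z (length z)" by blast
  \<comment> \<open>Copying takes at most \<open>length z + 1\<close> steps, rewinding
    \<open>length z\<close>, and one more step recognises the mark.\<close>
  have "(?f ^^ (1 + (length z + k))) (init (machine K P) z) = conf K z 3 (\<lambda>_. 0) []"
    unfolding funpow_add comp_apply using k(2) rewind_steps[OF assms] rewind_end[OF assms] by simp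
  then show ?thesis using k(1) by (intro exI[of _ "1 + (length z + k)"]) simp
qed

definition out_conf :: "nat \<Rightarrow> bool list \<Rightarrow> nat \<Rightarrow> regs
    \<Rightarrow> bool list \<Rightarrow> int \<Rightarrow> config" where
  "out_conf K z q s w h = (q, (h, snd (out_tape z w)) # reg_tapes K z s)"

lemma step_out_conf:
  assumes "machine_delta K P q (snd (out_tape z w) h # map tape_read (reg_tapes K z s)) =
    Some (q', act_at 0 (\<lambda>a. (a, m)) (snd (out_tape z w) h # map tape_read (reg_tapes K z
        s)))"
  shows "step (machine K P) (out_conf K z q s w h) = out_conf K z q' s w (h + shift m)"
proof -
  have [simp]: "(snd (out_tape z w))(h := snd (out_tape z w) h) = snd (out_tape z w)" by auto
  show ?thesis
    unfolding out_conf_def using assms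
    by (subst step_act_at[where q' = q' and k = 0 and f = "\<lambda>a. (a, m)"]) simp_all
qed

lemma rewind_output:
  "\<exists>k \<le> length w + 2. (step (machine K P) ^^ k) (conf K z (3 + length P) s w) =
     out_conf K z (5 + length P) s w (int (length z))"
proof -
  let ?f = "step (machine K P)" and ?n = "int (length z)" and ?q = "4 + length P"
  have 1: "?f (conf K z (3 + length P) s w) = out_conf K z ?q s w (?n + int (length w) - 1)"
    using step_out_conf[of K P "3 + length P" z w "?n + int (length w)" s ?q Move_Left]
    by (simp add: conf_def out_conf_def out_tape_def machine_delta_def)
  have 2: "?f (out_conf K z ?q s w (?n + int j)) = out_conf K z ?q s w (?n + int j - 1)"
    if "j < length w" for j
    using that by (subst step_out_conf[where m = Move_Left])
      (auto simp: out_tape_def machine_delta_def sym_def)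
  have 3: "?f (out_conf K z ?q s w (?n - 1)) = out_conf K z (5 + length P) s w ?n"
    by (subst step_out_conf[where m = Move_Right]) (auto simp: out_tape_def machine_delta_def)
  have 4: "(?f ^^ j) (out_conf K z ?q s w (?n + int j - 1)) = out_conf K z ?q s w (?n - 1)"
    if "j \<le> length w" for j
    using that
  proof (induction j)
    case (Suc j)
    then show ?case using 2[of j] by (simp add: funpow_Suc_right del: funpow.simps)
  qed simp
  have "(?f ^^ (1 + (length w + 1))) (conf K z (3 + length P) s w) = out_conf K z (5 + length P) s
      w ?n"
    unfolding funpow_add comp_apply using 1 3 4[of "length w"] by simp
  then show ?thesis by (intro exI[of _ "1 + (length w + 1)"]) simp
qed

theorem exec_computes:
  assumes "\<And>x. exec x c (\<lambda>_. 0) [] (poly p (length x)) (s x) (f x)"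
  shows "poly_time_computable f"
proof -
  obtain K where K: "K \<ge> 1" "regs_below K c" using regs_below_exists by blast
  let ?P = "compile c 3"
  let ?M = "machine K ?P"
  \<comment> \<open>The prelude takes at most \<open>2 * length x + 2\<close> steps, the program
    \<open>poly p (length x)\<close>, and the final rewind \<open>length (f x) + 2\<close>. The
    output is no longer than the running time of the program.\<close>
  have "computes_within ?M x (f x) (poly (2 * p + [:4, 2:]) (length x))" for x
  proof -
    let ?f = "step ?M" and ?t = "poly p (length x)"
    obtain k1 where k1: "k1 \<le> 2 * length x + 2" "(?f ^^ k1) (init ?M x) = conf K x 3
        (\<lambda>_. 0) []"
      using prelude_steps[OF K(1)] by blast
    obtain k2 where k2: "k2 \<le> ?t"
      "(?f ^^ k2) (conf K x 3 (\<lambda>_. 0) []) = conf K x (3 + length ?P) (s x) (f x)"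
      using exec_machine[OF assms, of ?P "[]" 3 "[]" K x] K by auto
    obtain k3 where k3: "k3 \<le> length (f x) + 2"
      "(?f ^^ k3) (conf K x (3 + length ?P) (s x) (f x)) =
       out_conf K x (5 + length ?P) (s x) (f x) (int (length x))"
      using rewind_output by blast
    have len: "length (f x) \<le> ?t" using exec_length[OF assms[of x]] by simp
    have e: "(?f ^^ (k3 + (k2 + k1))) (init ?M x) =
        out_conf K x (5 + length ?P) (s x) (f x) (int (length x))"
      unfolding funpow_add comp_apply using k1 k2 k3 by simp
    have "halted ?M (out_conf K x (5 + length ?P) (s x) (f x) (int (length x)))"
      by (simp add: out_conf_def machine_def machine_delta_def)
    moreover have "tape_holds (hd (snd (out_conf K x (5 + length ?P) (s x) (f x) (int (length
        x))))) (f x)"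
      by (auto simp: out_conf_def out_tape_def)
    ultimately show ?thesis
      unfolding computes_within_def using e k1(1) k2(1) k3(1) len
      by (intro exI[of _ "k3 + (k2 + k1)"]) (simp add: algebra_simps)
  qed
  then show ?thesis
    unfolding poly_time_computable_def using wf_machine[OF K(1)] by blast
qed

section \<open>Bounded arithmetic in polynomial time\<close>

text \<open>Terms denote polynomials in the length and the variables, which keeps all values and
  loop counts polynomial. The bits are given by a predicate rather than by the input string, so that
  one formula can be read on an input or on a certificate.\<close>

datatype trm = TV nat | TC nat | TLen | TAdd trm trm | TMul trm trm
datatype fm = FLt trm trm | FBit trm | FNeg fm | FAnd fm fm | FEx trm fm
datatype oe = OEmit bool | OCat oe oe | OIf fm oe oe | OFor trm oe

primrec tev :: "trm \<Rightarrow> nat \<Rightarrow> (nat \<Rightarrow> nat) \<Rightarrow> nat" where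
  "tev (TV k) n e = e k"
| "tev (TC c) n e = c"
| "tev TLen n e = n"
| "tev (TAdd a b) n e = tev a n e + tev b n e"
| "tev (TMul a b) n e = tev a n e * tev b n e"

primrec fev :: "fm \<Rightarrow> nat \<Rightarrow> (nat \<Rightarrow> bool) \<Rightarrow> (nat
    \<Rightarrow> nat) \<Rightarrow> bool" where
  "fev (FLt a b) n B e \<longleftrightarrow> tev a n e < tev b n e"
| "fev (FBit t) n B e \<longleftrightarrow> B (tev t n e)"
| "fev (FNeg f) n B e \<longleftrightarrow> \<not> fev f n B e"
| "fev (FAnd f g) n B e \<longleftrightarrow> fev f n B e \<and> fev g n B e"
| "fev (FEx t f) n B e \<longleftrightarrow> (\<exists>i < tev t n e. fev f n B (case_nat i e))"

primrec oev :: "oe \<Rightarrow> nat \<Rightarrow> (nat \<Rightarrow> bool) \<Rightarrow> (nat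
    \<Rightarrow> nat) \<Rightarrow> bool list" where
  "oev (OEmit b) n B e = [b]"
| "oev (OCat x y) n B e = oev x n B e @ oev y n B e"
| "oev (OIf f x y) n B e = (if fev f n B e then oev x n B e else oev y n B e)"
| "oev (OFor t x) n B e = concat (map (\<lambda>i. oev x n B (case_nat i e)) [0..<tev t n e])"

definition bits_of :: "bool list \<Rightarrow> nat \<Rightarrow> bool" where
  "bits_of z i \<longleftrightarrow> i < length z \<and> z ! i"

section \<open>Polynomial bounds on values and on inspected bits\<close>

lemma poly_mono_nat: "x \<le> y \<Longrightarrow> poly (p :: nat poly) x \<le> poly p y"
proof (induction p)
  case (pCons a p)
  then have "x * poly p x \<le> y * poly p y" by (intro mult_mono) auto
  then show ?case by simp
qed simp

text \<open>A single number \<open>b\<close> bounds both the length and all variables. This is the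
  form that passes under binders: a bound variable merely enlarges \<open>b\<close>.\<close>

lemma tev_bound: "\<exists>q. \<forall>n e b. n \<le> b \<longrightarrow> (\<forall>k. e k \<le> b)
    \<longrightarrow> tev t n e \<le> poly q b"
proof (induction t)
  case (TV k)
  show ?case by (intro exI[of _ "[:0, 1:]"]) simp
next
  case (TC c)
  show ?case by (intro exI[of _ "[:c:]"]) simp
next
  case TLen
  show ?case by (intro exI[of _ "[:0, 1:]"]) simp
next
  case (TAdd s t)
  then obtain p q where
    "\<And>n e b. n \<le> b \<Longrightarrow> (\<forall>k. e k \<le> b) \<Longrightarrow> tev s n e
        \<le> poly p b"
    "\<And>n e b. n \<le> b \<Longrightarrow> (\<forall>k. e k \<le> b) \<Longrightarrow> tev t n e
        \<le> poly q b" by blast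
  then show ?case by (intro exI[of _ "p + q"]) (auto intro: add_mono)
next
  case (TMul s t)
  then obtain p q where
    "\<And>n e b. n \<le> b \<Longrightarrow> (\<forall>k. e k \<le> b) \<Longrightarrow> tev s n e
        \<le> poly p b"
    "\<And>n e b. n \<le> b \<Longrightarrow> (\<forall>k. e k \<le> b) \<Longrightarrow> tev t n e
        \<le> poly q b" by blast
  then show ?case by (intro exI[of _ "p * q"]) (auto intro: mult_mono)
qed

lemma case_nat_le:
  "i \<le> b \<Longrightarrow> (\<forall>k. e k \<le> b) \<Longrightarrow> \<forall>k. (case k of 0
      \<Rightarrow> i | Suc k \<Rightarrow> e k) \<le> (b :: nat)"
  by (auto split: nat.splits)

text \<open>This is what makes certificates short: an arbitrary predicate of bits can be cut off at
  a polynomial position without changing the truth value.\<close>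

lemma fev_support:
  "\<exists>q. \<forall>n e b B B'. n \<le> b \<longrightarrow> (\<forall>k. e k \<le> b)
      \<longrightarrow> (\<forall>i < poly q b. B i = B' i) \<longrightarrow>
     fev f n B e = fev f n B' e"
proof (induction f)
  case (FLt s t)
  show ?case by simp
next
  case (FBit t)
  obtain q where "\<And>n e b. n \<le> b \<Longrightarrow> (\<forall>k. e k \<le> b)
      \<Longrightarrow> tev t n e \<le> poly q b"
    using tev_bound by blast
  then show ?case by (intro exI[of _ "q + 1"]) (auto simp: less_Suc_eq_le)
next
  case (FNeg f)
  then obtain q where "\<And>n e b B B'. n \<le> b \<Longrightarrow> (\<forall>k. e k \<le> b)
      \<Longrightarrow> (\<forall>i < poly q b. B i = B' i) \<Longrightarrow>
     fev f n B e = fev f n B' e" by blast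
  then show ?case by (intro exI[of _ q]) (metis fev.simps(3))
next
  case (FAnd f g)
  then obtain p q where "\<And>n e b B B'. n \<le> b \<Longrightarrow> (\<forall>k. e k \<le> b)
      \<Longrightarrow> (\<forall>i < poly p b. B i = B' i) \<Longrightarrow>
     fev f n B e = fev f n B' e"
    "\<And>n e b B B'. n \<le> b \<Longrightarrow> (\<forall>k. e k \<le> b) \<Longrightarrow>
        (\<forall>i < poly q b. B i = B' i) \<Longrightarrow>
     fev g n B e = fev g n B' e" by blast
  then show ?case
    by (intro exI[of _ "p + q"]) (smt (verit, best) fev.simps(4) poly_add trans_less_add1
        trans_less_add2)
next
  case (FEx t f)
  then obtain p where p: "\<And>n e b B B'. n \<le> b \<Longrightarrow> (\<forall>k. e k \<le> b)
      \<Longrightarrow> (\<forall>i < poly p b. B i = B' i) \<Longrightarrow>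
     fev f n B e = fev f n B' e" by blast
  obtain q where q: "\<And>n e b. n \<le> b \<Longrightarrow> (\<forall>k. e k \<le> b)
      \<Longrightarrow> tev t n e \<le> poly q b"
    using tev_bound by blast
  show ?case
  \<comment> \<open>Inside the quantifier the variables are bounded by \<open>b + poly q b\<close>
    instead of \<open>b\<close>, hence the composition of polynomials.\<close>
  proof (intro exI[of _ "pcompose p ([:0, 1:] + q)"] allI impI)
    fix n b B B' and e :: "nat \<Rightarrow> nat"
    assume a: "n \<le> b" "\<forall>k. e k \<le> b" "\<forall>i < poly (pcompose p ([:0, 1:] + q))
        b. B i = (B' i :: bool)"
    have "fev f n B (case_nat i e) = fev f n B' (case_nat i e)" if "i < tev t n e" for i
    proof (rule p[of n "b + poly q b"])
      show "n \<le> b + poly q b" using a(1) by simp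
      show "\<forall>k. (case k of 0 \<Rightarrow> i | Suc k \<Rightarrow> e k) \<le> b + poly q b"
        using q[OF a(1,2)] that a(2) by (intro case_nat_le) (auto intro: trans_le_add1)
      show "\<forall>i < poly p (b + poly q b). B i = B' i" using a(3) by (simp add: poly_pcompose)
    qed
    then show "fev (FEx t f) n B e = fev (FEx t f) n B' e" by auto
  qed
qed

lemma oev_support:
  "\<exists>q. \<forall>n e b B B'. n \<le> b \<longrightarrow> (\<forall>k. e k \<le> b)
      \<longrightarrow> (\<forall>i < poly q b. B i = B' i) \<longrightarrow>
     oev x n B e = oev x n B' e"
proof (induction x)
  case (OEmit b)
  show ?case by simp
next
  case (OCat x y)
  then obtain p q where "\<And>n e b B B'. n \<le> b \<Longrightarrow> (\<forall>k. e k \<le> b)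
      \<Longrightarrow> (\<forall>i < poly p b. B i = B' i) \<Longrightarrow>
     oev x n B e = oev x n B' e"
    "\<And>n e b B B'. n \<le> b \<Longrightarrow> (\<forall>k. e k \<le> b) \<Longrightarrow>
        (\<forall>i < poly q b. B i = B' i) \<Longrightarrow>
     oev y n B e = oev y n B' e" by blast
  then show ?case
    by (intro exI[of _ "p + q"]) (smt (verit, best) oev.simps(2) poly_add trans_less_add1
        trans_less_add2)
next
  case (OIf f x y)
  then obtain p q where pq: "\<And>n e b B B'. n \<le> b \<Longrightarrow> (\<forall>k. e k \<le>
      b) \<Longrightarrow> (\<forall>i < poly p b. B i = B' i) \<Longrightarrow>
     oev x n B e = oev x n B' e"
    "\<And>n e b B B'. n \<le> b \<Longrightarrow> (\<forall>k. e k \<le> b) \<Longrightarrow>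
        (\<forall>i < poly q b. B i = B' i) \<Longrightarrow>
     oev y n B e = oev y n B' e" by blast
  obtain r where r: "\<And>n e b B B'. n \<le> b \<Longrightarrow> (\<forall>k. e k \<le> b)
      \<Longrightarrow> (\<forall>i < poly r b. B i = B' i) \<Longrightarrow>
     fev f n B e = fev f n B' e" using fev_support by blast
  show ?case
  proof (intro exI[of _ "p + q + r"] allI impI)
    fix n b B B' and e :: "nat \<Rightarrow> nat"
    assume a: "n \<le> b" "\<forall>k. e k \<le> b" "\<forall>i < poly (p + q + r) b. B i = (B' i
        :: bool)"
    show "oev (OIf f x y) n B e = oev (OIf f x y) n B' e"
      using pq(1)[OF a(1,2), of B B'] pq(2)[OF a(1,2), of B B'] r[OF a(1,2), of B B'] a(3) by simp
  qed
next
  case (OFor t x)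
  then obtain p where p: "\<And>n e b B B'. n \<le> b \<Longrightarrow> (\<forall>k. e k \<le> b)
      \<Longrightarrow> (\<forall>i < poly p b. B i = B' i) \<Longrightarrow>
     oev x n B e = oev x n B' e" by blast
  obtain q where q: "\<And>n e b. n \<le> b \<Longrightarrow> (\<forall>k. e k \<le> b)
      \<Longrightarrow> tev t n e \<le> poly q b"
    using tev_bound by blast
  show ?case
  proof (intro exI[of _ "pcompose p ([:0, 1:] + q)"] allI impI)
    fix n b B B' and e :: "nat \<Rightarrow> nat"
    assume a: "n \<le> b" "\<forall>k. e k \<le> b" "\<forall>i < poly (pcompose p ([:0, 1:] + q))
        b. B i = (B' i :: bool)"
    have "oev x n B (case_nat i e) = oev x n B' (case_nat i e)" if "i < tev t n e" for i
    proof (rule p[of n "b + poly q b"])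
      show "n \<le> b + poly q b" using a(1) by simp
      show "\<forall>k. (case k of 0 \<Rightarrow> i | Suc k \<Rightarrow> e k) \<le> b + poly q b"
        using q[OF a(1,2)] that a(2) by (intro case_nat_le) (auto intro: trans_le_add1)
      show "\<forall>i < poly p (b + poly q b). B i = B' i" using a(3) by (simp add: poly_pcompose)
    qed
    then show "oev (OFor t x) n B e = oev (OFor t x) n B' e"
      by (auto intro!: arg_cong[where f = concat])
  qed
qed

section \<open>Compilation of terms, formulas and printing loops\<close>

definition clear :: "nat \<Rightarrow> cmd" where
  "clear r = Whl (NZ r) (Seq (Dec r) Skip)"

text \<open>Reading a counter destroys it, so its value is collected in \<open>h\<close> as well and
  moved back in the second loop.\<close>

definition add_to :: "nat \<Rightarrow> nat \<Rightarrow> nat \<Rightarrow> cmd" where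
  "add_to a d h = Seq (Whl (NZ a) (Seq (Dec a) (Seq (Inc d) (Inc h))))
     (Whl (NZ h) (Seq (Dec h) (Inc a)))"

text \<open>
  Register \<open>0\<close> holds truth values. The list \<open>vs\<close> maps de Bruijn indices
      to registers, and all
  registers from \<open>d\<close> on are free and hold \<open>0\<close>.
\<close>

primrec ctrm :: "trm \<Rightarrow> nat list \<Rightarrow> nat \<Rightarrow> cmd" where
  "ctrm (TV k) vs d = (if k < length vs then add_to (vs ! k) d (d + 1) else Skip)"
| "ctrm (TC c) vs d = (Seq (Inc d) ^^ c) Skip"
| "ctrm TLen vs d = Whl (NB d) (Inc d)"
| "ctrm (TAdd a b) vs d = Seq (ctrm a vs d) (Seq (ctrm b vs (d + 1))
     (Whl (NZ (d + 1)) (Seq (Dec (d + 1)) (Inc d))))"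
| "ctrm (TMul a b) vs d = Seq (ctrm a vs (d + 1)) (Seq (ctrm b vs (d + 2))
     (Seq (Whl (NZ (d + 1)) (Seq (Dec (d + 1)) (add_to (d + 2) d (d + 3)))) (clear (d + 2))))"

primrec cfm :: "fm \<Rightarrow> nat list \<Rightarrow> nat \<Rightarrow> cmd" where
  "cfm (FLt a b) vs d = Seq (ctrm a vs d) (Seq (ctrm b vs (d + 1))
     (Seq (Whl (NZ d) (Seq (Dec d) (Dec (d + 1))))
       (Seq (Ite (NZ (d + 1)) (Inc 0) Skip) (clear (d + 1)))))"
| "cfm (FBit t) vs d = Seq (ctrm t vs d) (Seq (Ite (BT d) (Inc 0) Skip) (clear d))"
| "cfm (FNeg f) vs d = Seq (cfm f vs d) (Ite (NZ 0) (Dec 0) (Inc 0))"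
| "cfm (FAnd f g) vs d = Seq (cfm f vs d) (Ite (NZ 0) (Seq (Dec 0) (cfm g vs d)) Skip)"
| "cfm (FEx t f) vs d = Seq (ctrm t vs d)
     (Seq (Whl (NZ d) (Seq (Dec d) (Seq (Ite (NZ 0) Skip (cfm f ((d + 1) # vs) (d + 2))) (Inc (d +
         1)))))
       (clear (d + 1)))"

primrec coe :: "oe \<Rightarrow> nat list \<Rightarrow> nat \<Rightarrow> cmd" where
  "coe (OEmit b) vs d = Emit b"
| "coe (OCat x y) vs d = Seq (coe x vs d) (coe y vs d)"
| "coe (OIf f x y) vs d = Seq (cfm f vs d) (Ite (NZ 0) (Seq (Dec 0) (coe x vs d)) (coe y vs d))"
| "coe (OFor t x) vs d = Seq (ctrm t vs d)
     (Seq (Whl (NZ d) (Seq (Dec d) (Seq (coe x ((d + 1) # vs) (d + 2)) (Inc (d + 1)))))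
       (clear (d + 1)))"

text \<open>The loop rule for counted loops: \<open>S j\<close> and \<open>W j\<close> are the
  registers and the output after \<open>j\<close> rounds. The body starts with the counter already
  decreased. A round costs \<open>t\<close> plus one step for \<open>Dec\<close> and two for branch
  and jump.\<close>

lemma exec_loop:
  assumes r: "\<And>j. j \<le> m \<Longrightarrow> S j r = m - j"
    and body: "\<And>j. j < m \<Longrightarrow> exec z c ((S j)(r := m - Suc j)) (W j) t (S (Suc
        j)) (W (Suc j))"
  shows "exec z (Whl (NZ r) (Seq (Dec r) c)) (S 0) (W 0) (m * (t + 3) + 1) (S m) (W m)"
proof -
  have "exec z (Whl (NZ r) (Seq (Dec r) c)) (S (m - k)) (W (m - k)) (k * (t + 3) + 1) (S m) (W m)"
    if "k \<le> m" for k
    using that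
  proof (induction k)
    case 0
    show ?case using exec_WhlF[of z "NZ r" "S m"] r[of m] by simp
  next
    case (Suc k)
    let ?j = "m - Suc k"
    have j: "?j < m" "Suc ?j = m - k" using Suc.prems by auto
    have "exec z (Dec r) (S ?j) (W ?j) 1 ((S ?j)(r := m - Suc ?j)) (W ?j)"
      using exec_Dec[of z r "S ?j" "W ?j"] r[of ?j] j Suc.prems by simp
    from exec_Seq[OF this body[OF j(1)]]
    have "exec z (Seq (Dec r) c) (S ?j) (W ?j) (1 + t) (S (m - k)) (W (m - k))"
      by (simp add: j(2))
    moreover have "tval z (NZ r) (S ?j)" using r[of ?j] Suc.prems by simp
    ultimately have "exec z (Whl (NZ r) (Seq (Dec r) c)) (S ?j) (W ?j)
        (1 + t + (k * (t + 3) + 1) + 2) (S m) (W m)"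
      using Suc by (intro exec_WhlT) auto
    then show ?case by (rule exec_weaken) (simp add: algebra_simps)
  qed
  from this[of m] show ?thesis by simp
qed

lemma exec_cong:
  "exec z c s w t s1 w1 \<Longrightarrow> t \<le> t' \<Longrightarrow> c = c' \<Longrightarrow> s1
      = s1' \<Longrightarrow> exec z c' s w t' s1' w1"
  using exec_weaken by blast

lemma exec_clear: "exec z (clear r) s w (3 * s r + 1) (s(r := 0)) w"
  using exec_loop[of "s r" "\<lambda>j. s(r := s r - j)" r z Skip "\<lambda>_. w" 0]
  by (simp add: clear_def exec_Skip mult.commute)

lemma exec_add_to:
  assumes "a \<noteq> d" "a \<noteq> h" "d \<noteq> h" "s h = 0"
  shows "exec z (add_to a d h) s w (9 * s a + 2) (s(d := s d + s a)) w"
proof -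
  have "exec z (Whl (NZ a) (Seq (Dec a) (Seq (Inc d) (Inc h)))) s w (s a * (2 + 3) + 1)
      (s(a := 0, d := s d + s a, h := s a)) w"
  proof -
    let ?S = "\<lambda>j. s(a := s a - j, d := s d + j, h := j)"
    have "exec z (Seq (Inc d) (Inc h)) ((?S j)(a := s a - Suc j)) w 2 (?S (Suc j)) w" for j
    proof -
      have "exec z (Seq (Inc d) (Inc h)) ((?S j)(a := s a - Suc j)) w (1 + 1)
        (((?S j)(a := s a - Suc j))(d := ((?S j)(a := s a - Suc j)) d + 1,
          h := (((?S j)(a := s a - Suc j))(d := ((?S j)(a := s a - Suc j)) d + 1)) h + 1)) w"
        by (rule exec_Seq[OF exec_Inc exec_Inc])
      moreover have "((?S j)(a := s a - Suc j))(d := ((?S j)(a := s a - Suc j)) d + 1,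
          h := (((?S j)(a := s a - Suc j))(d := ((?S j)(a := s a - Suc j)) d + 1)) h + 1) = ?S (Suc
              j)"
        using assms by (auto simp: fun_eq_iff)
      ultimately show ?thesis by (simp add: numeral_2_eq_2)
    qed
    moreover have "?S 0 = s" using assms by (auto simp: fun_eq_iff)
    ultimately show ?thesis
      using exec_loop[of "s a" ?S a z "Seq (Inc d) (Inc h)" "\<lambda>_. w" 2] assms by simp
  qed
  moreover have "exec z (Whl (NZ h) (Seq (Dec h) (Inc a))) (s(a := 0, d := s d + s a, h := s a)) w
      (s a * (1 + 3) + 1) (s(d := s d + s a)) w"
  proof -
    let ?S = "\<lambda>j. s(a := j, d := s d + s a, h := s a - j)"
    have "exec z (Inc a) ((?S j)(h := s a - Suc j)) w 1 (?S (Suc j)) w" for j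
    proof -
      have "((?S j)(h := s a - Suc j))(a := ((?S j)(h := s a - Suc j)) a + 1) = ?S (Suc j)"
        using assms by (auto simp: fun_eq_iff)
      then show ?thesis using exec_Inc[of z a "(?S j)(h := s a - Suc j)" w] by simp
    qed
    moreover have "?S (s a) = s(d := s d + s a)" using assms by (auto simp: fun_eq_iff)
    ultimately show ?thesis
      using exec_loop[of "s a" ?S h z "Inc a" "\<lambda>_. w" 1] by simp
  qed
  ultimately have "exec z (add_to a d h) s w ((s a * (2 + 3) + 1) + (s a * (1 + 3) + 1)) (s(d := s
      d + s a)) w"
    unfolding add_to_def by (rule exec_Seq)
  then show ?thesis by (rule exec_weaken) simp
qed

text \<open>Indices without a register denote \<open>0\<close>, in accordance with the initial
  environment, in which every variable is \<open>0\<close>.\<close>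

definition layout :: "nat list \<Rightarrow> nat \<Rightarrow> regs \<Rightarrow> (nat
    \<Rightarrow> nat) \<Rightarrow> bool" where
  "layout vs d s e \<longleftrightarrow> 1 \<le> d \<and> (\<forall>r \<in> set vs. 1 \<le> r
      \<and> r < d) \<and> (\<forall>r \<ge> d. s r = 0) \<and>
     (\<forall>k. e k = (if k < length vs then s (vs ! k) else 0))"

lemma layout_mono:
  assumes "layout vs d s e" "d \<le> d'" "\<And>r. 1 \<le> r \<Longrightarrow> r < d
      \<Longrightarrow> s' r = s r" "\<And>r. r \<ge> d' \<Longrightarrow> s' r = 0"
  shows "layout vs d' s' e"
  using assms unfolding layout_def by (auto dest: nth_mem less_le_trans)

lemma layout_cons:
  assumes "layout vs d s e" "\<And>r. 1 \<le> r \<Longrightarrow> r < d \<Longrightarrow> s' r = s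
      r" "s' (d + 1) = i"
    "\<And>r. r \<ge> d + 2 \<Longrightarrow> s' r = 0"
  shows "layout ((d + 1) # vs) (d + 2) s' (case_nat i e)"
  unfolding layout_def
proof (intro conjI allI ballI impI)
  fix k
  show "(case k of 0 \<Rightarrow> i | Suc k \<Rightarrow> e k) = (if k < length ((d + 1) # vs)
      then s' (((d + 1) # vs) ! k) else 0)"
    using assms(1-3) nth_mem[of _ vs] by (cases k) (auto simp: layout_def)
qed (use assms in \<open>auto simp: layout_def\<close>)

lemma exec_const: "exec z ((Seq (Inc d) ^^ c) Skip) s w c (s(d := s d + c)) w"
proof (induction c arbitrary: s)
  case 0
  show ?case using exec_Skip[of z s w] by simp
next
  case (Suc c)
  from exec_Seq[OF exec_Inc Suc.IH[of "s(d := s d + 1)"]] show ?case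
    by (simp del: fun_upd_apply add: fun_upd_same)
qed

lemma exec_len: "k \<le> length z \<Longrightarrow> exec z (Whl (NB d) (Inc d)) (s(d := length z -
    k)) w (3 * k + 1) (s(d := length z)) w"
proof (induction k)
  case 0
  have "exec z (Whl (NB d) (Inc d)) (s(d := length z)) w 1 (s(d := length z)) w"
    by (rule exec_WhlF) simp
  then show ?case by (simp del: fun_upd_apply)
next
  case (Suc k)
  have "exec z (Inc d) (s(d := length z - Suc k)) w 1 (s(d := length z - k)) w"
    using exec_Inc[of z d "s(d := length z - Suc k)" w] Suc.prems by (simp add: Suc_diff_Suc)
  moreover have "tval z (NB d) (s(d := length z - Suc k))" using Suc.prems by simp
  ultimately have "exec z (Whl (NB d) (Inc d)) (s(d := length z - Suc k)) w (1 + (3 * k + 1) + 2)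
      (s(d := length z)) w"
    using Suc.IH Suc.prems by (intro exec_WhlT) (auto simp del: fun_upd_apply)
  then show ?case by (rule exec_weaken) simp
qed

text \<open>The polynomial precedes all other quantifiers, since the body of a loop runs in a new
  environment in every round and all rounds need a common bound. Temporary registers are returned to
  \<open>0\<close>, so the same free registers can be used again.\<close>

lemma ctrm_exec:
  "\<exists>p. \<forall>z vs d s w e b. layout vs d s e \<longrightarrow> length z \<le> b
      \<longrightarrow> (\<forall>k. e k \<le> b) \<longrightarrow>
     exec z (ctrm t vs d) s w (poly p b) (s(d := tev t (length z) e)) w"
proof (induction t)
  case (TV k)
  show ?case
  proof (intro exI[of _ "[:2, 9:]"] allI impI)
    fix z :: "bool list" and vs d s w b and e :: "nat \<Rightarrow> nat"
    assume a: "layout vs d s e" "length z \<le> b" "\<forall>k. e k \<le> b"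
    show "exec z (ctrm (TV k) vs d) s w (poly [:2, 9:] b) (s(d := tev (TV k) (length z) e)) w"
    proof (cases "k < length vs")
      case True
      then have v: "vs ! k < d" "e k = s (vs ! k)" "s d = 0" "s (d + 1) = 0"
        using a(1) by (auto simp: layout_def)
      have "exec z (add_to (vs ! k) d (d + 1)) s w (9 * s (vs ! k) + 2) (s(d := e k)) w"
        using exec_add_to[of "vs ! k" d "d + 1" s z w] v by simp
      moreover have "9 * s (vs ! k) + 2 \<le> poly [:2, 9:] b" using a(3) v(2) by (simp add:
          mult.commute) (metis)
      ultimately show ?thesis by (rule exec_cong) (simp_all add: True)
    next
      case False
      then have "e k = 0" "s(d := 0) = s" using a(1) by (auto simp: layout_def)
      then show ?thesis using False exec_weaken[OF exec_Skip] by simp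
    qed
  qed
next
  case (TC c)
  show ?case
  proof (intro exI[of _ "[:c:]"] allI impI)
    fix z :: "bool list" and vs d s w b and e :: "nat \<Rightarrow> nat"
    assume a: "layout vs d s e" "length z \<le> b" "\<forall>k. e k \<le> b"
    show "exec z (ctrm (TC c) vs d) s w (poly [:c:] b) (s(d := tev (TC c) (length z) e)) w"
      using exec_const[of z c d s w] a(1) by (simp add: layout_def)
  qed
next
  case TLen
  show ?case
  proof (intro exI[of _ "[:1, 3:]"] allI impI)
    fix z :: "bool list" and vs d s w b and e :: "nat \<Rightarrow> nat"
    assume a: "layout vs d s e" "length z \<le> b" "\<forall>k. e k \<le> b"
    have "s(d := length z - length z) = s" using a(1) by (auto simp: layout_def)
    with exec_len[OF order_refl, of z d s w]
    have "exec z (Whl (NB d) (Inc d)) s w (3 * length z + 1) (s(d := length z)) w"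
      by (simp only:)
    then show "exec z (ctrm TLen vs d) s w (poly [:1, 3:] b) (s(d := tev TLen (length z) e)) w"
      by (rule exec_cong) (use a(2) in simp_all)
  qed
next
  case (TAdd x y)
  then obtain p1 p2 where
    1: "\<And>z vs d s w e b. layout vs d s e \<Longrightarrow> length z \<le> b \<Longrightarrow>
        (\<forall>k. e k \<le> b) \<Longrightarrow>
     exec z (ctrm x vs d) s w (poly p1 b) (s(d := tev x (length z) e)) w" and
    2: "\<And>z vs d s w e b. layout vs d s e \<Longrightarrow> length z \<le> b \<Longrightarrow>
        (\<forall>k. e k \<le> b) \<Longrightarrow>
     exec z (ctrm y vs d) s w (poly p2 b) (s(d := tev y (length z) e)) w" by blast
  obtain q where q: "\<And>n e b. n \<le> b \<Longrightarrow> (\<forall>k. e k \<le> b)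
      \<Longrightarrow> tev y n e \<le> poly q b"
    using tev_bound by blast
  show ?case
  proof (intro exI[of _ "p1 + p2 + (4 * q + 1)"] allI impI)
    fix z :: "bool list" and vs d s w b and e :: "nat \<Rightarrow> nat"
    assume a: "layout vs d s e" "length z \<le> b" "\<forall>k. e k \<le> b"
    let ?x = "tev x (length z) e" and ?y = "tev y (length z) e"
    have l: "layout vs (d + 1) (s(d := ?x)) e"
      by (rule layout_mono[OF a(1)]) (use a(1) in \<open>auto simp: layout_def\<close>)
    let ?S = "\<lambda>j. s(d := ?x + j, d + 1 := ?y - j)"
    have "exec z (Inc d) ((?S j)(d + 1 := ?y - Suc j)) w 1 (?S (Suc j)) w" for j
    proof -
      have "((?S j)(d + 1 := ?y - Suc j))(d := ((?S j)(d + 1 := ?y - Suc j)) d + 1) = ?S (Suc j)"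
        by (auto simp: fun_eq_iff)
      then show ?thesis using exec_Inc[of z d "(?S j)(d + 1 := ?y - Suc j)" w] by simp
    qed
    then have "exec z (Whl (NZ (d + 1)) (Seq (Dec (d + 1)) (Inc d))) (?S 0) w (?y * (1 + 3) + 1)
        (?S ?y) w"
      by (intro exec_loop[of ?y ?S "d + 1" z "Inc d" "\<lambda>_. w" 1]) auto
    moreover have "?S ?y = s(d := ?x + ?y)" using a(1) by (auto simp: layout_def fun_eq_iff)
    ultimately have "exec z (Whl (NZ (d + 1)) (Seq (Dec (d + 1)) (Inc d))) (s(d := ?x, d + 1 :=
        ?y)) w
        (?y * (1 + 3) + 1) (s(d := ?x + ?y)) w" by simp
    from exec_Seq[OF 1[OF a] exec_Seq[OF 2[OF l a(2,3)] this]]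
    show "exec z (ctrm (TAdd x y) vs d) s w (poly (p1 + p2 + (4 * q + 1)) b)
        (s(d := tev (TAdd x y) (length z) e)) w"
      by (rule exec_cong) (use q[OF a(2,3)] in simp_all)
  qed
next
  case (TMul x y)
  then obtain p1 p2 where
    1: "\<And>z vs d s w e b. layout vs d s e \<Longrightarrow> length z \<le> b \<Longrightarrow>
        (\<forall>k. e k \<le> b) \<Longrightarrow>
     exec z (ctrm x vs d) s w (poly p1 b) (s(d := tev x (length z) e)) w" and
    2: "\<And>z vs d s w e b. layout vs d s e \<Longrightarrow> length z \<le> b \<Longrightarrow>
        (\<forall>k. e k \<le> b) \<Longrightarrow>
     exec z (ctrm y vs d) s w (poly p2 b) (s(d := tev y (length z) e)) w" by blast
  obtain q1 q2 where q: "\<And>n e b. n \<le> b \<Longrightarrow> (\<forall>k. e k \<le> b)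
      \<Longrightarrow> tev x n e \<le> poly q1 b"
     "\<And>n e b. n \<le> b \<Longrightarrow> (\<forall>k. e k \<le> b) \<Longrightarrow> tev y n
         e \<le> poly q2 b"
    using tev_bound by metis
  show ?case
  proof (intro exI[of _ "p1 + (p2 + (q1 * (9 * q2 + 5) + 1 + (3 * q2 + 1)))"] allI impI)
    fix z :: "bool list" and vs d s w b and e :: "nat \<Rightarrow> nat"
    assume a: "layout vs d s e" "length z \<le> b" "\<forall>k. e k \<le> b"
    let ?x = "tev x (length z) e" and ?y = "tev y (length z) e"
    have z: "s d = 0" "s (d + 1) = 0" "s (d + 2) = 0" "s (d + 3) = 0" using a(1) by (auto simp:
        layout_def)
    have l1: "layout vs (d + 1) s e"
      by (rule layout_mono[OF a(1)]) (use a(1) in \<open>auto simp: layout_def\<close>)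
    have l2: "layout vs (d + 2) (s(d + 1 := ?x)) e"
      by (rule layout_mono[OF a(1)]) (use a(1) in \<open>auto simp: layout_def\<close>)
    let ?S = "\<lambda>j. s(d := j * ?y, d + 1 := ?x - j, d + 2 := ?y)"
    have "exec z (add_to (d + 2) d (d + 3)) ((?S j)(d + 1 := ?x - Suc j)) w (9 * ?y + 2) (?S (Suc
        j)) w" for j
    proof -
      have "((?S j)(d + 1 := ?x - Suc j))(d := ((?S j)(d + 1 := ?x - Suc j)) d +
          ((?S j)(d + 1 := ?x - Suc j)) (d + 2)) = ?S (Suc j)"
        by (auto simp: fun_eq_iff)
      then show ?thesis
        using exec_add_to[of "d + 2" d "d + 3" "(?S j)(d + 1 := ?x - Suc j)" z w] z by simp
    qed
    then have "exec z (Whl (NZ (d + 1)) (Seq (Dec (d + 1)) (add_to (d + 2) d (d + 3)))) (?S 0) w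
        (?x * ((9 * ?y + 2) + 3) + 1) (?S ?x) w"
      by (intro exec_loop[of ?x ?S "d + 1" z _ "\<lambda>_. w"]) auto
    moreover have "?S 0 = s(d + 1 := ?x, d + 2 := ?y)" using z by (auto simp: fun_eq_iff)
    ultimately have loop: "exec z (Whl (NZ (d + 1)) (Seq (Dec (d + 1)) (add_to (d + 2) d (d + 3))))
        (s(d + 1 := ?x, d + 2 := ?y)) w (?x * ((9 * ?y + 2) + 3) + 1) (?S ?x) w" by simp
    have "(?S ?x)(d + 2 := 0) = s(d := ?x * ?y)" using z by (auto simp: fun_eq_iff)
    then have clr: "exec z (clear (d + 2)) (?S ?x) w (3 * ?y + 1) (s(d := ?x * ?y)) w"
      using exec_clear[of z "d + 2" "?S ?x" w] by simp
    have "?x * (9 * ?y + 5) \<le> poly q1 b * (9 * poly q2 b + 5)"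
      using q(1)[OF a(2,3)] q(2)[OF a(2,3)] by (intro mult_mono) auto
    then show "exec z (ctrm (TMul x y) vs d) s w (poly (p1 + (p2 + (q1 * (9 * q2 + 5) + 1 + (3 * q2
        + 1)))) b)
        (s(d := tev (TMul x y) (length z) e)) w"
      by (intro exec_cong[OF exec_Seq[OF 1[OF l1 a(2,3)] exec_Seq[OF 2[OF l2 a(2,3)] exec_Seq[OF
          loop clr]]]])
        (use q(2)[OF a(2,3)] in \<open>simp_all add: add.commute\<close>)
  qed
qed

lemma cfm_exec:
  "\<exists>p. \<forall>z vs d s w e b. layout vs d s e \<longrightarrow> s 0 = 0 \<longrightarrow>
      length z \<le> b \<longrightarrow> (\<forall>k. e k \<le> b) \<longrightarrow>
     exec z (cfm f vs d) s w (poly p b) (s(0 := of_bool (fev f (length z) (bits_of z) e))) w"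
proof (induction f)
  case (FLt x y)
  obtain p1 where
    1: "\<And>z vs d s w e b. layout vs d s e \<Longrightarrow> length z \<le> b \<Longrightarrow>
        (\<forall>k. e k \<le> b) \<Longrightarrow>
     exec z (ctrm x vs d) s w (poly p1 b) (s(d := tev x (length z) e)) w"
    using ctrm_exec by blast
  obtain p2 where
    2: "\<And>z vs d s w e b. layout vs d s e \<Longrightarrow> length z \<le> b \<Longrightarrow>
        (\<forall>k. e k \<le> b) \<Longrightarrow>
     exec z (ctrm y vs d) s w (poly p2 b) (s(d := tev y (length z) e)) w"
    using ctrm_exec by blast
  obtain q1 q2 where q: "\<And>n e b. n \<le> b \<Longrightarrow> (\<forall>k. e k \<le> b)
      \<Longrightarrow> tev x n e \<le> poly q1 b"
     "\<And>n e b. n \<le> b \<Longrightarrow> (\<forall>k. e k \<le> b) \<Longrightarrow> tev y n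
         e \<le> poly q2 b"
    using tev_bound by metis
  show ?case
  proof (intro exI[of _ "p1 + (p2 + (4 * q1 + 1 + (3 + (3 * q2 + 1))))"] allI impI)
    fix z :: "bool list" and vs d s w b and e :: "nat \<Rightarrow> nat"
    assume a: "layout vs d s e" "s 0 = 0" "length z \<le> b" "\<forall>k. e k \<le> b"
    let ?x = "tev x (length z) e" and ?y = "tev y (length z) e"
    let ?b = "of_bool (?x < ?y) :: nat"
    have z: "s d = 0" "s (d + 1) = 0" "d \<noteq> 0" using a(1) by (auto simp: layout_def)
    have l: "layout vs (d + 1) (s(d := ?x)) e"
      by (rule layout_mono[OF a(1)]) (use a(1) in \<open>auto simp: layout_def\<close>)
    \<comment> \<open>Both counters are decreased \<open>?x\<close> times with truncation at
      \<open>0\<close>; the second one remains positive exactly if \<open>?x < ?y\<close>.\<close>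
    let ?S = "\<lambda>j. s(d := ?x - j, d + 1 := ?y - j)"
    have "exec z (Dec (d + 1)) ((?S j)(d := ?x - Suc j)) w 1 (?S (Suc j)) w" for j
    proof -
      have "((?S j)(d := ?x - Suc j))(d + 1 := ((?S j)(d := ?x - Suc j)) (d + 1) - 1) = ?S (Suc j)"
        by (auto simp: fun_eq_iff)
      then show ?thesis using exec_Dec[of z "d + 1" "(?S j)(d := ?x - Suc j)" w] by simp
    qed
    then have loop: "exec z (Whl (NZ d) (Seq (Dec d) (Dec (d + 1)))) (?S 0) w (?x * (1 + 3) + 1)
        (?S ?x) w"
      by (intro exec_loop[of ?x ?S d z _ "\<lambda>_. w" 1]) auto
    have ite: "exec z (Ite (NZ (d + 1)) (Inc 0) Skip) (?S ?x) w 3 ((?S ?x)(0 := ?b)) w"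
    proof (cases "?x < ?y")
      case True
      then have "exec z (Ite (NZ (d + 1)) (Inc 0) Skip) (?S ?x) w (1 + 2) ((?S ?x)(0 := (?S ?x) 0 +
          1)) w"
        by (intro exec_IteT exec_Inc) simp
      then show ?thesis by (rule exec_cong) (use True a(2) z(3) in \<open>auto simp:
          fun_eq_iff\<close>)
    next
      case False
      then have e: "exec z (Ite (NZ (d + 1)) (Inc 0) Skip) (?S ?x) w (0 + 2) (?S ?x) w"
        by (intro exec_IteF exec_Skip) simp
      show ?thesis
        by (rule exec_cong[OF e]) (use False a(2) z(3) in \<open>auto simp: fun_eq_iff\<close>)
    qed
    have "((?S ?x)(0 := ?b))(d + 1 := 0) = s(0 := ?b)" using z by (auto simp: fun_eq_iff)
    then have clr: "exec z (clear (d + 1)) ((?S ?x)(0 := ?b)) w (3 * (?y - ?x) + 1) (s(0 := ?b)) w"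
      using exec_clear[of z "d + 1" "(?S ?x)(0 := ?b)" w] by simp
    have "?S 0 = s(d := ?x, d + 1 := ?y)" by simp
    with loop have "exec z (Whl (NZ d) (Seq (Dec d) (Dec (d + 1)))) (s(d := ?x, d + 1 := ?y)) w (?x
        * (1 + 3) + 1) (?S ?x) w"
      by simp
    from exec_Seq[OF 1[OF a(1,3,4)] exec_Seq[OF 2[OF l a(3,4)] exec_Seq[OF this exec_Seq[OF ite
        clr]]]]
    have "exec z (cfm (FLt x y) vs d) s w (poly p1 b + (poly p2 b + (?x * (1 + 3) + 1 + (3 + (3 *
        (?y - ?x) + 1)))))
        (s(0 := of_bool (fev (FLt x y) (length z) (bits_of z) e))) w" by simp
    then show "exec z (cfm (FLt x y) vs d) s w (poly (p1 + (p2 + (4 * q1 + 1 + (3 + (3 * q2 +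
        1))))) b)
        (s(0 := of_bool (fev (FLt x y) (length z) (bits_of z) e))) w"
      by (rule exec_weaken) (use q(1)[OF a(3,4)] q(2)[OF a(3,4)] in simp)
  qed
next
  case (FBit x)
  obtain p1 where
    1: "\<And>z vs d s w e b. layout vs d s e \<Longrightarrow> length z \<le> b \<Longrightarrow>
        (\<forall>k. e k \<le> b) \<Longrightarrow>
     exec z (ctrm x vs d) s w (poly p1 b) (s(d := tev x (length z) e)) w"
    using ctrm_exec by blast
  obtain q1 where q: "\<And>n e b. n \<le> b \<Longrightarrow> (\<forall>k. e k \<le> b)
      \<Longrightarrow> tev x n e \<le> poly q1 b"
    using tev_bound by metis
  show ?case
  proof (intro exI[of _ "p1 + (3 + (3 * q1 + 1))"] allI impI)
    fix z :: "bool list" and vs d s w b and e :: "nat \<Rightarrow> nat"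
    assume a: "layout vs d s e" "s 0 = 0" "length z \<le> b" "\<forall>k. e k \<le> b"
    let ?x = "tev x (length z) e"
    let ?b = "of_bool (bits_of z ?x) :: nat"
    have z: "s d = 0" "d \<noteq> 0" using a(1) by (auto simp: layout_def)
    let ?S = "s(d := ?x)"
    have ite: "exec z (Ite (BT d) (Inc 0) Skip) ?S w 3 (?S(0 := ?b)) w"
    proof (cases "bits_of z ?x")
      case True
      then have "exec z (Ite (BT d) (Inc 0) Skip) ?S w (1 + 2) (?S(0 := ?S 0 + 1)) w"
        by (intro exec_IteT exec_Inc) (simp add: bits_of_def)
      then show ?thesis by (rule exec_cong) (use True a(2) z in \<open>auto simp:
          fun_eq_iff\<close>)
    next
      case False
      then have e: "exec z (Ite (BT d) (Inc 0) Skip) ?S w (0 + 2) ?S w"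
        by (intro exec_IteF exec_Skip) (simp add: bits_of_def)
      show ?thesis
        by (rule exec_cong[OF e]) (use False a(2) z in \<open>auto simp: fun_eq_iff\<close>)
    qed
    have "(?S(0 := ?b))(d := 0) = s(0 := ?b)" using z by (auto simp: fun_eq_iff)
    then have clr: "exec z (clear d) (?S(0 := ?b)) w (3 * ?x + 1) (s(0 := ?b)) w"
      using exec_clear[of z d "?S(0 := ?b)" w] z by simp
    from exec_Seq[OF 1[OF a(1,3,4)] exec_Seq[OF ite clr]]
    have "exec z (cfm (FBit x) vs d) s w (poly p1 b + (3 + (3 * ?x + 1)))
        (s(0 := of_bool (fev (FBit x) (length z) (bits_of z) e))) w" by simp
    then show "exec z (cfm (FBit x) vs d) s w (poly (p1 + (3 + (3 * q1 + 1))) b)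
        (s(0 := of_bool (fev (FBit x) (length z) (bits_of z) e))) w"
      by (rule exec_weaken) (use q[OF a(3,4)] in simp)
  qed
next
  case (FNeg f)
  then obtain p where p: "\<And>z vs d s w e b. layout vs d s e \<Longrightarrow> s 0 = 0
      \<Longrightarrow> length z \<le> b \<Longrightarrow> (\<forall>k. e k \<le> b)
          \<Longrightarrow>
     exec z (cfm f vs d) s w (poly p b) (s(0 := of_bool (fev f (length z) (bits_of z) e))) w" by
         blast
  show ?case
  proof (intro exI[of _ "p + 3"] allI impI)
    fix z :: "bool list" and vs d s w b and e :: "nat \<Rightarrow> nat"
    assume a: "layout vs d s e" "s 0 = 0" "length z \<le> b" "\<forall>k. e k \<le> b"
    let ?v = "fev f (length z) (bits_of z) e"
    have "exec z (Ite (NZ 0) (Dec 0) (Inc 0)) (s(0 := of_bool ?v)) w (1 + 2) (s(0 := of_bool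
        (\<not> ?v))) w"
    proof (cases ?v)
      case True
      then show ?thesis
        using exec_IteT[OF _ exec_Dec[of z 0 "s(0 := 1)" w], of "NZ 0" "Inc 0"] by simp
    next
      case False
      then show ?thesis
        using exec_IteF[OF _ exec_Inc[of z 0 "s(0 := 0)" w], of "NZ 0" "Dec 0"] by simp
    qed
    from exec_Seq[OF p[OF a] this]
    show "exec z (cfm (FNeg f) vs d) s w (poly (p + 3) b)
        (s(0 := of_bool (fev (FNeg f) (length z) (bits_of z) e))) w"
      by (rule exec_cong) simp_all
  qed
next
  case (FAnd f g)
  from FAnd.IH(1) obtain p where p: "\<And>z vs d s w e b. layout vs d s e \<Longrightarrow> s 0 =
      0 \<Longrightarrow> length z \<le> b \<Longrightarrow> (\<forall>k. e k \<le> b)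
          \<Longrightarrow>
     exec z (cfm f vs d) s w (poly p b) (s(0 := of_bool (fev f (length z) (bits_of z) e))) w" by
         blast
  from FAnd.IH(2) obtain q where q: "\<And>z vs d s w e b. layout vs d s e \<Longrightarrow> s 0 =
      0 \<Longrightarrow> length z \<le> b \<Longrightarrow> (\<forall>k. e k \<le> b)
          \<Longrightarrow>
     exec z (cfm g vs d) s w (poly q b) (s(0 := of_bool (fev g (length z) (bits_of z) e))) w" by
         blast
  show ?case
  proof (intro exI[of _ "p + (q + 3)"] allI impI)
    fix z :: "bool list" and vs d s w b and e :: "nat \<Rightarrow> nat"
    assume a: "layout vs d s e" "s 0 = 0" "length z \<le> b" "\<forall>k. e k \<le> b"
    let ?v = "fev f (length z) (bits_of z) e" and ?u = "fev g (length z) (bits_of z) e"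
    have s0: "s(0 := 0) = s" using a(2) by auto
    have "exec z (Ite (NZ 0) (Seq (Dec 0) (cfm g vs d)) Skip) (s(0 := of_bool ?v)) w (1 + poly q b
        + 2)
      (s(0 := of_bool (?v \<and> ?u))) w"
    proof (cases ?v)
      case True
      have "exec z (Dec 0) (s(0 := 1)) w 1 s w" using exec_Dec[of z 0 "s(0 := 1)" w] s0 by simp
      from exec_Seq[OF this q[OF a]] show ?thesis using True by (intro exec_IteT) simp_all
    next
      case False
      then have "exec z (Ite (NZ 0) (Seq (Dec 0) (cfm g vs d)) Skip) (s(0 := of_bool ?v)) w (0 + 2)
        (s(0 := of_bool ?v)) w" by (intro exec_IteF exec_Skip) simp
      then show ?thesis by (rule exec_cong) (use False in simp_all)
    qed
    from exec_Seq[OF p[OF a] this]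
    show "exec z (cfm (FAnd f g) vs d) s w (poly (p + (q + 3)) b)
        (s(0 := of_bool (fev (FAnd f g) (length z) (bits_of z) e))) w"
      by (rule exec_cong) simp_all
  qed
next
  case (FEx t f)
  obtain p1 where
    1: "\<And>z vs d s w e b. layout vs d s e \<Longrightarrow> length z \<le> b \<Longrightarrow>
        (\<forall>k. e k \<le> b) \<Longrightarrow>
     exec z (ctrm t vs d) s w (poly p1 b) (s(d := tev t (length z) e)) w"
    using ctrm_exec by blast
  obtain q where q: "\<And>n e b. n \<le> b \<Longrightarrow> (\<forall>k. e k \<le> b)
      \<Longrightarrow> tev t n e \<le> poly q b"
    using tev_bound by metis
  from FEx obtain p where p: "\<And>z vs d s w e b. layout vs d s e \<Longrightarrow> s 0 = 0
      \<Longrightarrow> length z \<le> b \<Longrightarrow> (\<forall>k. e k \<le> b)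
          \<Longrightarrow>
     exec z (cfm f vs d) s w (poly p b) (s(0 := of_bool (fev f (length z) (bits_of z) e))) w" by
         blast
  let ?p = "pcompose p ([:0, 1:] + q)"
  show ?case
  proof (intro exI[of _ "p1 + (q * (?p + 6) + 1 + (3 * q + 1))"] allI impI)
    fix z :: "bool list" and vs d s w b and e :: "nat \<Rightarrow> nat"
    assume a: "layout vs d s e" "s 0 = 0" "length z \<le> b" "\<forall>k. e k \<le> b"
    let ?x = "tev t (length z) e" and ?b = "b + poly q b"
    have x: "?x \<le> poly q b" using q a by blast
    have z: "s d = 0" "s (d + 1) = 0" "d \<noteq> 0" "\<And>r. r \<ge> d \<Longrightarrow> s r = 0"
        using a(1) by (auto simp: layout_def)
    let ?P = "\<lambda>i. fev f (length z) (bits_of z) (case_nat i e)"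
    \<comment> \<open>Register \<open>0\<close> accumulates the disjunction over the rounds so far.
      Once it is \<open>1\<close>, the body is skipped, because evaluation of a formula presupposes
      that register \<open>0\<close> holds \<open>0\<close>; the loop nevertheless runs to its
      end.\<close>
    let ?S = "\<lambda>j. s(0 := of_bool (\<exists>i<j. ?P i), d := ?x - j, d + 1 := j)"
    let ?c = "cfm f ((d + 1) # vs) (d + 2)"
    have body: "exec z (Seq (Ite (NZ 0) Skip ?c) (Inc (d + 1))) ((?S j)(d := ?x - Suc j)) w
        ((poly p ?b + 2) + 1) (?S (Suc j)) w" if j: "j < ?x" for j
    proof -
      let ?s = "(?S j)(d := ?x - Suc j)"
      have "exec z (Ite (NZ 0) Skip ?c) ?s w (poly p ?b + 2) (?s(0 := of_bool (\<exists>i<Suc j. ?P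
          i))) w"
      proof (cases "\<exists>i<j. ?P i")
        case True
        then have e: "exec z (Ite (NZ 0) Skip ?c) ?s w (0 + 2) ?s w"
          using z by (intro exec_IteT exec_Skip) simp
        show ?thesis
          by (rule exec_cong[OF e]) (use True z in \<open>auto simp: fun_eq_iff less_Suc_eq\<close>)
      next
        case False
        have "layout ((d + 1) # vs) (d + 2) ?s (case_nat j e)"
          by (rule layout_cons[OF a(1)]) (use z in auto)
        moreover have "length z \<le> ?b" "\<forall>k. (case k of 0 \<Rightarrow> j | Suc k
            \<Rightarrow> e k) \<le> ?b"
          using a(3) x j trans_le_add1[OF spec[OF a(4)]] by (auto intro!: case_nat_le[rule_format])
        moreover have "?s 0 = 0" using False z by simp
        ultimately have "exec z ?c ?s w (poly p ?b) (?s(0 := of_bool (?P j))) w" by (intro p)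
        moreover have "(\<exists>i<Suc j. ?P i) = ?P j" using False by (auto simp: less_Suc_eq)
        moreover have "\<not> tval z (NZ 0) ?s" using \<open>?s 0 = 0\<close> by simp
        ultimately show ?thesis by (simp only:) (rule exec_IteF)
      qed
      from exec_Seq[OF this exec_Inc[of z "d + 1"]]
      have "exec z (Seq (Ite (NZ 0) Skip ?c) (Inc (d + 1))) ?s w ((poly p ?b + 2) + 1)
        ((?s(0 := of_bool (\<exists>i<Suc j. ?P i)))(d + 1 := (?s(0 := of_bool (\<exists>i<Suc j.
            ?P i))) (d + 1) + 1)) w" .
      moreover have "(?s(0 := of_bool (\<exists>i<Suc j. ?P i)))(d + 1 := (?s(0 := of_bool
          (\<exists>i<Suc j. ?P i))) (d + 1) + 1)
          = ?S (Suc j)" using z by (auto simp: fun_eq_iff)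
      ultimately show ?thesis by simp
    qed
    have loop: "exec z (Whl (NZ d) (Seq (Dec d) (Seq (Ite (NZ 0) Skip ?c) (Inc (d + 1))))) (?S 0) w
       (?x * ((poly p ?b + 2) + 1 + 3) + 1) (?S ?x) w"
      using body by (intro exec_loop[of ?x ?S d z _ "\<lambda>_. w"]) auto
    have "?S 0 = s(d := ?x)" using z a(2) by (auto simp: fun_eq_iff)
    with loop have loop: "exec z (Whl (NZ d) (Seq (Dec d) (Seq (Ite (NZ 0) Skip ?c) (Inc (d +
        1))))) (s(d := ?x)) w
       (?x * ((poly p ?b + 2) + 1 + 3) + 1) (?S ?x) w" by simp
    have "(?S ?x)(d + 1 := 0) = s(0 := of_bool (\<exists>i<?x. ?P i))" using z by (auto simp:
        fun_eq_iff)
    then have clr: "exec z (clear (d + 1)) (?S ?x) w (3 * ?x + 1) (s(0 := of_bool (\<exists>i<?x.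
        ?P i))) w"
      using exec_clear[of z "d + 1" "?S ?x" w] by simp
    from exec_Seq[OF 1[OF a(1,3,4)] exec_Seq[OF loop clr]]
    have "exec z (cfm (FEx t f) vs d) s w (poly p1 b + ((?x * ((poly p ?b + 2) + 1 + 3) + 1) + (3 *
        ?x + 1)))
        (s(0 := of_bool (fev (FEx t f) (length z) (bits_of z) e))) w" by simp
    then show "exec z (cfm (FEx t f) vs d) s w (poly (p1 + (q * (?p + 6) + 1 + (3 * q + 1))) b)
        (s(0 := of_bool (fev (FEx t f) (length z) (bits_of z) e))) w"
      by (rule exec_weaken) (use x in \<open>auto simp: poly_pcompose add.commute intro!: add_mono
          mult_mono\<close>)
  qed
qed

lemma coe_exec:
  "\<exists>p. \<forall>z vs d s w e b. layout vs d s e \<longrightarrow> s 0 = 0 \<longrightarrow>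
      length z \<le> b \<longrightarrow> (\<forall>k. e k \<le> b) \<longrightarrow>
     exec z (coe x vs d) s w (poly p b) s (w @ oev x (length z) (bits_of z) e)"
proof (induction x)
  case (OEmit c)
  show ?case
  proof (intro exI[of _ 1] allI impI)
    fix z :: "bool list" and s :: regs and w b and e :: "nat \<Rightarrow> nat"
    show "exec z (coe (OEmit c) vs d) s w (poly 1 b) s (w @ oev (OEmit c) (length z) (bits_of z) e)"
      for vs d using exec_Emit[of z c s w] by simp
  qed
next
  case (OCat x y)
  from OCat.IH(1) obtain p where p: "\<And>z vs d s w e b. layout vs d s e \<Longrightarrow> s 0 =
      0 \<Longrightarrow> length z \<le> b \<Longrightarrow> (\<forall>k. e k \<le> b)
          \<Longrightarrow>
     exec z (coe x vs d) s w (poly p b) s (w @ oev x (length z) (bits_of z) e)" by blast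
  from OCat.IH(2) obtain q where q: "\<And>z vs d s w e b. layout vs d s e \<Longrightarrow> s 0 =
      0 \<Longrightarrow> length z \<le> b \<Longrightarrow> (\<forall>k. e k \<le> b)
          \<Longrightarrow>
     exec z (coe y vs d) s w (poly q b) s (w @ oev y (length z) (bits_of z) e)" by blast
  show ?case
  proof (intro exI[of _ "p + q"] allI impI)
    fix z :: "bool list" and vs d s w b and e :: "nat \<Rightarrow> nat"
    assume a: "layout vs d s e" "s 0 = 0" "length z \<le> b" "\<forall>k. e k \<le> b"
    from exec_Seq[OF p[OF a] q[OF a]]
    show "exec z (coe (OCat x y) vs d) s w (poly (p + q) b) s (w @ oev (OCat x y) (length z)
        (bits_of z) e)"
      by simp
  qed
next
  case (OIf f x y)
  from OIf.IH(1) obtain p where p: "\<And>z vs d s w e b. layout vs d s e \<Longrightarrow> s 0 = 0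
      \<Longrightarrow> length z \<le> b \<Longrightarrow> (\<forall>k. e k \<le> b)
          \<Longrightarrow>
     exec z (coe x vs d) s w (poly p b) s (w @ oev x (length z) (bits_of z) e)" by blast
  from OIf.IH(2) obtain q where q: "\<And>z vs d s w e b. layout vs d s e \<Longrightarrow> s 0 = 0
      \<Longrightarrow> length z \<le> b \<Longrightarrow> (\<forall>k. e k \<le> b)
          \<Longrightarrow>
     exec z (coe y vs d) s w (poly q b) s (w @ oev y (length z) (bits_of z) e)" by blast
  obtain r where r: "\<And>z vs d s w e b. layout vs d s e \<Longrightarrow> s 0 = 0
      \<Longrightarrow> length z \<le> b \<Longrightarrow> (\<forall>k. e k \<le> b)
          \<Longrightarrow>
     exec z (cfm f vs d) s w (poly r b) (s(0 := of_bool (fev f (length z) (bits_of z) e))) w"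
    using cfm_exec by blast
  show ?case
  proof (intro exI[of _ "r + (p + q + 3)"] allI impI)
    fix z :: "bool list" and vs d s w b and e :: "nat \<Rightarrow> nat"
    assume a: "layout vs d s e" "s 0 = 0" "length z \<le> b" "\<forall>k. e k \<le> b"
    let ?v = "fev f (length z) (bits_of z) e" and ?w = "w @ oev (OIf f x y) (length z) (bits_of z)
        e"
    have s0: "s(0 := 0) = s" using a(2) by auto
    have "exec z (Ite (NZ 0) (Seq (Dec 0) (coe x vs d)) (coe y vs d)) (s(0 := of_bool ?v)) w
        (poly p b + poly q b + 3) s ?w"
    proof (cases ?v)
      case True
      have "exec z (Dec 0) (s(0 := 1)) w 1 s w" using exec_Dec[of z 0 "s(0 := 1)" w] s0 by simp
      from exec_Seq[OF this p[OF a]]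
      have "exec z (Ite (NZ 0) (Seq (Dec 0) (coe x vs d)) (coe y vs d)) (s(0 := of_bool ?v)) w
        (1 + poly p b + 2) s ?w" using True by (intro exec_IteT) simp_all
      then show ?thesis by (rule exec_weaken) simp
    next
      case False
      then have "exec z (Ite (NZ 0) (Seq (Dec 0) (coe x vs d)) (coe y vs d)) (s(0 := of_bool ?v)) w
        (poly q b + 2) s ?w" using q[OF a] s0 a(2) by (intro exec_IteF) simp_all
      then show ?thesis by (rule exec_weaken) simp
    qed
    from exec_Seq[OF r[OF a] this]
    show "exec z (coe (OIf f x y) vs d) s w (poly (r + (p + q + 3)) b) s ?w" by simp
  qed
next
  case (OFor t x)
  obtain p1 where
    1: "\<And>z vs d s w e b. layout vs d s e \<Longrightarrow> length z \<le> b \<Longrightarrow>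
        (\<forall>k. e k \<le> b) \<Longrightarrow>
     exec z (ctrm t vs d) s w (poly p1 b) (s(d := tev t (length z) e)) w"
    using ctrm_exec by blast
  obtain q where q: "\<And>n e b. n \<le> b \<Longrightarrow> (\<forall>k. e k \<le> b)
      \<Longrightarrow> tev t n e \<le> poly q b"
    using tev_bound by metis
  from OFor obtain p where p: "\<And>z vs d s w e b. layout vs d s e \<Longrightarrow> s 0 = 0
      \<Longrightarrow> length z \<le> b \<Longrightarrow> (\<forall>k. e k \<le> b)
          \<Longrightarrow>
     exec z (coe x vs d) s w (poly p b) s (w @ oev x (length z) (bits_of z) e)" by blast
  let ?p = "pcompose p ([:0, 1:] + q)"
  show ?case
  proof (intro exI[of _ "p1 + (q * (?p + 4) + 1 + (3 * q + 1))"] allI impI)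
    fix z :: "bool list" and vs d s w b and e :: "nat \<Rightarrow> nat"
    assume a: "layout vs d s e" "s 0 = 0" "length z \<le> b" "\<forall>k. e k \<le> b"
    let ?x = "tev t (length z) e" and ?b = "b + poly q b"
    have x: "?x \<le> poly q b" using q a by blast
    have z: "s d = 0" "s (d + 1) = 0" "d \<noteq> 0" "\<And>r. r \<ge> d \<Longrightarrow> s r = 0"
        using a(1) by (auto simp: layout_def)
    let ?P = "\<lambda>i. oev x (length z) (bits_of z) (case_nat i e)"
    let ?S = "\<lambda>j. s(d := ?x - j, d + 1 := j)" and ?W = "\<lambda>j. w @ concat (map ?P
        [0..<j])"
    let ?c = "coe x ((d + 1) # vs) (d + 2)"
    have body: "exec z (Seq ?c (Inc (d + 1))) ((?S j)(d := ?x - Suc j)) (?W j)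
        (poly p ?b + 1) (?S (Suc j)) (?W (Suc j))" if j: "j < ?x" for j
    proof -
      let ?s = "(?S j)(d := ?x - Suc j)"
      have "layout ((d + 1) # vs) (d + 2) ?s (case_nat j e)"
        by (rule layout_cons[OF a(1)]) (use z in auto)
      moreover have "length z \<le> ?b" "\<forall>k. (case k of 0 \<Rightarrow> j | Suc k
          \<Rightarrow> e k) \<le> ?b"
        using a(3) x j trans_le_add1[OF spec[OF a(4)]] by (auto intro!: case_nat_le[rule_format])
      moreover have "?s 0 = 0" using z a(2) by simp
      ultimately have "exec z ?c ?s (?W j) (poly p ?b) ?s (?W j @ ?P j)" by (intro p)
      from exec_Seq[OF this exec_Inc[of z "d + 1"]]
      have "exec z (Seq ?c (Inc (d + 1))) ?s (?W j) (poly p ?b + 1)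
        (?s(d + 1 := ?s (d + 1) + 1)) (?W j @ ?P j)" .
      moreover have "?s(d + 1 := ?s (d + 1) + 1) = ?S (Suc j)" using z by (auto simp: fun_eq_iff)
      ultimately show ?thesis by simp
    qed
    have loop: "exec z (Whl (NZ d) (Seq (Dec d) (Seq ?c (Inc (d + 1))))) (?S 0) (?W 0)
       (?x * ((poly p ?b + 1) + 3) + 1) (?S ?x) (?W ?x)"
      using body by (intro exec_loop[of ?x ?S d z _ ?W]) auto
    have "?S 0 = s(d := ?x)" using z by (auto simp: fun_eq_iff)
    with loop have loop: "exec z (Whl (NZ d) (Seq (Dec d) (Seq ?c (Inc (d + 1))))) (s(d := ?x)) w
       (?x * ((poly p ?b + 1) + 3) + 1) (?S ?x) (?W ?x)" by simp
    have "(?S ?x)(d + 1 := 0) = s" using z by (auto simp: fun_eq_iff)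
    then have clr: "exec z (clear (d + 1)) (?S ?x) (?W ?x) (3 * ?x + 1) s (?W ?x)"
      using exec_clear[of z "d + 1" "?S ?x" "?W ?x"] by simp
    from exec_Seq[OF 1[OF a(1,3,4)] exec_Seq[OF loop clr]]
    have "exec z (coe (OFor t x) vs d) s w (poly p1 b + ((?x * ((poly p ?b + 1) + 3) + 1) + (3 * ?x
        + 1)))
        s (w @ oev (OFor t x) (length z) (bits_of z) e)" by simp
    then show "exec z (coe (OFor t x) vs d) s w (poly (p1 + (q * (?p + 4) + 1 + (3 * q + 1))) b)
        s (w @ oev (OFor t x) (length z) (bits_of z) e)"
      by (rule exec_weaken) (use x in \<open>auto simp: poly_pcompose add.commute intro!: add_mono
          mult_mono\<close>)
  qed
qed

definition tdef :: "(nat \<Rightarrow> (nat \<Rightarrow> nat) \<Rightarrow> nat) \<Rightarrow>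
    bool" where
  "tdef f \<longleftrightarrow> (\<exists>t. \<forall>n e. tev t n e = f n e)"

definition fdef :: "(nat \<Rightarrow> (nat \<Rightarrow> bool) \<Rightarrow> (nat \<Rightarrow>
    nat) \<Rightarrow> bool) \<Rightarrow> bool" where
  "fdef P \<longleftrightarrow> (\<exists>f. \<forall>n B e. fev f n B e = P n B e)"

definition odef :: "(nat \<Rightarrow> (nat \<Rightarrow> bool) \<Rightarrow> (nat \<Rightarrow>
    nat) \<Rightarrow> bool list) \<Rightarrow> bool" where
  "odef F \<longleftrightarrow> (\<exists>x. \<forall>n B e. oev x n B e = F n B e)"

theorem odef_poly_time:
  assumes "odef F"
  shows "poly_time_computable (\<lambda>x. F (length x) (bits_of x) (\<lambda>_. 0))"
proof -
  obtain y where y: "\<And>n B e. oev y n B e = F n B e" using assms by (auto simp: odef_def)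
  obtain p where p: "\<And>z vs d s w e b. layout vs d s e \<Longrightarrow> s 0 = 0
      \<Longrightarrow> length z \<le> b \<Longrightarrow> (\<forall>k. e k \<le> b)
          \<Longrightarrow>
     exec z (coe y vs d) s w (poly p b) s (w @ oev y (length z) (bits_of z) e)"
    using coe_exec by blast
  have "exec x (coe y [] 1) (\<lambda>_. 0) [] (poly p (length x)) (\<lambda>_. 0) (F (length x)
      (bits_of x) (\<lambda>_. 0))" for x
    using p[of "[]" 1 "\<lambda>_. 0" "\<lambda>_. 0" x "length x" "[]"] by (simp add: layout_def y)
  then show ?thesis by (rule exec_computes)
qed

text \<open>
  Replacing every output instruction by a comparison turns a program that prints a string into
  one that checks the printed string against \<open>x\<close>, where the input is \<open>pair_code
      x y\<close>. The new
  register \<open>0\<close> is the position in the input and register \<open>1\<close> counts the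
      mismatches.
\<close>

definition match1 :: "bool \<Rightarrow> cmd" where
  "match1 b = Ite (BT 0)
     (Seq (Inc 0) (Seq (Ite (BT 0) (if b then Skip else Inc 1) (if b then Inc 1 else Skip)) (Inc
         0)))
     (Inc 1)"

fun test_up :: "test \<Rightarrow> test" where
  "test_up (NZ r) = NZ (r + 2)"
| "test_up (BT r) = BT (r + 2)"
| "test_up (NB r) = NB (r + 2)"

fun matching :: "cmd \<Rightarrow> cmd" where
  "matching Skip = Skip"
| "matching (Inc r) = Inc (r + 2)"
| "matching (Dec r) = Dec (r + 2)"
| "matching (Emit b) = match1 b"
| "matching (Seq c1 c2) = Seq (matching c1) (matching c2)"
| "matching (Ite t c1 c2) = Ite (test_up t) (matching c1) (matching c2)"
| "matching (Whl t c) = Whl (test_up t) (matching c)"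

text \<open>In \<open>pair_code x y\<close> position \<open>2 * i\<close> tells whether
  \<open>x\<close> has an \<open>i\<close>-th bit, and position \<open>2 * i + 1\<close> holds it.
  At the end of \<open>x\<close> the position stays, so every surplus bit counts as a
  mismatch.\<close>

fun match_step :: "bool list \<Rightarrow> bool \<Rightarrow> nat \<times> nat \<Rightarrow> nat
    \<times> nat" where
  "match_step z b (p, f) =
     (if bits_of z p then (p + 2, if bits_of z (p + 1) = b then f else f + 1) else (p, f + 1))"

definition with_match :: "regs \<Rightarrow> nat \<times> nat \<Rightarrow> regs" where
  "with_match s pf = (\<lambda>r. if r = 0 then fst pf else if r = 1 then snd pf else s (r - 2))"

lemma with_match_upd: "(with_match s pf)(r + 2 := v) = with_match (s(r := v)) pf"
  by (auto simp: with_match_def fun_eq_iff)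

lemma with_match_simps [simp]:
  "with_match s pf 0 = fst pf" "with_match s pf (Suc 0) = snd pf" "with_match s pf (Suc (Suc r)) =
      s r"
  by (simp_all add: with_match_def)

lemma tval_test_up: "tval z (test_up t) (with_match s pf) = tval z t s"
  by (cases t) auto

lemma exec_match1:
  "exec z (match1 b) (with_match s pf) v 7 (with_match s (match_step z b pf)) v"
proof (cases pf)
  case pf: (Pair p f)
  let ?s = "with_match s pf"
  show ?thesis
  proof (cases "bits_of z p")
    case True
    let ?s1 = "?s(0 := p + 1)"
    let ?s2 = "?s1(1 := if bits_of z (p + 1) = b then f else f + 1)"
    have "exec z (Ite (BT 0) (if b then Skip else Inc 1) (if b then Inc 1 else Skip)) ?s1 v 3 ?s2 v"
    proof (cases "bits_of z (p + 1)")
      case True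
      have "exec z (if b then Skip else Inc 1) ?s1 v 1 ?s2 v"
      proof (cases b)
        case b: True
        have "?s2 = ?s1" using True b pf by (auto simp: fun_eq_iff)
        then show ?thesis using b exec_weaken[OF exec_Skip, of 1 z ?s1 v] by simp
      next
        case False
        then have "?s2 = ?s1(1 := ?s1 1 + 1)" using True pf by (auto simp: fun_eq_iff)
        then show ?thesis using False exec_Inc[of z 1 ?s1 v] by simp
      qed
      moreover have "tval z (BT 0) ?s1" using True by (simp add: bits_of_def)
      ultimately have "exec z (Ite (BT 0) (if b then Skip else Inc 1) (if b then Inc 1 else Skip))
          ?s1 v (1 + 2) ?s2 v"
        by (intro exec_IteT)
      then show ?thesis by (rule exec_weaken) simp
    next
      case False
      have "exec z (if b then Inc 1 else Skip) ?s1 v 1 ?s2 v"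
      proof (cases b)
        case b: False
        have "?s2 = ?s1" using False b pf by (auto simp: fun_eq_iff)
        then show ?thesis using b exec_weaken[OF exec_Skip, of 1 z ?s1 v] by simp
      next
        case True
        then have "?s2 = ?s1(1 := ?s1 1 + 1)" using False pf by (auto simp: fun_eq_iff)
        then show ?thesis using True exec_Inc[of z 1 ?s1 v] by simp
      qed
      moreover have "\<not> tval z (BT 0) ?s1" using False by (simp add: bits_of_def)
      ultimately have "exec z (Ite (BT 0) (if b then Skip else Inc 1) (if b then Inc 1 else Skip))
          ?s1 v (1 + 2) ?s2 v"
        by (intro exec_IteF)
      then show ?thesis by (rule exec_weaken) simp
    qed
    have i: "exec z (Inc 0) ?s v 1 ?s1 v" using exec_Inc[of z 0 ?s v] pf by simp
    have "tval z (BT 0) ?s" using True pf by (simp add: bits_of_def)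
    from exec_IteT[OF this exec_Seq[OF i exec_Seq[OF \<open>exec z (Ite _ _ _) ?s1 v 3 ?s2
        v\<close> exec_Inc[of z 0 ?s2 v]]]]
    have "exec z (match1 b) ?s v (1 + (3 + 1) + 2) (?s2(0 := ?s2 0 + 1)) v" by (simp add:
        match1_def)
    moreover have "?s2(0 := ?s2 0 + 1) = with_match s (match_step z b pf)"
      using True pf by (auto simp: fun_eq_iff with_match_def)
    ultimately show ?thesis by (simp del: fun_upd_apply)
  next
    case False
    then have "\<not> tval z (BT 0) ?s" using pf by (simp add: bits_of_def)
    from exec_IteF[OF this exec_Inc[of z 1 ?s v]]
    have "exec z (match1 b) ?s v (1 + 2) (?s(1 := ?s 1 + 1)) v" unfolding match1_def .
    then show ?thesis
      by (rule exec_cong) (use False pf in \<open>auto simp: fun_eq_iff with_match_def\<close>)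
  qed
qed

text \<open>The output produced so far is represented only by the result of folding
  \<open>match_step\<close> over it, while the real output \<open>v\<close> stays untouched. One
  comparison takes at most \<open>7\<close> steps, which gives the factor.\<close>

lemma exec_matching:
  "exec z c s w t s' w' \<Longrightarrow> exec z (matching c) (with_match s (fold (match_step z) w
      pf)) v (7 * t)
     (with_match s' (fold (match_step z) w' pf)) v"
proof (induction rule: exec.induct)
  case (exec_Skip s w)
  show ?case using exec.exec_Skip by simp
next
  case (exec_Inc r s w)
  have "exec z (Inc (r + 2)) (with_match s (fold (match_step z) w pf)) v 1
     (with_match (s(r := s r + 1)) (fold (match_step z) w pf)) v"
    using exec.exec_Inc[of z "r + 2" "with_match s (fold (match_step z) w pf)" v]
    by (simp only: with_match_upd) simp
  then show ?case by (rule exec_cong) (simp_all del: fun_upd_apply)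
next
  case (exec_Dec r s w)
  have "exec z (Dec (r + 2)) (with_match s (fold (match_step z) w pf)) v 1
     (with_match (s(r := s r - 1)) (fold (match_step z) w pf)) v"
    using exec.exec_Dec[of z "r + 2" "with_match s (fold (match_step z) w pf)" v]
    by (simp only: with_match_upd) simp
  then show ?case by (rule exec_cong) (simp_all del: fun_upd_apply)
next
  case (exec_Emit b s w)
  show ?case using exec_match1 by simp
next
  case (exec_Seq c1 s w t1 s1 w1 c2 t2 s2 w2)
  from exec.exec_Seq[OF exec_Seq.IH] show ?case by (simp add: algebra_simps)
next
  case (exec_IteT t s c1 w k s1 w1 c2)
  from exec_IteT.hyps(1) have "tval z (test_up t) (with_match s (fold (match_step z) w pf))"
    by (simp add: tval_test_up)
  from exec.exec_IteT[OF this exec_IteT.IH] show ?case by (rule exec_cong) simp_all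
next
  case (exec_IteF t s c2 w k s1 w1 c1)
  from exec_IteF.hyps(1) have "\<not> tval z (test_up t) (with_match s (fold (match_step z) w pf))"
    by (simp add: tval_test_up)
  from exec.exec_IteF[OF this exec_IteF.IH] show ?case by (rule exec_cong) simp_all
next
  case (exec_WhlF t s c w)
  from exec_WhlF.hyps(1) have "\<not> tval z (test_up t) (with_match s (fold (match_step z) w pf))"
    by (simp add: tval_test_up)
  from exec.exec_WhlF[OF this] show ?case by (rule exec_cong) simp_all
next
  case (exec_WhlT t s c w t1 s1 w1 t2 s2 w2)
  from exec_WhlT.hyps(1) have "tval z (test_up t) (with_match s (fold (match_step z) w pf))"
    by (simp add: tval_test_up)
  from exec.exec_WhlT[OF this exec_WhlT.IH(1) exec_WhlT.IH(2)[unfolded matching.simps]] show ?case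
    by (rule exec_cong) simp_all
next
  case (exec_weaken c s w t s1 w1 t')
  from exec_weaken.IH show ?case by (rule exec_cong) (use exec_weaken.hyps(2) in simp_all)
qed

section \<open>Bits of pair codes and relativisation\<close>

lemma self_delim_Cons: "self_delim (b # x) = True # b # self_delim x"
  by (simp add: self_delim_def)

lemma length_self_delim: "length (self_delim x) = 2 * length x + 1"
  by (induction x) (auto simp: self_delim_Cons, simp add: self_delim_def)

lemma self_delim_nth:
  "i \<le> length x \<Longrightarrow> self_delim x ! (2 * i) = (i < length x)"
  "i < length x \<Longrightarrow> self_delim x ! Suc (2 * i) = x ! i"
proof (induction x arbitrary: i)
  case Nil
  {
    case 1
    then show ?case by (simp add: self_delim_def)
  next
    case 2
    then show ?case by simp
  }
next
  case (Cons b x)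
  {
    case 1
    then show ?case using Cons.IH(1)[of "i - 1"] by (cases i) (auto simp: self_delim_Cons)
  next
    case 2
    then show ?case using Cons.IH(2)[of "i - 1"] by (cases i) (auto simp: self_delim_Cons)
  }
qed

lemma bits_of_pair_code:
  "i \<le> length x \<Longrightarrow> bits_of (pair_code x y) (2 * i) = (i < length x)"
  "i < length x \<Longrightarrow> bits_of (pair_code x y) (2 * i + 1) = x ! i"
  "bits_of (pair_code x y) (2 * length x + 1 + j) = bits_of y j"
  using self_delim_nth[of i x] by (auto simp: bits_of_def pair_code_def length_self_delim
      nth_append)

text \<open>The number of mismatches never decreases, so it ends at \<open>0\<close> only if all
  printed bits agree with \<open>x\<close>. The end marker at the final position excludes that the
  printed string is a proper prefix.\<close>

lemma fold_match_step:
  assumes "i \<le> length x"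
  shows "(case fold (match_step (pair_code x y)) h (2 * i, f) of (p, f') \<Rightarrow>
      f' = 0 \<and> \<not> bits_of (pair_code x y) p) \<longleftrightarrow> f = 0 \<and> h = drop i
          x"
  using assms
proof (induction h arbitrary: i f)
  case Nil
  then show ?case by (auto simp: bits_of_pair_code(1))
next
  case (Cons b h)
  show ?case
  proof (cases "i < length x")
    case True
    have "match_step (pair_code x y) b (2 * i, f) = (2 * Suc i, if x ! i = b then f else f + 1)"
      using True bits_of_pair_code(1,2)[of i x y] by simp
    moreover have "drop i x = x ! i # drop (Suc i) x" using True by (simp add: Cons_nth_drop_Suc)
    ultimately show ?thesis using Cons.IH[of "Suc i"] True by auto
  next
    case False
    then have "match_step (pair_code x y) b (2 * i, f) = (2 * i, f + 1)" "i = length x"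
      using Cons.prems bits_of_pair_code(1)[of i x y] by auto
    then show ?thesis using Cons.IH[of i "f + 1"] by auto
  qed
qed

text \<open>
  Relativisation to \<open>pair_code x y\<close>: the length of \<open>x\<close> becomes an extra
      variable below the \<open>d\<close>
  variables in scope, and the bits are those of \<open>y\<close>.
\<close>

primrec trel :: "nat \<Rightarrow> trm \<Rightarrow> trm" where
  "trel d (TV k) = TV (if k < d then k else Suc k)"
| "trel d (TC c) = TC c"
| "trel d TLen = TV d"
| "trel d (TAdd a b) = TAdd (trel d a) (trel d b)"
| "trel d (TMul a b) = TMul (trel d a) (trel d b)"

primrec frel :: "nat \<Rightarrow> fm \<Rightarrow> fm" where
  "frel d (FLt a b) = FLt (trel d a) (trel d b)"
| "frel d (FBit t) = FBit (TAdd (TAdd (TMul (TC 2) (TV d)) (TC 1)) (trel d t))"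
| "frel d (FNeg f) = FNeg (frel d f)"
| "frel d (FAnd f g) = FAnd (frel d f) (frel d g)"
| "frel d (FEx t f) = FEx (trel d t) (frel (Suc d) f)"

primrec orel :: "nat \<Rightarrow> oe \<Rightarrow> oe" where
  "orel d (OEmit b) = OEmit b"
| "orel d (OCat x y) = OCat (orel d x) (orel d y)"
| "orel d (OIf f x y) = OIf (frel d f) (orel d x) (orel d y)"
| "orel d (OFor t x) = OFor (trel d t) (orel (Suc d) x)"

definition ins_env :: "nat \<Rightarrow> nat \<Rightarrow> (nat \<Rightarrow> nat) \<Rightarrow>
    nat \<Rightarrow> nat" where
  "ins_env d n e k = (if k < d then e k else if k = d then n else e (k - 1))"

lemma ins_env_Suc: "case_nat i (ins_env d n e) = ins_env (Suc d) n (case_nat i e)"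
  by (auto simp: ins_env_def fun_eq_iff split: nat.splits)

lemma tev_trel: "tev (trel d t) m (ins_env d n e) = tev t n e"
  by (induction t) (auto simp: ins_env_def)

lemma fev_frel:
  assumes "\<And>j. B (2 * n + 1 + j) = B' j"
  shows "fev (frel d f) m B (ins_env d n e) = fev f n B' e"
proof (induction f arbitrary: d e)
  case (FBit t)
  have "ins_env d n e d = n" by (simp add: ins_env_def)
  then show ?case using assms[of "tev t n e"] by (simp add: tev_trel)
qed (simp_all add: tev_trel ins_env_Suc)

lemma oev_orel:
  assumes "\<And>j. B (2 * n + 1 + j) = B' j"
  shows "oev (orel d x) m B (ins_env d n e) = oev x n B' e"
  by (induction x arbitrary: d e) (simp_all add: tev_trel ins_env_Suc fev_frel[where B = B and B' =
      B', OF assms])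

definition empty_oe :: oe where
  "empty_oe = OFor (TC 0) (OEmit True)"

text \<open>The length of the first component is the least \<open>i\<close> with a \<open>0\<close>
  at position \<open>2 * i\<close>. The loop tries every \<open>i\<close> but prints only for this
  one, so it serves as a binder for that length, and its index is the extra variable introduced by
  \<open>orel\<close>.\<close>

definition unpair :: "oe \<Rightarrow> oe" where
  "unpair x = OFor TLen (OIf (FAnd (FNeg (FBit (TMul (TC 2) (TV 0))))
      (FNeg (FEx (TV 0) (FNeg (FBit (TMul (TC 2) (TV 0)))))))
     (orel 0 x) empty_oe)"

lemma concat_map_single:
  assumes "i < m" "\<And>j. j < m \<Longrightarrow> j \<noteq> i \<Longrightarrow> g j = []"
  shows "concat (map g [0..<m]) = g i"
proof -
  have "[0..<m] = [0..<i] @ i # [Suc i..<m]"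
    using assms(1) by (metis le_add_diff_inverse less_imp_le_nat upt_add_eq_append upt_conv_Cons
        zero_le)
  moreover have "concat (map g [0..<i]) = []" "concat (map g [Suc i..<m]) = []"
    using assms by auto
  ultimately show ?thesis
    by (simp only: map_append concat_append list.map concat.simps append_Nil append_Nil2)
qed

lemma oev_unpair:
  "oev (unpair x) (length (pair_code u y)) (bits_of (pair_code u y)) (\<lambda>_. 0) =
     oev x (length u) (bits_of y) (\<lambda>_. 0)"
proof -
  let ?z = "pair_code u y" and ?n = "length u"
  have n: "?n < length ?z" by (simp add: pair_code_def length_self_delim)
  let ?g = "\<lambda>i. if \<not> bits_of ?z (2 * i) \<and> (\<forall>j<i. bits_of ?z (2 * j))
    then oev (orel 0 x) (length ?z) (bits_of ?z) (case_nat i (\<lambda>_. 0)) else []"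
  have "oev (unpair x) (length ?z) (bits_of ?z) (\<lambda>_. 0) = concat (map ?g [0..<length ?z])"
    by (auto simp: unpair_def empty_oe_def intro!: arg_cong[where f = concat])
  also have "\<dots> = ?g ?n"
  proof (rule concat_map_single[OF n])
    fix j assume "j \<noteq> ?n"
    then consider "j < ?n" | "?n < j" by linarith
    then show "?g j = []"
    proof cases
      case 1
      then show ?thesis using bits_of_pair_code(1)[of j u y] by simp
    next
      case 2
      then show ?thesis using bits_of_pair_code(1)[of ?n u y] by auto
    qed
  qed
  also have "\<dots> = oev (orel 0 x) (length ?z) (bits_of ?z) (case_nat ?n (\<lambda>_. 0))"
    using bits_of_pair_code(1)[of _ u y] by simp
  also have "case_nat ?n (\<lambda>_. 0) = ins_env 0 ?n (\<lambda>_. 0)"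
    by (auto simp: ins_env_def fun_eq_iff split: nat.splits)
  also have "oev (orel 0 x) (length ?z) (bits_of ?z) (ins_env 0 ?n (\<lambda>_. 0)) = oev x ?n
      (bits_of y) (\<lambda>_. 0)"
    by (rule oev_orel) (simp only: bits_of_pair_code(3))
  finally show ?thesis .
qed

text \<open>Guess and print: \<open>Y\<close> is the certificate, and the verifier compares what is
  printed from \<open>Y\<close> with \<open>x\<close>. The predicate \<open>Y\<close> is infinite,
  but only polynomially many of its bits are inspected.\<close>

theorem odef_NP:
  assumes "odef F"
  shows "{x. \<exists>Y. x = F (length x) Y (\<lambda>_. 0)} \<in> class_NP"
proof -
  obtain g where g: "\<And>n B e. oev g n B e = F n B e" using assms by (auto simp: odef_def)
  obtain q where q: "\<And>n e b B B'. n \<le> b \<Longrightarrow> (\<forall>k. e k \<le> b)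
      \<Longrightarrow> (\<forall>i < poly q b. B i = B' i) \<Longrightarrow>
     F n B e = F n B' e" using oev_support[of g] unfolding g by blast
  obtain p where p: "\<And>z vs d s w e b. layout vs d s e \<Longrightarrow> s 0 = 0
      \<Longrightarrow> length z \<le> b \<Longrightarrow> (\<forall>k. e k \<le> b)
          \<Longrightarrow>
     exec z (coe (unpair g) vs d) s w (poly p b) s (w @ oev (unpair g) (length z) (bits_of z) e)"
    using coe_exec by blast
  \<comment> \<open>The final position and the number of mismatches after comparing the printed
    string with the first component of \<open>z\<close>.\<close>
  define R where "R z = fold (match_step z) (oev (unpair g) (length z) (bits_of z) (\<lambda>_. 0))
      (0, 0)" for z
  define V where "V = {z. case R z of (p, f) \<Rightarrow> f = 0 \<and> \<not> bits_of z p}"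
  let ?d = "Ite (NZ 1) (Emit False) (Ite (BT 0) (Emit False) (Emit True))"
  \<comment> \<open>Matching multiplies the time by \<open>7\<close>; the two nested tests that emit
    the answer take at most \<open>5\<close> steps.\<close>
  have "exec z (Seq (matching (coe (unpair g) [] 1)) ?d) (\<lambda>_. 0) [] (poly (7 * p + 5)
      (length z))
      (with_match (\<lambda>_. 0) (R z)) [z \<in> V]" for z
  proof -
    have "exec z (coe (unpair g) [] 1) (\<lambda>_. 0) [] (poly p (length z)) (\<lambda>_. 0)
        (oev (unpair g) (length z) (bits_of z) (\<lambda>_. 0))"
      using p[of "[]" 1 "\<lambda>_. 0" "\<lambda>_. 0" z "length z" "[]"] by (simp add: layout_def)
    from exec_matching[OF this, of "(0, 0)" "[]"]
    have 1: "exec z (matching (coe (unpair g) [] 1)) (with_match (\<lambda>_. 0) (0, 0)) [] (7 *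
        poly p (length z))
        (with_match (\<lambda>_. 0) (R z)) []" by (simp add: R_def)
    have 0: "with_match (\<lambda>_. 0) (0, 0) = (\<lambda>_. 0)" by (auto simp: with_match_def)
    obtain a f where R: "R z = (a, f)" by (cases "R z")
    have "exec z ?d (with_match (\<lambda>_. 0) (R z)) [] 5 (with_match (\<lambda>_. 0) (R z)) ([]
        @ [z \<in> V])"
    proof (cases "f = 0")
      case False
      then have "z \<notin> V" by (simp add: V_def R)
      then have "exec z ?d (with_match (\<lambda>_. 0) (R z)) [] (1 + 2) (with_match (\<lambda>_.
          0) (R z)) ([] @ [z \<in> V])"
        using False exec_Emit[of z False _ "[]"] by (intro exec_IteT) (simp_all add: R)
      then show ?thesis by (rule exec_weaken) simp
    next
      case True
      then have V: "z \<in> V \<longleftrightarrow> \<not> bits_of z a" by (simp add: V_def R)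
      have "exec z (Ite (BT 0) (Emit False) (Emit True)) (with_match (\<lambda>_. 0) (R z)) [] (1 +
          2)
          (with_match (\<lambda>_. 0) (R z)) ([] @ [z \<in> V])"
      proof (cases "bits_of z a")
        case True
        then show ?thesis using V exec_Emit[of z False _ "[]"]
          by (intro exec_IteT) (simp_all add: R bits_of_def)
      next
        case False
        then show ?thesis using V exec_Emit[of z True _ "[]"]
          by (intro exec_IteF) (simp_all add: R bits_of_def)
      qed
      then have "exec z ?d (with_match (\<lambda>_. 0) (R z)) [] ((1 + 2) + 2)
          (with_match (\<lambda>_. 0) (R z)) ([] @ [z \<in> V])"
        by (rule exec_IteF[rotated]) (simp add: R True)
      then show ?thesis by (rule exec_weaken) simp
    qed
    from exec_Seq[OF 1 this] show ?thesis unfolding 0 by simp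
  qed
  then have "poly_time_computable (\<lambda>z. [z \<in> V])" by (rule exec_computes)
  then have VP: "V \<in> class_P" by (simp add: class_P_def)
  have V: "pair_code x y \<in> V \<longleftrightarrow> x = F (length x) (bits_of y) (\<lambda>_.
      0)" for x y
    using fold_match_step[of 0 x y "F (length x) (bits_of y) (\<lambda>_. 0)" 0]
    by (auto simp: V_def R_def oev_unpair g)
  have "(\<exists>Y. x = F (length x) Y (\<lambda>_. 0)) \<longleftrightarrow>
      (\<exists>y. length y \<le> poly q (length x) \<and> pair_code x y \<in> V)" for x
  proof
    assume "\<exists>Y. x = F (length x) Y (\<lambda>_. 0)"
    then obtain Y where Y: "x = F (length x) Y (\<lambda>_. 0)" by blast
    let ?y = "map Y [0..<poly q (length x)]"
    have "F (length x) Y (\<lambda>_. 0) = F (length x) (bits_of ?y) (\<lambda>_. 0)"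
      by (rule q[of _ "length x"]) (simp_all add: bits_of_def)
    then show "\<exists>y. length y \<le> poly q (length x) \<and> pair_code x y \<in> V"
      using Y by (intro exI[of _ ?y]) (simp add: V)
  qed (auto simp: V)
  then show ?thesis unfolding class_NP_def using VP by blast
qed

section \<open>Definability\<close>

primrec tsub :: "(nat \<Rightarrow> trm) \<Rightarrow> trm \<Rightarrow> trm" where
  "tsub \<sigma> (TV k) = \<sigma> k"
| "tsub \<sigma> (TC c) = TC c"
| "tsub \<sigma> TLen = TLen"
| "tsub \<sigma> (TAdd a b) = TAdd (tsub \<sigma> a) (tsub \<sigma> b)"
| "tsub \<sigma> (TMul a b) = TMul (tsub \<sigma> a) (tsub \<sigma> b)"

definition lift_sub :: "(nat \<Rightarrow> trm) \<Rightarrow> nat \<Rightarrow> trm" where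
  "lift_sub \<sigma> = case_nat (TV 0) (\<lambda>k. tsub (\<lambda>k. TV (Suc k)) (\<sigma> k))"

primrec fsub :: "(nat \<Rightarrow> trm) \<Rightarrow> fm \<Rightarrow> fm" where
  "fsub \<sigma> (FLt a b) = FLt (tsub \<sigma> a) (tsub \<sigma> b)"
| "fsub \<sigma> (FBit t) = FBit (tsub \<sigma> t)"
| "fsub \<sigma> (FNeg f) = FNeg (fsub \<sigma> f)"
| "fsub \<sigma> (FAnd f g) = FAnd (fsub \<sigma> f) (fsub \<sigma> g)"
| "fsub \<sigma> (FEx t f) = FEx (tsub \<sigma> t) (fsub (lift_sub \<sigma>) f)"

primrec osub :: "(nat \<Rightarrow> trm) \<Rightarrow> oe \<Rightarrow> oe" where
  "osub \<sigma> (OEmit b) = OEmit b"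
| "osub \<sigma> (OCat x y) = OCat (osub \<sigma> x) (osub \<sigma> y)"
| "osub \<sigma> (OIf f x y) = OIf (fsub \<sigma> f) (osub \<sigma> x) (osub \<sigma> y)"
| "osub \<sigma> (OFor t x) = OFor (tsub \<sigma> t) (osub (lift_sub \<sigma>) x)"

lemma tev_tsub: "tev (tsub \<sigma> t) n e = tev t n (\<lambda>k. tev (\<sigma> k) n e)"
  by (induction t) auto

lemma tev_lift_sub: "(\<lambda>k. tev (lift_sub \<sigma> k) n (case_nat i e)) = case_nat i
    (\<lambda>k. tev (\<sigma> k) n e)"
  by (auto simp: lift_sub_def fun_eq_iff tev_tsub split: nat.splits)

lemma fev_fsub: "fev (fsub \<sigma> f) n B e = fev f n B (\<lambda>k. tev (\<sigma> k) n e)"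
  by (induction f arbitrary: \<sigma> e) (simp_all add: tev_tsub tev_lift_sub)

lemma oev_osub: "oev (osub \<sigma> x) n B e = oev x n B (\<lambda>k. tev (\<sigma> k) n e)"
  by (induction x arbitrary: \<sigma> e) (simp_all add: tev_tsub tev_lift_sub fev_fsub)

text \<open>These rules follow the structure of an expression, so definability of a concrete
  predicate or printed list is derived without exhibiting its syntax tree.\<close>

named_theorems def_intros

lemma tdef_var [def_intros]: "tdef (\<lambda>n e. e k)"
  unfolding tdef_def by (rule exI[of _ "TV k"]) simp

lemma tdef_const [def_intros]: "tdef (\<lambda>n e. c)"
  unfolding tdef_def by (rule exI[of _ "TC c"]) simp

lemma tdef_len [def_intros]: "tdef (\<lambda>n e. n)"
  unfolding tdef_def by (rule exI[of _ TLen]) simp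

lemma tdef_add [def_intros]: "tdef f \<Longrightarrow> tdef g \<Longrightarrow> tdef (\<lambda>n e.
    f n e + g n e)"
proof -
  assume "tdef f" "tdef g"
  then obtain s t where "\<And>n e. tev s n e = f n e" "\<And>n e. tev t n e = g n e"
    by (auto simp: tdef_def fdef_def)
  then show ?thesis unfolding tdef_def by (intro exI[of _ "TAdd s t"]) simp
qed

lemma tdef_mult [def_intros]: "tdef f \<Longrightarrow> tdef g \<Longrightarrow> tdef (\<lambda>n
    e. f n e * g n e)"
proof -
  assume "tdef f" "tdef g"
  then obtain s t where "\<And>n e. tev s n e = f n e" "\<And>n e. tev t n e = g n e"
    by (auto simp: tdef_def fdef_def)
  then show ?thesis unfolding tdef_def by (intro exI[of _ "TMul s t"]) simp
qed

lemma tdef_Suc [def_intros]: "tdef f \<Longrightarrow> tdef (\<lambda>n e. Suc (f n e))"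
  using tdef_add[OF _ tdef_const, of f 1] by simp

lemma tdef_poly:
  fixes p :: "nat poly"
  assumes "tdef f"
  shows "tdef (\<lambda>n e. poly p (f n e))"
proof (induction p)
  case 0
  show ?case using tdef_const[of 0] by simp
next
  case (pCons a p)
  then show ?case using tdef_add[OF tdef_const[of a] tdef_mult[OF assms pCons.IH]] by simp
qed

lemma fdef_sub:
  assumes "fdef P" "\<And>k. tdef (f k)"
  shows "fdef (\<lambda>n B e. P n B (\<lambda>k. f k n e))"
proof -
  obtain g where "\<And>n B e. fev g n B e = P n B e" using assms(1) by (auto simp: fdef_def)
  moreover have "\<forall>k. \<exists>t. \<forall>n e. tev t n e = f k n e" using assms(2) by (simp
      add: tdef_def)
  from choice[OF this] obtain \<sigma> where "\<forall>k n e. tev (\<sigma> k) n e = f k n e" ..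
  ultimately show ?thesis unfolding fdef_def by (intro exI[of _ "fsub \<sigma> g"]) (simp add:
      fev_fsub)
qed

lemma odef_sub:
  assumes "odef P" "\<And>k. tdef (f k)"
  shows "odef (\<lambda>n B e. P n B (\<lambda>k. f k n e))"
proof -
  obtain g where "\<And>n B e. oev g n B e = P n B e" using assms(1) by (auto simp: odef_def)
  moreover have "\<forall>k. \<exists>t. \<forall>n e. tev t n e = f k n e" using assms(2) by (simp
      add: tdef_def)
  from choice[OF this] obtain \<sigma> where "\<forall>k n e. tev (\<sigma> k) n e = f k n e" ..
  ultimately show ?thesis unfolding odef_def by (intro exI[of _ "osub \<sigma> g"]) (simp add:
      oev_osub)
qed

lemma fdef_sub2:
  assumes "fdef (\<lambda>n B e. P n B (e 0) (e 1))" "tdef f" "tdef g"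
  shows "fdef (\<lambda>n B e. P n B (f n e) (g n e))"
proof -
  have "tdef (\<lambda>n e. if k = 0 then f n e else if k = 1 then g n e else 0)" for k :: nat
    using assms(2,3) tdef_const[of 0] by (cases "k = 0"; cases "k = 1") simp_all
  from fdef_sub[OF assms(1), of "\<lambda>k n e. if k = 0 then f n e else if k = 1 then g n e else
      0",
      OF this] show ?thesis by simp
qed

lemma odef_sub1:
  assumes "odef (\<lambda>n B e. P n B (e 0))" "tdef f"
  shows "odef (\<lambda>n B e. P n B (f n e))"
proof -
  have "tdef (\<lambda>n e. if k = 0 then f n e else 0)" for k :: nat
    using assms(2) tdef_const[of 0] by (cases "k = 0") simp_all
  from odef_sub[OF assms(1), of "\<lambda>k n e. if k = 0 then f n e else 0", OF this] show ?thesis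
      by simp
qed

lemma fdef_less [def_intros]: "tdef f \<Longrightarrow> tdef g \<Longrightarrow> fdef (\<lambda>n B
    e. f n e < g n e)"
proof -
  assume "tdef f" "tdef g"
  then obtain s t where "\<And>n e. tev s n e = f n e" "\<And>n e. tev t n e = g n e"
    by (auto simp: tdef_def fdef_def)
  then show ?thesis unfolding fdef_def by (intro exI[of _ "FLt s t"]) simp
qed

lemma fdef_bit [def_intros]: "tdef f \<Longrightarrow> fdef (\<lambda>n B e. B (f n e))"
proof -
  assume "tdef f"
  then obtain s where "\<And>n e. tev s n e = f n e"
    by (auto simp: tdef_def fdef_def)
  then show ?thesis unfolding fdef_def by (intro exI[of _ "FBit s"]) simp
qed

lemma fdef_not [def_intros]: "fdef P \<Longrightarrow> fdef (\<lambda>n B e. \<not> P n B e)"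
proof -
  assume "fdef P"
  then obtain s where "\<And>n B e. fev s n B e = P n B e"
    by (auto simp: tdef_def fdef_def)
  then show ?thesis unfolding fdef_def by (intro exI[of _ "FNeg s"]) simp
qed

lemma fdef_conj [def_intros]: "fdef P \<Longrightarrow> fdef Q \<Longrightarrow> fdef (\<lambda>n B
    e. P n B e \<and> Q n B e)"
proof -
  assume "fdef P" "fdef Q"
  then obtain s t where "\<And>n B e. fev s n B e = P n B e" "\<And>n B e. fev t n B e = Q n B e"
    by (auto simp: tdef_def fdef_def)
  then show ?thesis unfolding fdef_def by (intro exI[of _ "FAnd s t"]) simp
qed

text \<open>In the premise the bound variable has index \<open>0\<close> and all free variables are
  shifted, which is the de Bruijn convention seen from the semantic side.\<close>

lemma fdef_ex [def_intros]:
  assumes "fdef (\<lambda>n B e. P n B (\<lambda>k. e (Suc k)) (e 0))" "tdef f"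
  shows "fdef (\<lambda>n B e. \<exists>i < f n e. P n B e i)"
proof -
  obtain g t where "\<And>n B e. fev g n B e = P n B (\<lambda>k. e (Suc k)) (e 0)" "\<And>n e. tev
      t n e = f n e"
    using assms by (auto simp: fdef_def tdef_def)
  then show ?thesis unfolding fdef_def by (intro exI[of _ "FEx t g"]) simp
qed

lemma fdef_const [def_intros]: "fdef (\<lambda>n B e. c)"
proof (cases c)
  case True
  then show ?thesis using fdef_less[OF tdef_const[of 0] tdef_const[of 1]] by simp
next
  case False
  then show ?thesis using fdef_less[OF tdef_const[of 0] tdef_const[of 0]] by simp
qed

lemma fdef_disj [def_intros]: "fdef P \<Longrightarrow> fdef Q \<Longrightarrow> fdef (\<lambda>n B
    e. P n B e \<or> Q n B e)"
  using fdef_not[OF fdef_conj[OF fdef_not fdef_not], of P Q] by simp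

lemma fdef_imp [def_intros]: "fdef P \<Longrightarrow> fdef Q \<Longrightarrow> fdef (\<lambda>n B
    e. P n B e \<longrightarrow> Q n B e)"
  unfolding imp_conv_disj by (intro fdef_disj fdef_not)

lemma fdef_iff [def_intros]: "fdef P \<Longrightarrow> fdef Q \<Longrightarrow> fdef (\<lambda>n B
    e. P n B e = Q n B e)"
proof -
  assume "fdef P" "fdef Q"
  then have "fdef (\<lambda>n B e. (P n B e \<longrightarrow> Q n B e) \<and> (Q n B e
      \<longrightarrow> P n B e))"
    by (intro fdef_conj fdef_imp)
  moreover have "(\<lambda>n B e. (P n B e \<longrightarrow> Q n B e) \<and> (Q n B e
      \<longrightarrow> P n B e)) = (\<lambda>n B e. P n B e = Q n B e)"
    by (auto simp: fun_eq_iff)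
  ultimately show ?thesis by (simp only:)
qed

lemma fdef_all [def_intros]:
  assumes "fdef (\<lambda>n B e. P n B (\<lambda>k. e (Suc k)) (e 0))" "tdef f"
  shows "fdef (\<lambda>n B e. \<forall>i < f n e. P n B e i)"
  using fdef_not[OF fdef_ex[OF fdef_not[OF assms(1)] assms(2)]] by simp

lemma fdef_eq [def_intros]: "tdef f \<Longrightarrow> tdef g \<Longrightarrow> fdef (\<lambda>n B
    e. f n e = g n e)"
proof -
  assume "tdef f" "tdef g"
  then have "fdef (\<lambda>n B e. \<not> f n e < g n e \<and> \<not> g n e < f n e)"
    by (intro fdef_conj fdef_not fdef_less)
  moreover have "(\<lambda>n B e. \<not> f n e < g n e \<and> \<not> g n e < f n e) = (\<lambda>n
      (B :: nat \<Rightarrow> bool) e. f n e = g n e)"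
    by (auto simp: fun_eq_iff)
  ultimately show ?thesis by (simp only:)
qed

lemma fdef_le [def_intros]: "tdef f \<Longrightarrow> tdef g \<Longrightarrow> fdef (\<lambda>n B
    e. f n e \<le> g n e)"
  using fdef_not[OF fdef_less[of g f]] by (simp add: not_less)

lemma fdef_finite_ex:
  assumes "finite S" "\<And>s. s \<in> S \<Longrightarrow> fdef (P s)"
  shows "fdef (\<lambda>n B e. \<exists>s \<in> S. P s n B e)"
  using assms
proof (induction S)
  case empty
  show ?case using fdef_const[of False] by simp
next
  case (insert x S)
  then show ?case using fdef_disj[of "P x" "\<lambda>n B e. \<exists>s \<in> S. P s n B e"] by simp
qed

lemma odef_append [def_intros]: "odef F \<Longrightarrow> odef G \<Longrightarrow> odef (\<lambda>n
    B e. F n B e @ G n B e)"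
proof -
  assume "odef F" "odef G"
  then obtain x y where "\<And>n B e. oev x n B e = F n B e" "\<And>n B e. oev y n B e = G n B e"
    by (auto simp: odef_def)
  then show ?thesis unfolding odef_def by (intro exI[of _ "OCat x y"]) simp
qed

lemma odef_if [def_intros]:
  "fdef P \<Longrightarrow> odef F \<Longrightarrow> odef G \<Longrightarrow> odef (\<lambda>n B e.
      if P n B e then F n B e else G n B e)"
proof -
  assume "fdef P" "odef F" "odef G"
  then obtain f x y where "\<And>n B e. fev f n B e = P n B e" "\<And>n B e. oev x n B e = F n B e"
    "\<And>n B e. oev y n B e = G n B e"
    by (auto simp: odef_def fdef_def)
  then show ?thesis unfolding odef_def by (intro exI[of _ "OIf f x y"]) simp
qed

lemma odef_concat_map [def_intros]:
  assumes "odef (\<lambda>n B e. F n B (\<lambda>k. e (Suc k)) (e 0))" "tdef f"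
  shows "odef (\<lambda>n B e. concat (map (F n B e) [0..<f n e]))"
proof -
  obtain g t where "\<And>n B e. oev g n B e = F n B (\<lambda>k. e (Suc k)) (e 0)" "\<And>n e. tev
      t n e = f n e"
    using assms by (auto simp: odef_def tdef_def)
  then show ?thesis unfolding odef_def by (intro exI[of _ "OFor t g"]) simp
qed

lemma odef_Nil [def_intros]: "odef (\<lambda>n B e. [])"
  unfolding odef_def by (intro exI[of _ "OFor (TC 0) (OEmit True)"]) simp

lemma odef_Cons [def_intros]: "fdef P \<Longrightarrow> odef F \<Longrightarrow> odef (\<lambda>n B
    e. P n B e # F n B e)"
proof -
  assume "fdef P" "odef F"
  moreover have "odef (\<lambda>n B e. [b])" for b unfolding odef_def by (intro exI[of _ "OEmit
      b"]) simp
  ultimately have "odef (\<lambda>n B e. (if P n B e then [True] else [False]) @ F n B e)"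
    by (intro odef_append odef_if)
  moreover have "(\<lambda>n B e. (if P n B e then [True] else [False]) @ F n B e) = (\<lambda>n B
      e. P n B e # F n B e)"
    by (auto simp: fun_eq_iff)
  ultimately show ?thesis by simp
qed

lemma odef_replicate [def_intros]:
  assumes "tdef f"
  shows "odef (\<lambda>n B e. replicate (f n e) True)"
proof -
  have "odef (\<lambda>n B e. concat (map (\<lambda>i. [True]) [0..<f n e]))"
    by (intro def_intros assms)
  moreover have "concat (map (\<lambda>i. [True]) [0..<m]) = replicate m True" for m :: nat
    by (induction m) (simp_all add: replicate_append_same)
  ultimately show ?thesis by simp
qed

section \<open>Binary output of small numbers\<close>

definition two_power :: "nat \<Rightarrow> bool" where
  "two_power q \<longleftrightarrow> 0 < q \<and> (\<forall>d < Suc q. \<forall>c < Suc q. d * c =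
      q \<longrightarrow> d = 1 \<or> (\<exists>h < d. d = 2 * h))"

text \<open>The formula says that every divisor of the positive number \<open>q\<close> other than
  \<open>1\<close> is even. This characterises powers of two by multiplication and quantifiers below
  \<open>Suc q\<close> alone.\<close>

lemma two_power_iff: "two_power q \<longleftrightarrow> (\<exists>k. q = 2 ^ k)"
proof
  assume "two_power q"
  then show "\<exists>k. q = 2 ^ k"
  proof (induction q rule: less_induct)
    case (less q)
    show ?case
    proof (cases "q = 1")
      case True
      then show ?thesis by (intro exI[of _ 0]) simp
    next
      case False
      have "q * 1 = q" "q < Suc q" "1 < Suc q" using less.prems by (auto simp: two_power_def)
      then obtain h where h: "q = 2 * h" "h < q" using less.prems False unfolding two_power_def by
          blast
      have "two_power h"
        unfolding two_power_def
      proof (intro conjI allI impI)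
        show "0 < h" using h by simp
        fix d c assume "d < Suc h" "c < Suc h" "d * c = h"
        then have "d * (2 * c) = q" "d < Suc q" "2 * c < Suc q" using h by auto
        then show "d = 1 \<or> (\<exists>h < d. d = 2 * h)" using less.prems unfolding
            two_power_def by blast
      qed
      then obtain k where "h = 2 ^ k" using less.IH h(2) by blast
      then show ?thesis using h(1) by (intro exI[of _ "Suc k"]) simp
    qed
  qed
next
  assume "\<exists>k. q = 2 ^ k"
  then obtain k where k: "q = 2 ^ k" by blast
  show "two_power q"
    unfolding two_power_def
  proof (intro conjI allI impI)
    show "0 < q" by (simp add: k)
    fix d c assume "d * c = q"
    then have "d dvd 2 ^ k" using k by (metis dvd_triv_left)
    then obtain i where "d = 2 ^ i"
      using divides_primepow_nat[of 2 d k] by auto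
    then show "d = 1 \<or> (\<exists>h < d. d = 2 * h)" by (cases i) auto
  qed
qed

lemma bits_conv:
  "bits m = map (\<lambda>k. odd (m div 2 ^ k)) [0..<length (bits m)]"
  "m < 2 ^ length (bits m)" "m \<noteq> 0 \<Longrightarrow> 2 ^ length (bits m) \<le> 2 * m"
proof (induction m rule: less_induct)
  case (less m)
  have b: "bits m = odd m # bits (m div 2)" if "m \<noteq> 0" using that by (subst bits.simps) simp
  have z: "bits 0 = []" by (subst bits.simps) simp
  {
    case 1
    show ?case
    proof (cases "m = 0")
      case True
      then show ?thesis by (simp add: z)
    next
      case False
      then have l: "m div 2 < m" by simp
      have "map (\<lambda>k. odd (m div 2 ^ k)) [0..<Suc (length (bits (m div 2)))] =
          odd m # map (\<lambda>k. odd (m div 2 ^ Suc k)) [0..<length (bits (m div 2))]"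
        by (simp add: map_upt_Suc del: upt_Suc)
      also have "map (\<lambda>k. odd (m div 2 ^ Suc k)) [0..<length (bits (m div 2))] = bits (m
          div 2)"
        by (rule trans[OF _ less(1)[OF l, symmetric]]) (simp add: div_mult2_eq)
      finally show ?thesis using b[OF False] by simp
    qed
  next
    case 2
    show ?case using less(2)[of "m div 2"] b by (cases "m = 0") (auto simp: z)
  next
    case 3
    show ?case using less(3)[of "m div 2"] b 3 by (cases "m div 2 = 0") (auto simp: z)
  }
qed

lemma concat_map_append_Nil:
  "(\<And>q. q \<in> set ys \<Longrightarrow> h q = []) \<Longrightarrow> concat (map h (xs @ ys))
      = concat (map h xs)"
  by (induction ys) auto

text \<open>A loop over exponents is simulated by a loop over all numbers that does something only
  at powers of two. Its length is polynomial because the number to be printed is the value of a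
  term.\<close>

lemma concat_two_powers:
  "concat (map (\<lambda>q. if two_power q then g q else []) [0..<2 ^ K]) = concat (map
      (\<lambda>k. g (2 ^ k)) [0..<K])"
proof (induction K)
  case 0
  show ?case by (simp add: two_power_def)
next
  case (Suc K)
  let ?h = "\<lambda>q. if two_power q then g q else []"
  have no: "\<not> two_power q" if "2 ^ K < q" "q < 2 ^ Suc K" for q
  proof
    assume "two_power q"
    then obtain k where "q = 2 ^ k" by (auto simp: two_power_iff)
    with that have "K < k" "k < Suc K"
      using power_strict_increasing_iff[of "2 :: nat" K k] power_strict_increasing_iff[of "2 ::
          nat" k "Suc K"]
      by (simp_all del: power_Suc)
    then show False by simp
  qed
  have "[0..<2 ^ Suc K] = ([0..<2 ^ K] @ [2 ^ K]) @ [Suc (2 ^ K)..<2 ^ Suc K]"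
  proof -
    have "[0..<2 ^ Suc K] = [0..<Suc (2 ^ K) + (2 ^ K - 1)]" by (simp add: mult_2)
    also have "\<dots> = [0..<Suc (2 ^ K)] @ [Suc (2 ^ K)..<Suc (2 ^ K) + (2 ^ K - 1)]"
      by (rule upt_add_eq_append) simp
    finally show ?thesis by (simp add: mult_2)
  qed
  then have "concat (map ?h [0..<2 ^ Suc K]) = concat (map ?h ([0..<2 ^ K] @ [2 ^ K]))"
    by (simp only:) (rule concat_map_append_Nil, use no in auto)
  also have "\<dots> = concat (map (\<lambda>k. g (2 ^ k)) [0..<Suc K])"
    using Suc.IH by (auto simp: two_power_iff)
  finally show ?case .
qed

text \<open>The powers of two up to \<open>m\<close> correspond to the binary digits of
  \<open>m\<close>, without leading zeros. The digit at \<open>q\<close> is the parity of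
  \<open>m div q\<close>, and this quotient is odd if and only if
  \<open>m = q * (2 * a + 1) + r\<close> with \<open>r < q\<close>.\<close>

lemma enc_nat_two_powers:
  "enc_nat m = concat (map (\<lambda>q. if two_power q then
       [True, \<exists>a < Suc m. \<exists>r < q. m = q * (2 * a + 1) + r] else []) [0..<Suc m]) @
           [False]"
proof -
  let ?g = "\<lambda>q. [True, odd (m div q)]" and ?K = "length (bits m)"
  let ?h = "\<lambda>q. if two_power q then ?g q else []"
  have odd: "odd (m div q) \<longleftrightarrow> (\<exists>a < Suc m. \<exists>r < q. m = q * (2 *
      a + 1) + r)" if "q > 0" for q
  proof
    assume "odd (m div q)"
    then obtain a where a: "m div q = 2 * a + 1" by (auto elim: oddE)
    have "m = q * (2 * a + 1) + m mod q" using a by (metis mult_div_mod_eq)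
    moreover have "a < Suc m" using a div_le_dividend[of m q] by linarith
    moreover have "m mod q < q" using that by simp
    ultimately show "\<exists>a < Suc m. \<exists>r < q. m = q * (2 * a + 1) + r"
      by blast
  next
    assume "\<exists>a < Suc m. \<exists>r < q. m = q * (2 * a + 1) + r"
    then obtain a r where "r < q" "m = q * (2 * a + 1) + r" by blast
    then have "m div q = 2 * a + 1" by (simp del: mult_Suc_right)
    then show "odd (m div q)" by simp
  qed
  have "concat (map ?h [0..<Suc m]) = concat (map ?h [0..<2 ^ ?K])"
  proof -
    have "[0..<2 ^ ?K] = [0..<Suc m] @ [Suc m..<2 ^ ?K]"
      using bits_conv(2)[of m] upt_add_eq_append[of 0 "Suc m" "2 ^ ?K - Suc m"] by simp
    moreover have "?h q = []" if "q \<in> set [Suc m..<2 ^ ?K]" for q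
    proof -
      have q: "m < q" "q < 2 ^ ?K" using that by auto
      have "\<not> two_power q"
      proof
        assume "two_power q"
        then obtain k where k: "q = 2 ^ k" by (auto simp: two_power_iff)
        then have "k < ?K" using q(2) by (simp add: power_strict_increasing_iff)
        then have "2 ^ Suc k \<le> (2 ^ ?K :: nat)" by (intro power_increasing) auto
        moreover have "m \<noteq> 0"
          using \<open>k < ?K\<close> by (cases "m = 0") (simp_all add: bits.simps[of 0])
        ultimately have "2 ^ Suc k \<le> 2 * m" using bits_conv(3)[of m] by linarith
        then show False using q(1) k by simp
      qed
      then show ?thesis by simp
    qed
    ultimately show ?thesis by (simp only:) (rule concat_map_append_Nil[symmetric])
  qed
  also have "\<dots> = concat (map (\<lambda>k. ?g (2 ^ k)) [0..<?K])" by (rule concat_two_powers)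
  also have "\<dots> = concat (map (\<lambda>b. [True, b]) (bits m))"
  proof -
    have "concat (map (\<lambda>b. [True, b]) (map (\<lambda>k. odd (m div 2 ^ k)) [0..<?K])) =
        concat (map (\<lambda>b. [True, b]) (bits m))" by (simp only: bits_conv(1)[symmetric])
    then show ?thesis by (simp add: comp_def)
  qed
  finally have "enc_nat m = concat (map ?h [0..<Suc m]) @ [False]"
    by (simp add: enc_nat_def self_delim_def)
  moreover have "?h q = (if two_power q then
       [True, \<exists>a < Suc m. \<exists>r < q. m = q * (2 * a + 1) + r] else [])" for q
    using odd[of q] by (auto simp: two_power_def)
  ultimately show ?thesis by (simp only:)
qed

lemma odef_enc_nat [def_intros]:
  assumes "tdef f"
  shows "odef (\<lambda>n B e. enc_nat (f n e))"
proof -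
  have "odef (\<lambda>n B e. enc_nat (e 0))"
    unfolding enc_nat_two_powers two_power_def by (intro def_intros)
  from odef_sub1[OF this assms] show ?thesis .
qed

text \<open>A polynomial pairing, so that codes are terms. It is injective because it lies between
  the square of \<open>a + b\<close> and the next square.\<close>

definition pr :: "nat \<Rightarrow> nat \<Rightarrow> nat" where
  "pr a b = (a + b) * (a + b) + a"

lemma tdef_pr [def_intros]: "tdef f \<Longrightarrow> tdef g \<Longrightarrow> tdef (\<lambda>n e.
    pr (f n e) (g n e))"
  unfolding pr_def by (intro def_intros)

lemma pr_less: "a + b < c + d \<Longrightarrow> pr a b < pr c d"
proof -
  assume "a + b < c + d"
  then have "(a + b + 1) * (a + b + 1) \<le> (c + d) * (c + d)" by (intro mult_mono) auto
  then show ?thesis by (simp add: pr_def algebra_simps)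
qed

lemma pr_inject [simp]: "pr a b = pr c d \<longleftrightarrow> a = c \<and> b = d"
proof
  assume eq: "pr a b = pr c d"
  then have "a + b = c + d" using pr_less[of a b c d] pr_less[of c d a b] by linarith
  then show "a = c \<and> b = d" using eq by (simp add: pr_def)
qed simp

lemma pr_ge: "a \<le> pr a b" "b \<le> pr a b"
proof -
  have "a + b \<le> (a + b) * (a + b)" by (cases "a + b") auto
  then show "a \<le> pr a b" "b \<le> pr a b" unfolding pr_def by linarith+
qed

lemma pr_mono: "a \<le> c \<Longrightarrow> b \<le> d \<Longrightarrow> pr a b \<le> pr c d"
  unfolding pr_def by (intro add_mono mult_mono) auto

section \<open>From satisfiability to delay-bounded flows\<close>

text \<open>Flows may be given by sets of edges that merely contain a walk from source to sink.
  Cutting each walk down to a simple path can only lower loads and delays, as these are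
  non-negative. Both the reduction and the soundness of certificates construct flows in this
  way.\<close>

lemma flow_of_edge_sets:
  fixes S :: nat
  assumes v: "valid_instance I"
    and walk: "\<And>k. k < S \<Longrightarrow> \<exists>p. pre_digraph.awalk (graph I) (source I)
        p (sink I) \<and> set p \<subseteq> E k"
    and fin: "\<And>k. k < S \<Longrightarrow> finite (E k)"
    and del: "\<And>k. k < S \<Longrightarrow> 0 < g k \<Longrightarrow> int (\<Sum>e\<in>E k.
        delay I e) \<le> bound I"
    and cap: "\<And>e. e \<in> arcs (graph I) \<Longrightarrow> (\<Sum>k | k < S \<and> e \<in> E
        k. g k) \<le> cap I e"
    and rate: "(\<Sum>k<S. g k) = rate I"
  shows "I \<in> int_min_max_delay"
proof -
  interpret wf_digraph "graph I" using v by (simp add: valid_instance_def)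
  have "\<exists>q. q \<in> st_paths I \<and> set q \<subseteq> E k" if k: "k < S" for k
  proof -
    obtain p where p: "awalk (source I) p (sink I)" "set p \<subseteq> E k" using walk[OF k] by
        blast
    have "set (awalk_to_apath p) \<subseteq> E k" using awalk_to_apath_subset[OF p(1)] p(2) by blast
    then show ?thesis using apath_awalk_to_apath[OF p(1)] by (auto simp: st_paths_def)
  qed
  then have "\<forall>k. \<exists>q. k < S \<longrightarrow> q \<in> st_paths I \<and> set q
      \<subseteq> E k" by blast
  from choice[OF this] obtain Q where "\<forall>k. k < S \<longrightarrow> Q k \<in> st_paths I
      \<and> set (Q k) \<subseteq> E k" ..
  then have Q: "\<And>k. k < S \<Longrightarrow> Q k \<in> st_paths I" "\<And>k. k < S
      \<Longrightarrow> set (Q k) \<subseteq> E k"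
    by blast+
  \<comment> \<open>Different indices may lead to the same simple path; their rates are
    added.\<close>
  define f where "f p = (\<Sum>k \<in> {k \<in> {..<S}. Q k = p}. g k)" for p
  have fs: "finite (st_paths I)" using finite_st_paths[OF v] .
  have "(\<Sum>p\<in>st_paths I. f p) = (\<Sum>k<S. g k)"
    unfolding f_def using fs Q(1) by (intro sum.group) auto
  moreover have "edge_rate I f e \<le> cap I e" if "e \<in> arcs (graph I)" for e
  proof -
    let ?T = "{p \<in> st_paths I. e \<in> set p}" and ?K = "{k \<in> {..<S}. e \<in> set (Q k)}"
    have "edge_rate I f e = (\<Sum>p\<in>?T. \<Sum>k \<in> {k \<in> ?K. Q k = p}. g k)"
      unfolding edge_rate_def f_def by (intro sum.cong refl) auto
    also have "\<dots> = (\<Sum>k\<in>?K. g k)" using fs Q(1) by (intro sum.group) auto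
    also have "\<dots> \<le> (\<Sum>k | k < S \<and> e \<in> E k. g k)" using Q(2) by (intro
        sum_mono2) auto
    finally show ?thesis using cap[OF that] by simp
  qed
  ultimately have feas: "feasible_flow I f" using rate by (simp add: feasible_flow_def)
  have "int (path_delay I p) \<le> bound I" if "f p > 0" for p
  proof -
    have "\<exists>k \<in> {k \<in> {..<S}. Q k = p}. g k \<noteq> 0"
    proof (rule ccontr)
      assume "\<not> ?thesis"
      then have "f p = 0" unfolding f_def by (intro sum.neutral) auto
      with that show False by simp
    qed
    then obtain k where k: "k < S" "Q k = p" "0 < g k" by auto
    have "path_delay I p \<le> (\<Sum>e\<in>E k. delay I e)"
      unfolding path_delay_def using Q(2)[OF k(1)] k(2) fin[OF k(1)] by (intro sum_mono2) auto
    then show ?thesis using del[OF k(1,3)] by linarith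
  qed
  moreover have "max_delay I f \<in> path_delay I ` {p \<in> st_paths I. f p > 0}"
    unfolding max_delay_def using fs feasible_flow_support_nonempty[OF v feas]
    by (intro Max_in) auto
  ultimately have "int (max_delay I f) \<le> bound I" by auto
  then show ?thesis using v feas by (auto simp: int_min_max_delay_def)
qed

text \<open>The way in which paths of the constructed network are shown to use particular edges: for
  a suitable cut only one edge can be the crossing one.\<close>

lemma (in pre_digraph) cas_crosses_cut:
  "cas u p v \<Longrightarrow> u \<in> X \<Longrightarrow> v \<notin> X \<Longrightarrow>
      \<exists>e \<in> set p. tail G e \<in> X \<and> head G e \<notin> X"
proof (induction p arbitrary: u)
  case (Cons e p)
  then show ?case by (cases "head G e \<in> X") auto
qed simp

lemma (in pre_digraph) cas_appendI: "cas u p w \<Longrightarrow> cas w q v \<Longrightarrow> cas u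
    (p @ q) v"
  by (induction p arbitrary: u) auto

lemma (in pre_digraph) apath_tail_inj:
  assumes "apath u p v" "e \<in> set p" "e' \<in> set p" "tail G e = tail G e'"
  shows "e = e'"
proof -
  have "p \<noteq> []" using assms(2) by auto
  then have "distinct (map (tail G) p)"
    using assms(1) awalk_verts_conv[of u p] by (auto simp: apath_def)
  then show ?thesis using assms(2-) by (auto simp: distinct_map inj_on_def)
qed

lemma (in pre_digraph) apath_head_inj:
  assumes "apath u p v" "e \<in> set p" "e' \<in> set p" "head G e = head G e'"
  shows "e = e'"
proof -
  have "p \<noteq> []" using assms(2) by auto
  then have "distinct (map (head G) p)"
    using assms(1) awalk_verts_conv'[of u p v] by (auto simp: apath_def awalk_def)
  then show ?thesis using assms(2-) by (auto simp: distinct_map inj_on_def)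
qed

lemma sum_two_le:
  fixes f :: "'a \<Rightarrow> nat"
  assumes "finite A" "p \<in> A" "q \<in> A" "p \<noteq> q"
  shows "f p + f q \<le> sum f A"
proof -
  have "sum f {p, q} \<le> sum f A" using assms by (intro sum_mono2) auto
  then show ?thesis using assms by simp
qed

section \<open>The network of a formula\<close>

abbreviation vS :: nat where "vS \<equiv> pr 0 0"
abbreviation vT :: nat where "vT \<equiv> pr 5 0"
abbreviation vA :: "nat \<Rightarrow> nat" where "vA m \<equiv> pr 2 m"
abbreviation vZ :: "nat \<Rightarrow> nat" where "vZ m \<equiv> pr 3 m"
abbreviation vW :: "nat \<Rightarrow> nat \<Rightarrow> nat" where "vW l j \<equiv> pr 4 (pr l j)"

text \<open>
  The literal \<open>2 i + b\<close> is the variable \<open>i\<close> if \<open>b = 1\<close> and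
      its negation if \<open>b = 0\<close>. A unit of flow
  from \<open>vA m\<close> to \<open>vZ m'\<close> has delay \<open>m + (N + C - m')\<close>, hence
      \<open>m \<le> m'\<close>, and then \<open>m = m'\<close> because all
  these edges are saturated. The unit of a variable traverses the chain \<open>vW l 0, \<dots>, vW
      l C\<close> of
  its false literal \<open>l\<close>, and the unit of clause \<open>j\<close> uses the
      \<open>j\<close>-th edge of the chain of a true
  literal.
\<close>

definition sat_edges :: "nat \<Rightarrow> nat \<Rightarrow> (nat \<Rightarrow> nat \<Rightarrow>
    bool) \<Rightarrow> ((nat \<times> nat) \<times> (nat \<times> nat)) list" where
  "sat_edges N C Lit =
     map (\<lambda>m. ((vS, vA m), (1, m))) [0..<N + C] @
     map (\<lambda>m. ((vZ m, vT), (1, N + C - m))) [0..<N + C] @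
     concat (map (\<lambda>i. [((vA i, vW (2 * i) 0), (1, 0)), ((vA i, vW (2 * i + 1) 0), (1, 0)),
                       ((vW (2 * i) C, vZ i), (1, 0)), ((vW (2 * i + 1) C, vZ i), (1, 0))])
                           [0..<N]) @
     concat (map (\<lambda>l. concat (map (\<lambda>j. ((vW l j, vW l (Suc j)), (1, 0)) #
       (if Lit j l then [((vA (N + j), vW l j), (1, 0)), ((vW l (Suc j), vZ (N + j)), (1, 0))] else
           []))
       [0..<C])) [0..<2 * N])"

definition sat_instance :: "nat \<Rightarrow> nat \<Rightarrow> (nat \<Rightarrow> nat
    \<Rightarrow> bool) \<Rightarrow> instance_data" where
  "sat_instance N C Lit =
     \<lparr>nverts = pr 6 (pr (2 * N + C + 2) (2 * N + C + 2)), edges = sat_edges N C Lit,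
      source = vS, sink = vT, rate = N + C, bound = int (N + C)\<rparr>"

definition sat_link :: "nat \<Rightarrow> nat \<Rightarrow> (nat \<Rightarrow> nat \<Rightarrow>
    bool) \<Rightarrow> nat \<times> nat \<Rightarrow> bool" where
  "sat_link N C Lit e \<longleftrightarrow>
     (\<exists>i < N. \<exists>l. (l = 2 * i \<or> l = 2 * i + 1) \<and> (e = (vA i, vW l 0) \<or>
         e = (vW l C, vZ i))) \<or>
     (\<exists>l < 2 * N. \<exists>j < C. e = (vW l j, vW l (Suc j)) \<or>
        Lit j l \<and> (e = (vA (N + j), vW l j) \<or> e = (vW l (Suc j), vZ (N + j))))"

lemma set_concat_upt: "x \<in> set (concat (map f [0..<n])) \<longleftrightarrow> (\<exists>i < n.
    x \<in> set (f i))"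
  by auto

lemma sat_edges_iff:
  "(e, (c, d)) \<in> set (sat_edges N C Lit) \<longleftrightarrow> c = 1 \<and>
     ((\<exists>m < N + C. e = (vS, vA m) \<and> d = m) \<or> (\<exists>m < N + C. e = (vZ m, vT)
         \<and> d = N + C - m) \<or>
      sat_link N C Lit e \<and> d = 0)"
proof -
  let ?f = "\<lambda>i. [((vA i, vW (2 * i) 0), (1::nat, 0::nat)), ((vA i, vW (2 * i + 1) 0), (1,
      0)),
                       ((vW (2 * i) C, vZ i), (1, 0)), ((vW (2 * i + 1) C, vZ i), (1, 0))]"
  let ?g = "\<lambda>l j. ((vW l j, vW l (Suc j)), (1::nat, 0::nat)) #
       (if Lit j l then [((vA (N + j), vW l j), (1, 0)), ((vW l (Suc j), vZ (N + j)), (1, 0))] else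
           [])"
  have f: "(e, (c, d)) \<in> set (?f i) \<longleftrightarrow> c = 1 \<and> d = 0 \<and>
      (\<exists>l. (l = 2 * i \<or> l = 2 * i + 1) \<and> (e = (vA i, vW l 0) \<or> e = (vW l C, vZ
          i)))" for i
    by auto
  have g: "(e, (c, d)) \<in> set (?g l j) \<longleftrightarrow> c = 1 \<and> d = 0 \<and> (e = (vW
      l j, vW l (Suc j)) \<or>
        Lit j l \<and> (e = (vA (N + j), vW l j) \<or> e = (vW l (Suc j), vZ (N + j))))" for l j
    by auto
  show ?thesis
    unfolding sat_edges_def set_append Un_iff set_concat_upt f g sat_link_def set_map image_iff
    by (simp add: Bex_def atLeastLessThan_iff) blast
qed

lemma distinct_concat_upt:
  assumes "\<And>i. i < n \<Longrightarrow> distinct (f i)" "\<And>i j. i < n \<Longrightarrow> j <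
      n \<Longrightarrow> i \<noteq> j \<Longrightarrow> set (f i) \<inter> set (f j) = {}"
  shows "distinct (concat (map f [0..<n]))"
  using assms
proof (induction n)
  case (Suc n)
  have "distinct (concat (map f [0..<n]))" using Suc by simp
  moreover have "set (concat (map f [0..<n])) \<inter> set (f n) = {}"
  proof -
    have "x \<notin> set (f n)" if "i < n" "x \<in> set (f i)" for i x using that Suc.prems(2)[of i
        n] by auto
    then show ?thesis by auto
  qed
  ultimately show ?case using Suc.prems(1)[of n] by simp
qed simp

lemma distinct_sat_edges: "distinct (map fst (sat_edges N C Lit))"
proof -
  have 1: "distinct (map fst (concat (map (\<lambda>i. [((vA i, vW (2 * i) 0), (1::nat, 0::nat)),
      ((vA i, vW (2 * i + 1) 0), (1, 0)),
                       ((vW (2 * i) C, vZ i), (1, 0)), ((vW (2 * i + 1) C, vZ i), (1, 0))])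
                           [0..<N])))"
    unfolding map_concat map_map by (rule distinct_concat_upt) (auto simp: comp_def)
  have 2: "distinct (map fst (concat (map (\<lambda>l. concat (map (\<lambda>j. ((vW l j, vW l (Suc
      j)), (1::nat, 0::nat)) #
       (if Lit j l then [((vA (N + j), vW l j), (1, 0)), ((vW l (Suc j), vZ (N + j)), (1, 0))] else
           []))
       [0..<C])) [0..<2 * N])))"
    unfolding map_concat map_map comp_def
  proof (rule distinct_concat_upt)
    fix l
    show "distinct (concat (map (\<lambda>j. map fst (((vW l j, vW l (Suc j)), (1::nat, 0::nat)) #
       (if Lit j l then [((vA (N + j), vW l j), (1, 0)), ((vW l (Suc j), vZ (N + j)), (1, 0))] else
           []))) [0..<C]))"
      by (rule distinct_concat_upt) (auto split: if_splits)
  qed (auto split: if_splits)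
  show ?thesis
    unfolding sat_edges_def map_append distinct_append
    by (intro conjI 1 2) (auto simp: distinct_map inj_on_def split: if_splits)
qed

lemma arcs_sat_instance:
  "e \<in> arcs (graph (sat_instance N C Lit)) \<longleftrightarrow>
     (\<exists>m < N + C. e = (vS, vA m)) \<or> (\<exists>m < N + C. e = (vZ m, vT)) \<or> sat_link
         N C Lit e"
proof -
  have "e \<in> fst ` set (sat_edges N C Lit) \<longleftrightarrow> (\<exists>c d. (e, (c, d))
      \<in> set (sat_edges N C Lit))"
    by force
  also have "\<dots> \<longleftrightarrow> (\<exists>m < N + C. e = (vS, vA m)) \<or> (\<exists>m <
      N + C. e = (vZ m, vT)) \<or> sat_link N C Lit e"
    unfolding sat_edges_iff by blast
  finally show ?thesis by (simp add: graph_def sat_instance_def)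
qed

lemma sat_instance_weights:
  assumes "(e, (c, d)) \<in> set (sat_edges N C Lit)"
  shows "cap (sat_instance N C Lit) e = c" "delay (sat_instance N C Lit) e = d"
  using map_of_is_SomeI[OF distinct_sat_edges assms] by (simp_all add: cap_def delay_def
      sat_instance_def)

lemma cap_sat_instance: "e \<in> arcs (graph (sat_instance N C Lit)) \<Longrightarrow> cap
    (sat_instance N C Lit) e = 1"
proof -
  assume "e \<in> arcs (graph (sat_instance N C Lit))"
  then obtain c d where e: "(e, (c, d)) \<in> set (sat_edges N C Lit)"
    by (auto simp: graph_def sat_instance_def)
  then have "c = 1" by (simp only: sat_edges_iff)
  then show ?thesis using sat_instance_weights(1)[OF e] by simp
qed

lemma delay_sat_instance:
  "m < N + C \<Longrightarrow> delay (sat_instance N C Lit) (vS, vA m) = m"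
  "m < N + C \<Longrightarrow> delay (sat_instance N C Lit) (vZ m, vT) = N + C - m"
  "sat_link N C Lit e \<Longrightarrow> delay (sat_instance N C Lit) e = 0"
  by (rule sat_instance_weights(2)[where c = 1], simp add: sat_edges_iff)+

lemma sat_instance_simps [simp]:
  "source (sat_instance N C Lit) = vS" "sink (sat_instance N C Lit) = vT"
  "rate (sat_instance N C Lit) = N + C" "bound (sat_instance N C Lit) = int (N + C)"
  "head (graph I) = snd" "tail (graph I) = fst"
  by (simp_all add: sat_instance_def graph_def)

lemma valid_sat_instance:
  assumes "N + C > 0"
  shows "valid_instance (sat_instance N C Lit)"
proof -
  define X where "X = 2 * N + C + 2"
  let ?V = "pr 6 (pr X X)"
  have V: "verts (graph (sat_instance N C Lit)) = {..<?V}" by (simp add: graph_def sat_instance_def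
      X_def)
  \<comment> \<open>All vertices carry tags below \<open>6\<close>, and their second components are
    at most \<open>pr X X\<close>.\<close>
  have lt: "pr a b < ?V" if "a < 6" "b \<le> pr X X" for a b using that by (intro pr_less) simp
  have X: "X \<le> pr X X" by (rule pr_ge)
  have w: "vW l j < ?V" if "l \<le> X" "j \<le> X" for l j
    by (rule lt, simp, rule pr_mono[OF that])
  have m: "vA m < ?V" "vZ m < ?V" if "m \<le> X" for m
    by (rule lt, simp, rule order_trans[OF that X])+
  have st: "vS < ?V" "vT < ?V" by (rule lt, simp, simp)+
  have "fst e < ?V \<and> snd e < ?V" if "e \<in> arcs (graph (sat_instance N C Lit))" for e
    using that unfolding arcs_sat_instance sat_link_def by (auto intro!: w m st) (simp_all add:
        X_def)
  then have "wf_digraph (graph (sat_instance N C Lit))"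
    by unfold_locales (auto simp: V)
  then show ?thesis
    using assms st distinct_sat_edges[of N C Lit]
    by (simp add: valid_instance_def V) (simp add: sat_instance_def)
qed

text \<open>The number of vertices is written in unary and exceeds all capacities, delays, the rate
  and the bound. Hence the identity polynomial suffices for the strong form of hardness.\<close>

lemma max_number_sat_instance:
  "max_number (sat_instance N C Lit) \<le> length (enc_instance (sat_instance N C Lit))"
proof -
  let ?I = "sat_instance N C Lit" and ?X = "2 * N + C + 2"
  have "pr ?X ?X \<ge> ?X" "pr 6 (pr ?X ?X) \<ge> pr ?X ?X" by (rule pr_ge)+
  then have n: "N + C < nverts ?I" unfolding sat_instance_def by simp
  have d: "cap ?I e \<le> nverts ?I \<and> delay ?I e \<le> nverts ?I" if e: "e \<in> arcs (graph
      ?I)" for e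
  proof -
    have "delay ?I e \<le> N + C"
      using e unfolding arcs_sat_instance by (auto simp: delay_sat_instance)
    then show ?thesis using cap_sat_instance[OF e] n by simp
  qed
  have "finite (arcs (graph ?I))" by (simp add: graph_def)
  then have "max_number ?I \<le> nverts ?I"
    unfolding max_number_def using n d by (subst Max_le_iff) auto
  then show ?thesis by (simp add: enc_instance_def)
qed

section \<open>Satisfying assignments and feasible flows\<close>

lemma sat_imp_flow:
  assumes pos: "N + C > 0"
    and A: "\<And>j. j < C \<Longrightarrow> \<exists>l < 2 * N. Lit j l \<and> A (l div 2) = odd l"
  shows "sat_instance N C Lit \<in> int_min_max_delay"
proof -
  let ?I = "sat_instance N C Lit"
  interpret wf_digraph "graph ?I" using valid_sat_instance[OF pos] by (simp add: valid_instance_def)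
  obtain cl where cl: "\<And>j. j < C \<Longrightarrow> cl j < 2 * N" "\<And>j. j < C
      \<Longrightarrow> Lit j (cl j)"
    "\<And>j. j < C \<Longrightarrow> A (cl j div 2) = odd (cl j)"
    using A by metis
  \<comment> \<open>The literal of variable \<open>i\<close> that is false under \<open>A\<close>:
    even literals are negations, so a true variable has the false literal
    \<open>2 * i\<close>.\<close>
  define lf where "lf i = 2 * i + (if A i then 0 else 1)" for i
  have lf: "lf i div 2 = i" "odd (lf i) \<longleftrightarrow> \<not> A i" "lf i = 2 * i \<or> lf i
      = 2 * i + 1" for i
    by (auto simp: lf_def)
  have lfN: "lf i < 2 * N" if "i < N" for i using that by (auto simp: lf_def)
  define W where "W m = (if m < N
     then (vS, vA m) # (vA m, vW (lf m) 0) # map (\<lambda>j. (vW (lf m) j, vW (lf m) (Suc j)))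
         [0..<C] @
       [(vW (lf m) C, vZ m), (vZ m, vT)]
     else let j = m - N; l = cl j in
       [(vS, vA m), (vA m, vW l j), (vW l j, vW l (Suc j)), (vW l (Suc j), vZ m), (vZ m, vT)])" for
           m
  have link: "sat_link N C Lit e" if "m < N + C" "e \<in> set (W m)" "e \<noteq> (vS, vA m)" "e
      \<noteq> (vZ m, vT)" for m e
  proof (cases "m < N")
    case True
    with that have "e = (vA m, vW (lf m) 0) \<or> e = (vW (lf m) C, vZ m) \<or> (\<exists>j < C. e
        = (vW (lf m) j, vW (lf m) (Suc j)))"
      by (auto simp: W_def)
    then show ?thesis unfolding sat_link_def using lf(3)[of m] True lfN[OF True] by blast
  next
    case False
    let ?j = "m - N"
    have j: "?j < C" "m = N + ?j" using False that(1) by auto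
    from that False have "e = (vA m, vW (cl ?j) ?j) \<or> e = (vW (cl ?j) ?j, vW (cl ?j) (Suc ?j))
        \<or> e = (vW (cl ?j) (Suc ?j), vZ m)"
      by (auto simp: W_def Let_def)
    then show ?thesis unfolding sat_link_def using cl[OF j(1)] j by metis
  qed
  have cas_chain: "cas (vW l a) (map (\<lambda>j. (vW l j, vW l (Suc j))) [a..<b]) (vW l b)" if "a
      \<le> b" for l a b
    using that by (induction rule: inc_induct) (simp_all add: upt_conv_Cons)
  show ?thesis
  proof (rule flow_of_edge_sets[OF valid_sat_instance[OF pos], where S = "N + C" and E =
      "\<lambda>m. set (W m)" and g = "\<lambda>_. 1"])
    fix m assume m: "m < N + C"
    have "set (W m) \<subseteq> arcs (graph ?I)"
      using link[OF m] m unfolding arcs_sat_instance subset_iff by blast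
    moreover have "cas vS (W m) vT"
      by (auto simp: W_def Let_def simp del: cas_append_iff intro!: cas_appendI[OF cas_chain[of 0
          C]])
    moreover have "vS \<in> verts (graph ?I)" using valid_sat_instance[OF pos] by (simp add:
        valid_instance_def)
    ultimately have "awalk (source ?I) (W m) (sink ?I)" by (simp add: awalk_def)
    then show "\<exists>p. awalk (source ?I) p (sink ?I) \<and> set p \<subseteq> set (W m)" by
        blast
    have "(\<Sum>e\<in>set (W m). delay ?I e) = (\<Sum>e\<in>{(vS, vA m), (vZ m, vT)}. delay ?I e)"
      using link[OF m] by (intro sum.mono_neutral_right) (auto simp: delay_sat_instance(3) W_def
          Let_def)
    then show "int (\<Sum>e\<in>set (W m). delay ?I e) \<le> bound ?I"
      using m by (simp add: delay_sat_instance)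
  next
    fix e assume e: "e \<in> arcs (graph ?I)"
    have "m = m'" if m: "m < N + C" "e \<in> set (W m)" "m' < N + C" "e \<in> set (W m')" for m m'
    proof -
      \<comment> \<open>A variable and a clause could only collide on a chain edge, but the variable
        runs along a false literal and the clause borrows an edge of a true one.\<close>
      have key: "False" if i: "i < N" "N \<le> k" "k < N + C" "e \<in> set (W i)" "e \<in> set (W
          k)" for i k
      proof -
        let ?j = "k - N"
        have j: "?j < C" using i by auto
        have "lf i = cl ?j" using i by (auto simp: W_def Let_def)
        then show False using lf[of i] cl(3)[OF j] by auto
      qed
      show ?thesis
      proof (cases "m < N"; cases "m' < N")
        assume mm: "m < N" "m' < N"
        then have "m = m' \<or> lf m = lf m'" using m by (auto simp: W_def)
        then show ?thesis using lf(1)[of m] lf(1)[of m'] by metis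
      next
        assume mm: "\<not> m < N" "\<not> m' < N"
        then have "m - N = m' - N" using m by (auto simp: W_def Let_def)
        then show ?thesis using mm by simp
      qed (use key[of m m'] key[of m' m] m in auto)
    qed
    then have "card {m. m < N + C \<and> e \<in> set (W m)} \<le> 1"
      by (intro card_le_Suc0_iff_eq[THEN iffD2, simplified One_nat_def[symmetric]]) auto
    then show "(\<Sum>k | k < N + C \<and> e \<in> set (W k). 1) \<le> cap ?I e"
      using cap_sat_instance[OF e] by simp
  qed simp_all
qed

text \<open>A flow might connect terminals in an unintended way or change chains on its way through
  clause gadgets. The delays exclude the first; then the second is impossible too, since a detour
  from a chain ends at the terminal of another unit.\<close>

lemma flow_imp_sat:
  assumes flow: "sat_instance N C Lit \<in> int_min_max_delay"
  shows "\<exists>A. \<forall>j < C. \<exists>l < 2 * N. Lit j l \<and> A (l div 2) = odd l"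
proof -
  let ?I = "sat_instance N C Lit" and ?R = "N + C"
  have v: "valid_instance ?I" using flow by (simp add: int_min_max_delay_def)
  interpret wf_digraph "graph ?I" using v by (simp add: valid_instance_def)
  obtain f where f: "feasible_flow ?I f" "int (max_delay ?I f) \<le> bound ?I"
    using flow by (auto simp: int_min_max_delay_def)
  have fs: "finite (st_paths ?I)" by (rule finite_st_paths[OF v])
  have ap: "apath vS p vT" if "p \<in> st_paths ?I" for p using that by (simp add: st_paths_def)
  have arcs: "set p \<subseteq> arcs (graph ?I)" "cas vS p vT" if "p \<in> st_paths ?I" for p
    using ap[OF that] by (auto simp: apath_def awalk_def)
  have del: "path_delay ?I p \<le> ?R" if "p \<in> st_paths ?I" "f p > 0" for p
  proof -
    have "path_delay ?I p \<le> max_delay ?I f"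
      unfolding max_delay_def using fs that by (intro Max_ge) auto
    then show ?thesis using f(2) by simp
  qed
  have rate: "edge_rate ?I f e \<le> 1" if "e \<in> arcs (graph ?I)" for e
    using f(1) that cap_sat_instance[OF that] by (auto simp: feasible_flow_def)
  have unique: "p = q" if "p \<in> st_paths ?I" "q \<in> st_paths ?I" "f p > 0" "f q > 0" "e \<in>
      set p" "e \<in> set q" for p q e
  proof (rule ccontr)
    assume "p \<noteq> q"
    then have "f p + f q \<le> edge_rate ?I f e"
      unfolding edge_rate_def using that fs by (intro sum_two_le) auto
    moreover have "e \<in> arcs (graph ?I)" using arcs(1) that by blast
    ultimately show False using rate[of e] that by simp
  qed
  have start: "\<exists>m < ?R. (vS, vA m) \<in> set p" if p: "p \<in> st_paths ?I" for p
  proof -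
    obtain e where e: "e \<in> set p" "fst e = vS" "snd e \<noteq> vS"
      using cas_crosses_cut[OF arcs(2)[OF p], of "{vS}"] by auto
    then have "e \<in> arcs (graph ?I)" using arcs(1)[OF p] by blast
    then show ?thesis using e unfolding arcs_sat_instance sat_link_def by auto
  qed
  have stop: "\<exists>m < ?R. (vZ m, vT) \<in> set p" if p: "p \<in> st_paths ?I" for p
  proof -
    obtain e where e: "e \<in> set p" "fst e \<noteq> vT" "snd e = vT"
      using cas_crosses_cut[OF arcs(2)[OF p], of "- {vT}"] by auto
    then have "e \<in> arcs (graph ?I)" using arcs(1)[OF p] by blast
    then show ?thesis using e unfolding arcs_sat_instance sat_link_def by auto
  qed
  \<comment> \<open>There are \<open>?R\<close> edges of capacity \<open>1\<close> at the source and
    every path uses one of them, so rate \<open>?R\<close> leaves none of them idle.\<close>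
  have each: "\<exists>p. p \<in> st_paths ?I \<and> (vS, vA m) \<in> set p \<and> f p > 0" if m:
      "m < ?R" for m
  proof (rule ccontr)
    assume no: "\<not> ?thesis"
    have "?R = (\<Sum>p\<in>st_paths ?I. f p)" using f(1) by (simp add: feasible_flow_def)
    also have "\<dots> \<le> (\<Sum>p\<in>st_paths ?I. \<Sum>k<?R. if (vS, vA k) \<in> set p then f
        p else 0)"
    proof (rule sum_mono)
      fix p assume "p \<in> st_paths ?I"
      then obtain k where "k < ?R" "(vS, vA k) \<in> set p" using start by blast
      then show "f p \<le> (\<Sum>k<?R. if (vS, vA k) \<in> set p then f p else 0)"
        using member_le_sum[of k "{..<?R}" "\<lambda>k. if (vS, vA k) \<in> set p then f p else 0"]
            by simp
    qed
    also have "\<dots> = (\<Sum>k<?R. \<Sum>p\<in>st_paths ?I. if (vS, vA k) \<in> set p then f p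
        else 0)"
      by (rule sum.swap)
    also have "\<dots> = (\<Sum>k<?R. edge_rate ?I f (vS, vA k))"
      unfolding edge_rate_def using fs by (simp add: sum.inter_filter)
    also have "\<dots> \<le> (\<Sum>k<?R. if k = m then 0 else 1)"
    proof (rule sum_mono)
      fix k assume k: "k \<in> {..<?R}"
      show "edge_rate ?I f (vS, vA k) \<le> (if k = m then 0 else 1)"
      proof (cases "k = m")
        case True
        have "edge_rate ?I f (vS, vA m) = 0"
          unfolding edge_rate_def using no by (intro sum.neutral) auto
        then show ?thesis using True by simp
      next
        case False
        have "(vS, vA k) \<in> arcs (graph ?I)" using k by (auto simp: arcs_sat_instance)
        then show ?thesis using rate False by simp
      qed
    qed
    also have "\<dots> = card ({..<?R} - {m})"
      by (simp add: sum.If_cases Diff_eq)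
    also have "\<dots> < ?R" using m by simp
    finally show False by simp
  qed
  then have "\<forall>m. \<exists>p. m < ?R \<longrightarrow> p \<in> st_paths ?I \<and> (vS, vA m)
      \<in> set p \<and> f p > 0" by blast
  from choice[OF this] obtain P where P0: "\<forall>m. m < ?R \<longrightarrow> P m \<in> st_paths
      ?I \<and> (vS, vA m) \<in> set (P m) \<and> f (P m) > 0" ..
  then have P: "P m \<in> st_paths ?I" "(vS, vA m) \<in> set (P m)" "f (P m) > 0" if "m < ?R" for m
    using that by auto
  have "\<forall>m. \<exists>k. m < ?R \<longrightarrow> k < ?R \<and> (vZ k, vT) \<in> set (P m)"
      using P(1) stop by blast
  from choice[OF this] obtain \<sigma> where s0: "\<forall>m. m < ?R \<longrightarrow> \<sigma> m <
      ?R \<and> (vZ (\<sigma> m), vT) \<in> set (P m)" ..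
  then have \<sigma>: "\<sigma> m < ?R" "(vZ (\<sigma> m), vT) \<in> set (P m)" if "m < ?R" for m
      using that by auto
  have P_inj: "m = m'" if "m < ?R" "m' < ?R" "P m = P m'" for m m'
    using apath_tail_inj[OF ap[OF P(1)[OF that(1)]] P(2)[OF that(1)], of "(vS, vA m')"] P(2)[OF
        that(2)] that(3)
    by auto
  \<comment> \<open>The delays at the two ends of the path add up to
    \<open>m + (?R - \<sigma> m)\<close>, and the bound is \<open>?R\<close>.\<close>
  have le: "m \<le> \<sigma> m" if m: "m < ?R" for m
  proof -
    have "delay ?I (vS, vA m) + delay ?I (vZ (\<sigma> m), vT) \<le> path_delay ?I (P m)"
      unfolding path_delay_def using P(2)[OF m] \<sigma>(2)[OF m] by (intro sum_two_le) auto
    then have "m + (?R - \<sigma> m) \<le> ?R"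
      using del[OF P(1,3)[OF m]] m \<sigma>(1)[OF m] by (simp add: delay_sat_instance)
    then show ?thesis using \<sigma>(1)[OF m] by simp
  qed
  have inj: "inj_on \<sigma> {..<?R}"
  proof (rule inj_onI)
    fix m m' assume m: "m \<in> {..<?R}" "m' \<in> {..<?R}" "\<sigma> m = \<sigma> m'"
    then have "P m = P m'" using unique[of "P m" "P m'" "(vZ (\<sigma> m), vT)"] P[of m] P[of m']
        \<sigma>(2)[of m] \<sigma>(2)[of m'] by simp
    then show "m = m'" using P_inj m by simp
  qed
  have "\<sigma> ` {..<?R} = {..<?R}"
    using inj \<sigma>(1) by (intro endo_inj_surj) auto
  \<comment> \<open>As a permutation, \<sigma> preserves the sum; together with
    \<open>m \<le> \<sigma> m\<close> for all \<open>m\<close> this forces equality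
    everywhere.\<close>
  then have "(\<Sum>m<?R. m) = (\<Sum>m<?R. \<sigma> m)"
    using sum.reindex[OF inj, of "\<lambda>m. m"] by simp
  then have id: "\<sigma> m = m" if "m < ?R" for m
    using sum_mono_inv[of "\<lambda>m. m" "{..<?R}" \<sigma> m] le that by auto
  have sink: "m' = m" if "m < ?R" "(vZ m', vT) \<in> set (P m)" for m m'
    using apath_head_inj[OF ap[OF P(1)[OF that(1)]] that(2) \<sigma>(2)[OF that(1)]] id[OF that(1)]
        by auto
  have second: "\<exists>x q. (vA m, x) \<in> arcs (graph ?I) \<and> cas x q vT \<and> set q
      \<subseteq> set (P m)" if m: "m < ?R" for m
  proof -
    have c: "cas vS (P m) vT" by (rule arcs(2)[OF P(1)[OF m]])
    obtain e q where e: "P m = e # q" using P(2)[OF m] by (cases "P m") auto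
    then have "fst e = vS" "cas (snd e) q vT" using c by auto
    moreover have "e = (vS, vA m)"
      using apath_tail_inj[OF ap[OF P(1)[OF m]] P(2)[OF m], of e] e \<open>fst e = vS\<close> by
          auto
    ultimately have q: "cas (vA m) q vT" by simp
    then obtain e' q' where e': "q = e' # q'" by (cases q) auto
    then have "fst e' = vA m" "cas (snd e') q' vT" using q by auto
    moreover have "e' \<in> arcs (graph ?I)" using arcs(1)[OF P(1)[OF m]] e e' by auto
    ultimately show ?thesis using e e'
      by (intro exI[of _ "snd e'"] exI[of _ q']) (cases e', auto)
  qed
  have chain: "\<exists>l. (l = 2 * i \<or> l = 2 * i + 1) \<and> (\<forall>j < C. (vW l j, vW l
      (Suc j)) \<in> set (P i))" if i: "i < N" for i
  proof -
    have iR: "i < ?R" using i by simp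
    obtain x q where q: "(vA i, x) \<in> arcs (graph ?I)" "cas x q vT" "set q \<subseteq> set (P i)"
      using second[OF iR] by blast
    from q(1) i obtain l where l: "l = 2 * i \<or> l = 2 * i + 1" "x = vW l 0"
      unfolding arcs_sat_instance sat_link_def by auto
    have "(vW l j, vW l (Suc j)) \<in> set (P i)" if j: "j < C" for j
    proof -
      \<comment> \<open>A side exit of the chain leads to a clause terminal, which belongs to the
        cut, and from there only to the sink; the path of \<open>i\<close> enters the sink from
        \<open>vZ i\<close> alone. So the cut can only be left along the \<open>j\<close>-th chain
        edge.\<close>
      let ?X = "{vW l k | k. k \<le> j} \<union> {vZ m | m. m \<noteq> i}"
      obtain e where e: "e \<in> set q" "fst e \<in> ?X" "snd e \<notin> ?X"
        using cas_crosses_cut[OF q(2), of ?X] l(2) by auto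
      have eP: "e \<in> set (P i)" using e(1) q(3) by blast
      then have ea: "e \<in> arcs (graph ?I)" using arcs(1)[OF P(1)[OF iR]] by blast
      show ?thesis
      proof (cases "\<exists>m. fst e = vZ m")
        case True
        then obtain m where "e = (vZ m, vT)" "m \<noteq> i"
          using e ea unfolding arcs_sat_instance sat_link_def by auto
        then show ?thesis using sink[OF iR, of m] eP by blast
      next
        case False
        then obtain k where k: "fst e = vW l k" "k \<le> j" using e(2) by auto
        then have "e = (vW l k, vW l (Suc k))"
          using ea e(3) i j unfolding arcs_sat_instance sat_link_def by auto
        moreover have "k = j" using e(3) k(2) calculation by (cases "k = j") auto
        ultimately show ?thesis using eP by simp
      qed
    qed
    then show ?thesis using l(1) by blast
  qed
  then have "\<forall>i. \<exists>l. i < N \<longrightarrow> (l = 2 * i \<or> l = 2 * i + 1) \<and>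
      (\<forall>j < C. (vW l j, vW l (Suc j)) \<in> set (P i))"
    by blast
  from choice[OF this] obtain lit where lit0: "\<forall>i. i < N \<longrightarrow>
    (lit i = 2 * i \<or> lit i = 2 * i + 1) \<and> (\<forall>j < C. (vW (lit i) j, vW (lit i) (Suc
        j)) \<in> set (P i))" ..
  \<comment> \<open>A variable is true if its unit occupies the chain of its negation. If the
    literal used by clause \<open>j\<close> were false, its chain would be occupied and two units
    would share an edge of capacity \<open>1\<close>.\<close>
  have "\<exists>l < 2 * N. Lit j l \<and> even (lit (l div 2)) = odd l" if j: "j < C" for j
  proof -
    let ?m = "N + j"
    have mR: "?m < ?R" using j by simp
    obtain x q where q: "(vA ?m, x) \<in> arcs (graph ?I)" "cas x q vT" "set q \<subseteq> set (P
        ?m)"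
      using second[OF mR] by blast
    from q(1) obtain l where l: "l < 2 * N" "Lit j l" "x = vW l j"
      unfolding arcs_sat_instance sat_link_def by auto
    let ?X = "{vW l j} \<union> {vZ m | m. m \<noteq> ?m}"
    obtain e where e: "e \<in> set q" "fst e \<in> ?X" "snd e \<notin> ?X"
      using cas_crosses_cut[OF q(2), of ?X] l(3) by auto
    have eP: "e \<in> set (P ?m)" using e(1) q(3) by blast
    then have ea: "e \<in> arcs (graph ?I)" using arcs(1)[OF P(1)[OF mR]] by blast
    have edge: "(vW l j, vW l (Suc j)) \<in> set (P ?m)"
    proof (cases "\<exists>m. fst e = vZ m")
      case True
      then obtain m where "e = (vZ m, vT)" "m \<noteq> ?m"
        using e ea unfolding arcs_sat_instance sat_link_def by auto
      then show ?thesis using sink[OF mR, of m] eP by blast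
    next
      case False
      then have "fst e = vW l j" using e(2) by auto
      then have "e = (vW l j, vW l (Suc j))"
        using ea e(3) j unfolding arcs_sat_instance sat_link_def by auto
      then show ?thesis using eP by simp
    qed
    have "even (lit (l div 2)) = odd l"
    proof (rule ccontr)
      let ?i = "l div 2"
      assume ne: "even (lit ?i) \<noteq> odd l"
      have i: "?i < N" using l(1) by simp
      have li: "lit ?i = 2 * ?i \<or> lit ?i = 2 * ?i + 1" "\<forall>j < C. (vW (lit ?i) j, vW (lit
          ?i) (Suc j)) \<in> set (P ?i)"
        using lit0 i by auto
      have "lit ?i = l" using li(1) ne by presburger
      then have "(vW l j, vW l (Suc j)) \<in> set (P ?i)" using li(2) j by auto
      then have "P ?i = P ?m"
        using unique[of "P ?i" "P ?m"] P[of ?i] P[of ?m] edge i j by auto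
      then show False using P_inj[of ?i ?m] i j by simp
    qed
    then show ?thesis using l by blast
  qed
  then show ?thesis by (intro exI[of _ "\<lambda>i. even (lit i)"]) blast
qed

section \<open>Printing the network\<close>

lemma concat_map_concat: "concat (map h (concat (map F xs))) = concat (map (\<lambda>i. concat (map
    h (F i))) xs)"
  by (induction xs) auto

text \<open>Terms have no subtraction, so the difference is found by a loop over all candidates that
  prints only the right one.\<close>

lemma enc_nat_diff:
  "m \<le> R \<Longrightarrow> enc_nat (R - m) = concat (map (\<lambda>k. if m + k = R then enc_nat
      k else []) [0..<Suc R])"
  by (subst concat_map_single[of "R - m"]) auto

lemma concat_map_cong: "(\<And>i. i < n \<Longrightarrow> f i = g i) \<Longrightarrow> concat (map
    f [0..<n]) = concat (map g [0..<n])"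
  by (induction n) auto

lemma odef_sat_instance:
  assumes [def_intros]: "tdef (\<lambda>n e. N n)" "tdef (\<lambda>n e. C n)"
    and Lit: "fdef (\<lambda>n B e. Lit n B (e 0) (e 1))"
  shows "odef (\<lambda>n B e. enc_instance (sat_instance (N n) (C n) (Lit n B)))"
proof -
  note [def_intros] = fdef_sub2[OF Lit]
  let ?h = "\<lambda>x. True # enc_edge x"
  define E2 where "E2 n = concat (map (\<lambda>m. True # enc_nat (vZ m) @ enc_nat vT @ enc_nat 1 @
      concat (map (\<lambda>k. if m + k = N n + C n then enc_nat k else []) [0..<Suc (N n + C n)]))
          [0..<N n + C n])" for n
  have E2: "concat (map ?h (map (\<lambda>m. ((vZ m, vT), (1, N n + C n - m))) [0..<N n + C n])) =
      E2 n" for n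
    unfolding E2_def map_map comp_def enc_edge.simps
    by (intro concat_map_cong) (simp add: enc_nat_diff del: upt_Suc)
  define F where "F n B = replicate (pr 6 (pr (2 * N n + C n + 2) (2 * N n + C n + 2))) True @
      [False] @
     (concat (map (\<lambda>m. True # enc_edge ((vS, vA m), (1, m))) [0..<N n + C n]) @ E2 n @
     concat (map (\<lambda>i. concat (map ?h [((vA i, vW (2 * i) 0), (1, 0)), ((vA i, vW (2 * i +
         1) 0), (1, 0)),
                       ((vW (2 * i) (C n), vZ i), (1, 0)), ((vW (2 * i + 1) (C n), vZ i), (1,
                           0))])) [0..<N n]) @
     concat (map (\<lambda>l. concat (map (\<lambda>j. ?h ((vW l j, vW l (Suc j)), (1, 0)) @
       (if Lit n B j l then concat (map ?h [((vA (N n + j), vW l j), (1, 0)), ((vW l (Suc j), vZ (N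
           n + j)), (1, 0))]) else []))
       [0..<C n])) [0..<2 * N n])) @ [False] @
     enc_nat vS @ enc_nat vT @ enc_nat (N n + C n) @ False # enc_nat (N n + C n)" for n B
  have "odef (\<lambda>n B e. F n B)"
    unfolding F_def E2_def enc_edge.simps list.map concat.simps append_Nil append_Nil2
    by (intro def_intros)
  moreover have "F n B = enc_instance (sat_instance (N n) (C n) (Lit n B))" for n B
  proof -
    have g: "concat (map ?h (((vW l j, vW l (Suc j)), (1, 0)) #
       (if Lit n B j l then [((vA (N n + j), vW l j), (1, 0)), ((vW l (Suc j), vZ (N n + j)), (1,
           0))] else []))) =
       ?h ((vW l j, vW l (Suc j)), (1, 0)) @
       (if Lit n B j l then concat (map ?h [((vA (N n + j), vW l j), (1, 0)), ((vW l (Suc j), vZ (N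
           n + j)), (1, 0))]) else [])"
      for l j by simp
    show ?thesis
      unfolding F_def sat_instance_def enc_instance_def instance_data.simps enc_list_def
          sat_edges_def
        map_append concat_append E2 concat_map_concat g
      by (simp add: comp_def enc_int_def nat_int_add del: enc_edge.simps)
  qed
  ultimately show ?thesis by (simp only:)
qed

text \<open>The formula of \<open>x\<close> is given only by its numbers of variables and clauses
  and the incidence of literals. If these are definable, the composition with the network is
  computable in polynomial time, so no encoding of formulas is needed.\<close>

theorem sat_reduction:
  assumes "tdef (\<lambda>n e. N n)" "tdef (\<lambda>n e. C n)" "fdef (\<lambda>n B e. Lit n B (e
      0) (e 1))"
    and pos: "\<And>n. N n > 0"
    and L: "\<And>x. x \<in> L \<longleftrightarrow> (\<exists>A. \<forall>j < C (length x).
        \<exists>l < 2 * N (length x).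
      Lit (length x) (bits_of x) j l \<and> A (l div 2) = odd l)"
  shows "poly_time_reducible L
    (enc_instance ` {I \<in> int_min_max_delay. max_number I \<le> length (enc_instance I)})"
proof -
  let ?I = "\<lambda>x. sat_instance (N (length x)) (C (length x)) (Lit (length x) (bits_of x))"
  have "poly_time_computable (\<lambda>x. enc_instance (?I x))"
    using odef_poly_time[OF odef_sat_instance[OF assms(1-3)]] .
  moreover have "x \<in> L \<longleftrightarrow> enc_instance (?I x) \<in>
      enc_instance ` {I \<in> int_min_max_delay. max_number I \<le> length (enc_instance I)}" for x
  proof -
    have "x \<in> L \<longleftrightarrow> ?I x \<in> int_min_max_delay"
      using L[of x] flow_imp_sat[of "N (length x)" "C (length x)" "Lit (length x) (bits_of x)"]
        sat_imp_flow[of "N (length x)" "C (length x)" "Lit (length x) (bits_of x)"] pos[of "length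
            x"]
      by (metis add_gr_0)
    then show ?thesis
      using max_number_sat_instance by (simp add: inj_image_mem_iff[OF inj_enc_instance])
  qed
  ultimately show ?thesis unfolding poly_time_reducible_def by blast
qed

section \<open>Encoding computations by clauses\<close>

text \<open>Transitions are made total by letting a halted machine repeat its configuration.
  Acceptance can then be read at one fixed time.\<close>

definition next_of :: "tm \<Rightarrow> nat \<Rightarrow> nat list \<Rightarrow> nat \<times> (nat
    \<times> move) list" where
  "next_of M q as = (case delta M q as of None \<Rightarrow> (q, map (\<lambda>a. (a, Stay)) as) |
      Some r \<Rightarrow> r)"

lemma step_next_of:
  "step M (q, ts) = (fst (next_of M q (map tape_read ts)),
     map2 tape_act (snd (next_of M q (map tape_read ts))) ts)"
proof (cases "delta M q (map tape_read ts)")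
  case None
  then show ?thesis by (simp only: step.simps next_of_def option.case fst_conv snd_conv map2_stay)
next
  case (Some r)
  then show ?thesis by (cases r) (simp only: step.simps next_of_def option.case fst_conv snd_conv
      prod.case)
qed

definition cell_at :: "tape \<Rightarrow> int \<Rightarrow> nat" where
  "cell_at tp d = snd tp (fst tp + d)"

text \<open>Seen from the head, a move shifts the whole tape, and the cell just written lies at
  distance \<open>- shift m\<close>. Head positions need no variables in this description.\<close>

lemma cell_at_tape_act:
  "cell_at (tape_act (w, m) tp) d = (if d + shift m = 0 then w else cell_at tp (d + shift m))"
  by (cases tp) (auto simp: cell_at_def algebra_simps)

lemma tape_read_cell_at: "tape_read tp = cell_at tp 0"
  by (cases tp) (simp add: cell_at_def)

definition wf_conf :: "tm \<Rightarrow> config \<Rightarrow> bool" where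
  "wf_conf M c \<longleftrightarrow> fst c < states M \<and> length (snd c) = tapes M \<and>
     (\<forall>k < tapes M. \<forall>d. cell_at (snd c ! k) d < symbols M)"

lemma wf_next_of:
  assumes "wf_tm M" "q < states M" "length as = tapes M" "set as \<subseteq> {..<symbols M}"
  shows "fst (next_of M q as) < states M" "length (snd (next_of M q as)) = tapes M"
    "k < tapes M \<Longrightarrow> fst (snd (next_of M q as) ! k) < symbols M"
proof -
  have *: "fst (next_of M q as) < states M \<and> length (snd (next_of M q as)) = tapes M \<and>
      fst ` set (snd (next_of M q as)) \<subseteq> {..<symbols M}"
  proof (cases "delta M q as")
    case None
    then show ?thesis using assms by (auto simp: next_of_def)
  next
    case (Some r)
    obtain q' acts where r: "r = (q', acts)" by (cases r)
    have "q' < states M \<and> length acts = tapes M \<and> fst ` set acts \<subseteq> {..<symbols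
        M}"
      using assms Some r unfolding wf_tm_def by blast
    then show ?thesis using Some r by (simp add: next_of_def)
  qed
  then show "fst (next_of M q as) < states M" "length (snd (next_of M q as)) = tapes M" by auto
  show "fst (snd (next_of M q as) ! k) < symbols M" if "k < tapes M"
    using * that nth_mem[of k "snd (next_of M q as)"] by (auto simp: image_subset_iff)
qed

lemma wf_conf_step:
  assumes "wf_tm M" "wf_conf M c"
  shows "wf_conf M (step M c)"
proof -
  obtain q ts where c: "c = (q, ts)" by (cases c)
  let ?as = "map tape_read ts"
  have as: "q < states M" "length ?as = tapes M" "set ?as \<subseteq> {..<symbols M}"
  proof -
    have "tape_read tp < symbols M" if "tp \<in> set ts" for tp
    proof -
      obtain k where "k < tapes M" "tp = ts ! k"
        using \<open>tp \<in> set ts\<close> assms(2) c by (auto simp: in_set_conv_nth wf_conf_def)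
      then show ?thesis using assms(2) c by (simp add: wf_conf_def tape_read_cell_at)
    qed
    then show "q < states M" "length ?as = tapes M" "set ?as \<subseteq> {..<symbols M}"
      using assms(2) c by (auto simp: wf_conf_def)
  qed
  note w = wf_next_of[OF assms(1) as]
  have "cell_at (map2 tape_act (snd (next_of M q ?as)) ts ! k) d < symbols M" if "k < tapes M" for
      k d
    using that w(2) w(3)[OF that] assms(2) c
    by (cases "snd (next_of M q ?as) ! k") (auto simp: wf_conf_def cell_at_tape_act)
  then show ?thesis using w c assms(2) unfolding wf_conf_def step_next_of by (simp add: c
      step_next_of del: step.simps)
qed

lemma wf_conf_init: "wf_tm M \<Longrightarrow> wf_conf M (init M z)"
  by (auto simp: wf_conf_def wf_tm_def init_def tape_of_def cell_at_def sym_def nth_Cons split: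
      nat.split)

lemma funpow_halted: "halted M c \<Longrightarrow> (step M ^^ k) c = c"
proof (induction k)
  case (Suc k)
  then show ?case by (cases c) simp
qed simp

text \<open>A move is split into two natural numbers so that the new position \<open>p'\<close> of a
  cell is given by \<open>p' + dn m = p + up m\<close>, without subtraction.\<close>

fun dn :: "move \<Rightarrow> nat" where
  "dn Move_Right = 1" | "dn Stay = 0" | "dn Move_Left = 0"

fun up :: "move \<Rightarrow> nat" where
  "up Move_Right = 0" | "up Stay = 0" | "up Move_Left = 1"

lemma shift_dn_up: "shift m = int (dn m) - int (up m)"
  by (cases m) auto

definition var :: "nat \<Rightarrow> nat \<Rightarrow> nat \<Rightarrow> nat \<Rightarrow> nat"
    where
  "var \<tau> k p a = pr \<tau> (pr k (pr p a))"

lemma var_inject [simp]: "var \<tau> k p a = var \<tau>' k' p' a' \<longleftrightarrow> \<tau> =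
    \<tau>' \<and> k = k' \<and> p = p' \<and> a = a'"
  by (simp add: var_def)

lemma tdef_var_code [def_intros]:
  "tdef f \<Longrightarrow> tdef g \<Longrightarrow> tdef h \<Longrightarrow> tdef i
      \<Longrightarrow> tdef (\<lambda>n e. var (f n e) (g n e) (h n e) (i n e))"
  unfolding var_def by (intro def_intros)

text \<open>
  The tapes are described relative to the head: \<open>var \<tau> k p a\<close> with \<open>k <
      tapes M\<close> says that after
  \<open>\<tau>\<close> steps tape \<open>k\<close> contains \<open>a\<close> at distance \<open>p
      - T\<close> from its head; \<open>k = tapes M\<close> encodes the
  state \<open>a\<close> and \<open>k = tapes M + 1\<close> the index \<open>a\<close> of the
      current pair of state and scanned
  symbols in \<open>CL\<close>. The clauses only force the facts of the run to be true, so
      uniqueness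
  of symbols and states need not be expressed.
\<close>

locale tableau =
  fixes M :: tm and T P :: "nat \<Rightarrow> nat" and CL :: "(nat \<times> nat list) list"
  assumes wf: "wf_tm M"
    and T_tdef: "tdef (\<lambda>n e. T n)" and P_tdef: "tdef (\<lambda>n e. P n)"
    and CL: "set CL = {(q, as). q < states M \<and> length as = tapes M \<and> set as \<subseteq>
        {..<symbols M}}"
    and T_pos: "T n \<ge> 1"
begin

abbreviation "K \<equiv> tapes M"
abbreviation "m \<equiv> length CL"

section \<open>The clauses\<close>

definition cq :: "nat \<Rightarrow> nat" where "cq c = fst (CL ! c)"
definition ca :: "nat \<Rightarrow> nat \<Rightarrow> nat" where "ca c k = snd (CL ! c) ! k"
definition nq :: "nat \<Rightarrow> nat" where "nq c = fst (next_of M (fst (CL ! c)) (snd (CL !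
    c)))"
definition nw :: "nat \<Rightarrow> nat \<Rightarrow> nat" where "nw c k = fst (snd (next_of M (fst
    (CL ! c)) (snd (CL ! c))) ! k)"
definition nm :: "nat \<Rightarrow> nat \<Rightarrow> move" where "nm c k = snd (snd (next_of M
    (fst (CL ! c)) (snd (CL ! c))) ! k)"

lemma CL_bounds:
  assumes "c < m"
  shows "cq c < states M" "length (snd (CL ! c)) = K" "nq c < states M"
    "k < K \<Longrightarrow> ca c k < symbols M" "k < K \<Longrightarrow> nw c k < symbols M"
proof -
  have "CL ! c \<in> set CL" using assms by simp
  then have c: "fst (CL ! c) < states M" "length (snd (CL ! c)) = K" "set (snd (CL ! c))
      \<subseteq> {..<symbols M}"
    unfolding CL by auto
  then show "cq c < states M" "length (snd (CL ! c)) = K" "nq c < states M"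
    "k < K \<Longrightarrow> ca c k < symbols M" "k < K \<Longrightarrow> nw c k < symbols M"
    using wf_next_of[OF wf c] nth_mem[of k "snd (CL ! c)"]
    by (auto simp: cq_def ca_def nq_def nw_def subset_iff)
qed

text \<open>The literals \<open>2 * v\<close> and \<open>2 * v + 1\<close> are the negation of
  \<open>v\<close> and \<open>v\<close> itself, so this clause is an implication from the state and
  all scanned symbols to the index \<open>c\<close> of their combination. The number in the name of
  each family is the tag of its clause codes.\<close>

definition fam2 :: "nat \<Rightarrow> nat \<Rightarrow> nat \<Rightarrow> bool" where
  "fam2 n j l \<longleftrightarrow> (\<exists>\<tau> < T n. \<exists>c \<in> {..<m}. j = pr 2 (pr
      \<tau> c) \<and>
     (l = 2 * var \<tau> K 0 (cq c) \<or> (\<exists>k \<in> {..<K}. l = 2 * var \<tau> k (T n) (ca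
         c k)) \<or>
      l = 2 * var \<tau> (K + 1) 0 c + 1))"

definition fam3 :: "nat \<Rightarrow> nat \<Rightarrow> nat \<Rightarrow> bool" where
  "fam3 n j l \<longleftrightarrow> (\<exists>\<tau> < T n. \<exists>c \<in> {..<m}. j = pr 3 (pr
      \<tau> c) \<and>
     (l = 2 * var \<tau> (K + 1) 0 c \<or> l = 2 * var (Suc \<tau>) K 0 (nq c) + 1))"

definition fam4 :: "nat \<Rightarrow> nat \<Rightarrow> nat \<Rightarrow> bool" where
  "fam4 n j l \<longleftrightarrow> (\<exists>\<tau> < T n. \<exists>c \<in> {..<m}. \<exists>k
      \<in> {..<K}. j = pr 4 (pr \<tau> (pr c k)) \<and>
     (l = 2 * var \<tau> (K + 1) 0 c \<or>
      (\<exists>p < 2 * T n + 2. p + dn (nm c k) = T n + up (nm c k) \<and> l = 2 * var (Suc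
          \<tau>) k p (nw c k) + 1)))"

text \<open>The frame clauses: a cell that is not scanned keeps its symbol and changes its distance.
  Positions \<open>p\<close> with no natural \<open>p'\<close>, at the left end under a move to the
  right, yield no clause.\<close>

definition fam5 :: "nat \<Rightarrow> nat \<Rightarrow> nat \<Rightarrow> bool" where
  "fam5 n j l \<longleftrightarrow> (\<exists>\<tau> < T n. \<exists>c \<in> {..<m}. \<exists>k
      \<in> {..<K}. \<exists>p < 2 * T n + 1. \<exists>a \<in> {..<symbols M}.
     p \<noteq> T n \<and> j = pr 5 (pr \<tau> (pr c (pr k (pr p a)))) \<and>
     (\<exists>p' < 2 * T n + 2. p' + dn (nm c k) = p + up (nm c k) \<and>
       (l = 2 * var \<tau> (K + 1) 0 c \<or> l = 2 * var \<tau> k p a \<or> l = 2 * var (Suc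
           \<tau>) k p' a + 1)))"

definition fam6 :: "nat \<Rightarrow> nat \<Rightarrow> nat \<Rightarrow> bool" where
  "fam6 n j l \<longleftrightarrow> j = pr 6 0 \<and> l = 2 * var 0 K 0 0 + 1"

definition fam7 :: "nat \<Rightarrow> nat \<Rightarrow> nat \<Rightarrow> bool" where
  "fam7 n j l \<longleftrightarrow> (\<exists>k \<in> {1..<K}. \<exists>p < 2 * T n + 1. j = pr 7
      (pr k p) \<and> l = 2 * var 0 k p 0 + 1)"

text \<open>Position \<open>T n\<close> is cell \<open>0\<close>, where the code of \<open>x\<close>
  starts: a \<open>True\<close> in front of every bit and a final \<open>False\<close>, hence
  \<open>2 * n + 1\<close> cells. The next \<open>P n\<close> cells are left open for the
  certificate, and the rest is blank.\<close>

definition fixed_cell :: "nat \<Rightarrow> (nat \<Rightarrow> bool) \<Rightarrow> nat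
    \<Rightarrow> nat \<Rightarrow> bool" where
  "fixed_cell n B p a \<longleftrightarrow> p < T n \<and> a = 0 \<or> (\<exists>i < n. p = T n + 2
      * i \<and> a = 2) \<or>
     (\<exists>i < n. p = T n + 2 * i + 1 \<and> (B i \<and> a = 2 \<or> \<not> B i \<and> a = 1))
         \<or>
     p = T n + 2 * n \<and> a = 1 \<or> T n + 2 * n + 1 + P n \<le> p \<and> a = 0"

definition fam8 :: "nat \<Rightarrow> (nat \<Rightarrow> bool) \<Rightarrow> nat \<Rightarrow> nat
    \<Rightarrow> bool" where
  "fam8 n B j l \<longleftrightarrow> (\<exists>p < 2 * T n + 1. \<exists>a \<in> {..<3}.
      fixed_cell n B p a \<and>
     j = pr 8 (pr p a) \<and> l = 2 * var 0 0 p a + 1)"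

definition fam9 :: "nat \<Rightarrow> nat \<Rightarrow> nat \<Rightarrow> bool" where
  "fam9 n j l \<longleftrightarrow> (\<exists>i < P n. j = pr 9 i \<and> (\<exists>a \<in> {..<3}.
      l = 2 * var 0 0 (T n + 2 * n + 1 + i) a + 1))"

text \<open>Blanks persist to the right, so the open cells hold a string of any length up to
  \<open>P n\<close> followed by blanks.\<close>

definition fam10 :: "nat \<Rightarrow> nat \<Rightarrow> nat \<Rightarrow> bool" where
  "fam10 n j l \<longleftrightarrow> (\<exists>i < P n. j = pr 10 i \<and> (l = 2 * var 0 0 (T n +
      2 * n + 1 + i) 0 \<or>
     l = 2 * var 0 0 (T n + 2 * n + 1 + Suc i) 0 + 1))"

text \<open>Unit clauses that exclude every symbol other than \<open>2\<close>, the symbol for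
  \<open>True\<close>, under the head of the first tape at time \<open>T n\<close>.\<close>

definition fam11 :: "nat \<Rightarrow> nat \<Rightarrow> nat \<Rightarrow> bool" where
  "fam11 n j l \<longleftrightarrow> (\<exists>a \<in> {..<symbols M}. a \<noteq> 2 \<and> j = pr
      11 a \<and> l = 2 * var (T n) 0 (T n) a)"

definition lit :: "nat \<Rightarrow> (nat \<Rightarrow> bool) \<Rightarrow> nat \<Rightarrow> nat
    \<Rightarrow> bool" where
  "lit n B j l \<longleftrightarrow> fam2 n j l \<or> fam3 n j l \<or> fam4 n j l \<or> fam5 n j l
      \<or> fam6 n j l \<or> fam7 n j l \<or>
     fam8 n B j l \<or> fam9 n j l \<or> fam10 n j l \<or> fam11 n j l"

lemmas fam_defs = fam2_def fam3_def fam4_def fam5_def fam6_def fam7_def fam8_def fam9_def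
  fam10_def fam11_def

lemma fdef_lit: "fdef (\<lambda>n B e. lit n B (e 0) (e 1))"
  unfolding lit_def fam_defs fixed_cell_def
  by (intro def_intros T_tdef P_tdef fdef_finite_ex finite_lessThan finite_atLeastLessThan)

lemma lit_tag:
  "lit n B (pr 2 u) l = fam2 n (pr 2 u) l" "lit n B (pr 3 u) l = fam3 n (pr 3 u) l"
  "lit n B (pr 4 u) l = fam4 n (pr 4 u) l" "lit n B (pr 5 u) l = fam5 n (pr 5 u) l"
  "lit n B (pr 6 u) l = fam6 n (pr 6 u) l" "lit n B (pr 7 u) l = fam7 n (pr 7 u) l"
  "lit n B (pr 8 u) l = fam8 n B (pr 8 u) l" "lit n B (pr 9 u) l = fam9 n (pr 9 u) l"
  "lit n B (pr 10 u) l = fam10 n (pr 10 u) l" "lit n B (pr 11 u) l = fam11 n (pr 11 u) l"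
  by (simp_all add: lit_def fam_defs)

text \<open>A crude common bound on all components of codes. The codes of variables and clauses then
  lie below \<open>nvars\<close> and \<open>nclauses\<close>, where \<open>11\<close> is the largest
  tag; many numbers in these ranges code nothing.\<close>

definition X :: "nat \<Rightarrow> nat" where
  "X n = 2 * T n + 2 * n + P n + (K + symbols M + states M + m + 5)"

definition nvars :: "nat \<Rightarrow> nat" where
  "nvars n = Suc (pr (X n) (pr (X n) (pr (X n) (X n))))"

definition nclauses :: "nat \<Rightarrow> nat" where
  "nclauses n = Suc (pr 11 (pr (X n) (pr (X n) (pr (X n) (pr (X n) (X n))))))"

lemma tdef_sizes: "tdef (\<lambda>n e. nvars n)" "tdef (\<lambda>n e. nclauses n)"
  unfolding nvars_def nclauses_def X_def by (intro def_intros T_tdef P_tdef)+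

lemma var_bound:
  assumes "\<tau> \<le> X n" "k \<le> X n" "p \<le> X n" "a \<le> X n"
  shows "2 * var \<tau> k p a < 2 * nvars n" "Suc (2 * var \<tau> k p a) < 2 * nvars n" "var \<tau>
      k p a < nvars n"
proof -
  have "var \<tau> k p a \<le> pr (X n) (pr (X n) (pr (X n) (X n)))"
    unfolding var_def using assms by (intro pr_mono)
  then show "2 * var \<tau> k p a < 2 * nvars n" "Suc (2 * var \<tau> k p a) < 2 * nvars n" "var
      \<tau> k p a < nvars n"
    by (simp_all add: nvars_def)
qed

lemma code_bound1: "t \<le> 11 \<Longrightarrow> a \<le> X n \<Longrightarrow> pr t a < nclauses n"
  unfolding nclauses_def less_Suc_eq_le by (intro pr_mono order_trans[OF _ pr_ge(1)])

lemma code_bound2: "t \<le> 11 \<Longrightarrow> a \<le> X n \<Longrightarrow> b \<le> X n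
    \<Longrightarrow> pr t (pr a b) < nclauses n"
  unfolding nclauses_def less_Suc_eq_le by (intro pr_mono order_trans[OF _ pr_ge(1)[of "X n" "pr _
      (pr _ _)"]])

lemma code_bound3:
  "t \<le> 11 \<Longrightarrow> a \<le> X n \<Longrightarrow> b \<le> X n \<Longrightarrow> c \<le>
      X n \<Longrightarrow> pr t (pr a (pr b c)) < nclauses n"
  unfolding nclauses_def less_Suc_eq_le by (intro pr_mono order_trans[OF _ pr_ge(1)[of "X n" "pr _
      _"]])

lemma code_bound5:
  "t \<le> 11 \<Longrightarrow> a \<le> X n \<Longrightarrow> b \<le> X n \<Longrightarrow> c \<le>
      X n \<Longrightarrow> d \<le> X n \<Longrightarrow> e \<le> X n \<Longrightarrow>
   pr t (pr a (pr b (pr c (pr d e)))) < nclauses n"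
  unfolding nclauses_def less_Suc_eq_le by (intro pr_mono)

lemma CL_X:
  "c < m \<Longrightarrow> cq c \<le> X n" "c < m \<Longrightarrow> nq c \<le> X n"
  "c < m \<Longrightarrow> k < K \<Longrightarrow> ca c k \<le> X n" "c < m \<Longrightarrow> k < K
      \<Longrightarrow> nw c k \<le> X n"
  by (drule CL_bounds(1) CL_bounds(3), simp add: X_def, drule CL_bounds(3), simp add: X_def,
      drule (1) CL_bounds(4), simp add: X_def, drule (1) CL_bounds(5), simp add: X_def)

lemma lit_bound:
  assumes "lit n B j l"
  shows "j < nclauses n" "l < 2 * nvars n"
proof -
  have "j < nclauses n \<and> l < 2 * nvars n"
    using assms unfolding lit_def
  proof (elim disjE)
    assume "fam2 n j l"
    then show ?thesis unfolding fam2_def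
      by (auto intro!: var_bound code_bound2 CL_X) (simp_all add: X_def)
  next
    assume "fam3 n j l"
    then show ?thesis unfolding fam3_def
      by (auto intro!: var_bound code_bound2 CL_X) (simp_all add: X_def)
  next
    assume "fam4 n j l"
    then show ?thesis unfolding fam4_def
      by (auto intro!: var_bound code_bound3 CL_X) (simp_all add: X_def)
  next
    assume "fam5 n j l"
    then show ?thesis unfolding fam5_def
      by (auto intro!: var_bound code_bound5 CL_X) (simp_all add: X_def)
  next
    assume "fam6 n j l"
    then show ?thesis unfolding fam6_def
      by (auto intro!: var_bound code_bound1 CL_X) (simp_all add: X_def)
  next
    assume "fam7 n j l"
    then show ?thesis unfolding fam7_def
      by (auto intro!: var_bound code_bound2 CL_X) (simp_all add: X_def)
  next
    assume "fam8 n B j l"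
    then show ?thesis unfolding fam8_def
      by (auto intro!: var_bound code_bound2 CL_X) (simp_all add: X_def)
  next
    assume "fam9 n j l"
    then show ?thesis unfolding fam9_def
      by (auto intro!: var_bound code_bound1 CL_X) (simp_all add: X_def)
  next
    assume "fam10 n j l"
    then show ?thesis unfolding fam10_def
      by (auto intro!: var_bound code_bound1 CL_X) (simp_all add: X_def)
  next
    assume "fam11 n j l"
    then show ?thesis unfolding fam11_def
      by (auto intro!: var_bound code_bound1 CL_X) (simp_all add: X_def)
  qed
  then show "j < nclauses n" "l < 2 * nvars n" by auto
qed

section \<open>Runs and satisfying assignments\<close>

definition run :: "bool list \<Rightarrow> nat \<Rightarrow> config" where
  "run z \<tau> = (step M ^^ \<tau>) (init M z)"

definition cel :: "bool list \<Rightarrow> nat \<Rightarrow> nat \<Rightarrow> int \<Rightarrow>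
    nat" where
  "cel z \<tau> k d = cell_at (snd (run z \<tau>) ! k) d"

definition reads :: "bool list \<Rightarrow> nat \<Rightarrow> nat list" where
  "reads z \<tau> = map tape_read (snd (run z \<tau>))"

lemma wf_run: "wf_conf M (run z \<tau>)"
  unfolding run_def by (induction \<tau>) (simp_all add: wf_conf_init[OF wf] wf_conf_step[OF wf])

lemma run_bounds:
  "fst (run z \<tau>) < states M" "k < K \<Longrightarrow> cel z \<tau> k d < symbols M" "length
      (snd (run z \<tau>)) = K"
  using wf_run[of z \<tau>] by (auto simp: wf_conf_def cel_def)

lemma reads_nth: "length (reads z \<tau>) = K" "k < K \<Longrightarrow> reads z \<tau> ! k = cel z
    \<tau> k 0"
  using run_bounds(3)[of z \<tau>] by (simp_all add: reads_def cel_def tape_read_cell_at)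

lemma comb_ex: "\<exists>c < m. CL ! c = (fst (run z \<tau>), reads z \<tau>)"
proof -
  have "reads z \<tau> ! k < symbols M" if "k < K" for k
    using run_bounds(2)[OF that] reads_nth(2)[OF that] by simp
  then have "(fst (run z \<tau>), reads z \<tau>) \<in> set CL"
    unfolding CL using run_bounds(1) reads_nth(1) by (auto simp: in_set_conv_nth)
  then show ?thesis by (metis in_set_conv_nth)
qed

lemma run_Suc:
  assumes "c < m" "CL ! c = (fst (run z \<tau>), reads z \<tau>)"
  shows "fst (run z (Suc \<tau>)) = nq c"
    "k < K \<Longrightarrow> cel z (Suc \<tau>) k d = (if d + shift (nm c k) = 0 then nw c k else
        cel z \<tau> k (d + shift (nm c k)))"
proof -
  have s: "run z (Suc \<tau>) = (nq c, map2 tape_act (snd (next_of M (fst (CL ! c)) (snd (CL !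
      c)))) (snd (run z \<tau>)))"
    using step_next_of[of M "fst (run z \<tau>)" "snd (run z \<tau>)"] assms(2)
    by (simp add: run_def nq_def reads_def del: step.simps)
  then show "fst (run z (Suc \<tau>)) = nq c" by simp
  have "CL ! c \<in> set CL" using assms(1) by simp
  then have c: "fst (CL ! c) < states M" "length (snd (CL ! c)) = K" "set (snd (CL ! c))
      \<subseteq> {..<symbols M}"
    unfolding CL by auto
  show "cel z (Suc \<tau>) k d = (if d + shift (nm c k) = 0 then nw c k else cel z \<tau> k (d +
      shift (nm c k)))"
    if "k < K"
  proof -
    have "snd (run z (Suc \<tau>)) ! k = tape_act (nw c k, nm c k) (snd (run z \<tau>) ! k)"
      using that s wf_next_of(2)[OF wf c] run_bounds(3)[of z \<tau>] by (simp add: nw_def nm_def)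
    then show ?thesis by (simp add: cel_def cell_at_tape_act)
  qed
qed

lemma run_0:
  "fst (run z 0) = 0"
  "cel z 0 0 d = (if 0 \<le> d \<and> d < int (length z) then sym (z ! nat d) else 0)"
  "1 \<le> k \<Longrightarrow> k < K \<Longrightarrow> cel z 0 k d = 0"
  by (simp_all add: run_def init_def cel_def cell_at_def tape_of_def nth_Cons')

definition fact_of :: "nat \<Rightarrow> bool list \<Rightarrow> nat \<Rightarrow> nat
    \<Rightarrow> nat \<Rightarrow> nat \<Rightarrow> bool" where
  "fact_of n z \<tau> k p a \<longleftrightarrow> k < K \<and> a = cel z \<tau> k (int p - int (T
      n)) \<or> k = K \<and> a = fst (run z \<tau>) \<or>
     k = K + 1 \<and> a < m \<and> CL ! a = (fst (run z \<tau>), reads z \<tau>)"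

lemma cel_pair_code:
  assumes "length y \<le> P (length x)" "fixed_cell (length x) (bits_of x) p a"
  shows "cel (pair_code x y) 0 0 (int p - int (T (length x))) = a"
proof -
  let ?z = "pair_code x y" and ?n = "length x"
  have len: "length ?z = 2 * ?n + 1 + length y" by (simp add: pair_code_def length_self_delim)
  have z: "i \<le> ?n \<Longrightarrow> ?z ! (2 * i) = (i < ?n)" "i < ?n \<Longrightarrow> ?z ! (2
      * i + 1) = x ! i" for i
    using self_delim_nth[of i x] by (auto simp: pair_code_def length_self_delim nth_append)
  from assms(2) show ?thesis
    unfolding fixed_cell_def
  proof (elim disjE exE conjE)
    fix i assume "i < ?n" "p = T ?n + 2 * i" "a = 2"
    then show ?thesis using z(1)[of i] by (simp add: run_0 len sym_def nat_mult_distrib)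
  next
    fix i assume i: "i < ?n" "p = T ?n + 2 * i + 1" "bits_of x i" "a = 2"
    have "nat (2 * int i + 1) = 2 * i + 1" by simp
    then show ?thesis using z(2)[of i] i by (simp add: run_0 len sym_def bits_of_def algebra_simps)
  next
    fix i assume i: "i < ?n" "p = T ?n + 2 * i + 1" "\<not> bits_of x i" "a = 1"
    have "nat (2 * int i + 1) = 2 * i + 1" by simp
    then show ?thesis using z(2)[of i] i by (simp add: run_0 len sym_def bits_of_def algebra_simps)
  next
    assume "p = T ?n + 2 * ?n" "a = 1"
    then show ?thesis using z(1)[of ?n] by (simp add: run_0 len sym_def nat_mult_distrib)
  qed (use assms(1) in \<open>auto simp: run_0 len\<close>)
qed

lemma cel_certificate:
  "cel (pair_code x y) 0 0 (int (T (length x) + 2 * length x + 1 + i) - int (T (length x))) =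
     (if i < length y then sym (y ! i) else 0)"
proof -
  have "nat (int (T (length x) + 2 * length x + 1 + i) - int (T (length x))) = 2 * length x + 1 +
      i" by simp
  then show ?thesis by (auto simp: run_0 pair_code_def length_self_delim nth_append)
qed

text \<open>The assignment consists of the facts that hold in the run, and every clause is an
  implication that the run obeys or, in the last family, acceptance. Only numbers \<open>j\<close>
  with at least one literal are treated as clauses.\<close>

lemma run_imp_sat:
  assumes y: "length y \<le> P (length x)" and acc: "cel (pair_code x y) (T (length x)) 0 0 = 2"
  shows "\<exists>A. \<forall>j. (\<exists>l. lit (length x) (bits_of x) j l) \<longrightarrow>
    (\<exists>l. lit (length x) (bits_of x) j l \<and> A (l div 2) = odd l)"
proof -
  let ?n = "length x" and ?z = "pair_code x y" and ?B = "bits_of x"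
  define A where "A v = (\<exists>\<tau> k p a. v = var \<tau> k p a \<and> fact_of ?n ?z \<tau> k
      p a)" for v
  have A: "A (var \<tau> k p a) = fact_of ?n ?z \<tau> k p a" for \<tau> k p a by (auto simp: A_def)
  have A0: "A (2 * var \<tau> k p a div 2) = odd (2 * var \<tau> k p a) \<longleftrightarrow>
      \<not> fact_of ?n ?z \<tau> k p a"
    and A1: "A ((2 * var \<tau> k p a + 1) div 2) = odd (2 * var \<tau> k p a + 1)
        \<longleftrightarrow> fact_of ?n ?z \<tau> k p a"
    for \<tau> k p a by (simp_all add: A)
  have K: "K \<ge> 1" using wf by (simp add: wf_tm_def)
  have "\<exists>l. lit ?n ?B j l \<and> A (l div 2) = odd l" if "lit ?n ?B j l0" for j l0
    using that unfolding lit_def[of _ _ _ l0]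
  proof (elim disjE)
    assume "fam2 ?n j l0"
    then obtain \<tau> c where c: "\<tau> < T ?n" "c < m" "j = pr 2 (pr \<tau> c)" by (auto simp:
        fam2_def)
    have L: "lit ?n ?B j (2 * var \<tau> K 0 (cq c))" "k < K \<Longrightarrow> lit ?n ?B j (2 * var
        \<tau> k (T ?n) (ca c k))"
      "lit ?n ?B j (2 * var \<tau> (K + 1) 0 c + 1)" for k
      using c unfolding c(3) lit_tag fam2_def by auto
    show ?thesis
    proof (cases "cq c = fst (run ?z \<tau>) \<and> (\<forall>k < K. ca c k = cel ?z \<tau> k 0)")
      case True
      then have "CL ! c = (fst (run ?z \<tau>), reads ?z \<tau>)"
        using CL_bounds(2)[OF c(2)] reads_nth[where z = ?z and \<tau> = \<tau>]
        by (intro prod_eqI nth_equalityI) (auto simp: cq_def ca_def)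
      then have "fact_of ?n ?z \<tau> (K + 1) 0 c" using c by (simp add: fact_of_def)
      then show ?thesis using L(3) A1 by blast
    next
      case False
      then consider "cq c \<noteq> fst (run ?z \<tau>)" | k where "k < K" "ca c k \<noteq> cel ?z
          \<tau> k 0" by blast
      then show ?thesis
      proof cases
        case 1
        then have "\<not> fact_of ?n ?z \<tau> K 0 (cq c)" by (simp add: fact_of_def)
        then show ?thesis using L(1) A0 by blast
      next
        case (2 k)
        then have "\<not> fact_of ?n ?z \<tau> k (T ?n) (ca c k)" by (simp add: fact_of_def)
        then show ?thesis using L(2)[OF 2(1)] A0 by blast
      qed
    qed
  next
    assume "fam3 ?n j l0"
    then obtain \<tau> c where c: "\<tau> < T ?n" "c < m" "j = pr 3 (pr \<tau> c)" by (auto simp: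
        fam3_def)
    have L: "lit ?n ?B j (2 * var \<tau> (K + 1) 0 c)" "lit ?n ?B j (2 * var (Suc \<tau>) K 0 (nq
        c) + 1)"
      using c unfolding c(3) lit_tag fam3_def by auto
    show ?thesis
    proof (cases "CL ! c = (fst (run ?z \<tau>), reads ?z \<tau>)")
      case True
      then have "fact_of ?n ?z (Suc \<tau>) K 0 (nq c)" using run_Suc(1)[OF c(2) True] by (simp
          add: fact_of_def)
      then show ?thesis using L(2) A1 by blast
    next
      case False
      then have "\<not> fact_of ?n ?z \<tau> (K + 1) 0 c" by (simp add: fact_of_def)
      then show ?thesis using L(1) A0 by blast
    qed
  next
    assume "fam4 ?n j l0"
    then obtain \<tau> c k where c: "\<tau> < T ?n" "c < m" "k < K" "j = pr 4 (pr \<tau> (pr c k))"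
        by (auto simp: fam4_def)
    \<comment> \<open>The position, after the move, of the cell that was scanned before it. The
      subtraction is exact because \<open>T ?n\<close> is at least \<open>1\<close>.\<close>
    define p where "p = T ?n + up (nm c k) - dn (nm c k)"
    have p: "p + dn (nm c k) = T ?n + up (nm c k)" "p < 2 * T ?n + 2"
      using T_pos[of ?n] by (cases "nm c k"; simp add: p_def)+
    have L: "lit ?n ?B j (2 * var \<tau> (K + 1) 0 c)" "lit ?n ?B j (2 * var (Suc \<tau>) k p (nw c
        k) + 1)"
      using c p unfolding c(4) lit_tag fam4_def by auto
    show ?thesis
    proof (cases "CL ! c = (fst (run ?z \<tau>), reads ?z \<tau>)")
      case True
      have "int p - int (T ?n) + shift (nm c k) = 0" using p(1) by (simp add: shift_dn_up)
      then have "fact_of ?n ?z (Suc \<tau>) k p (nw c k)"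
        using run_Suc(2)[OF c(2) True c(3)] c(3) by (simp add: fact_of_def)
      then show ?thesis using L(2) A1 by blast
    next
      case False
      then have "\<not> fact_of ?n ?z \<tau> (K + 1) 0 c" by (simp add: fact_of_def)
      then show ?thesis using L(1) A0 by blast
    qed
  next
    assume "fam5 ?n j l0"
    then obtain \<tau> c k p a p' where c: "\<tau> < T ?n" "c < m" "k < K" "p < 2 * T ?n + 1" "a <
        symbols M"
      "p \<noteq> T ?n" "j = pr 5 (pr \<tau> (pr c (pr k (pr p a))))" "p' < 2 * T ?n + 2"
      "p' + dn (nm c k) = p + up (nm c k)" unfolding fam5_def by blast
    have L: "lit ?n ?B j (2 * var \<tau> (K + 1) 0 c)" "lit ?n ?B j (2 * var \<tau> k p a)"
      "lit ?n ?B j (2 * var (Suc \<tau>) k p' a + 1)"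
      unfolding c(7) lit_tag fam5_def using c by blast+
    show ?thesis
    proof (cases "CL ! c = (fst (run ?z \<tau>), reads ?z \<tau>)")
      case True
      have p': "int p' - int (T ?n) + shift (nm c k) = int p - int (T ?n)" using c(9) by (simp add:
          shift_dn_up)
      show ?thesis
      proof (cases "a = cel ?z \<tau> k (int p - int (T ?n))")
        case a: True
        have "fact_of ?n ?z (Suc \<tau>) k p' a"
          using run_Suc(2)[OF c(2) True c(3), of "int p' - int (T ?n)"] c(3,6) a unfolding p' by
              (simp add: fact_of_def)
        then show ?thesis using L(3) A1 by blast
      next
        case False
        then have "\<not> fact_of ?n ?z \<tau> k p a" using c(3) by (simp add: fact_of_def)
        then show ?thesis using L(2) A0 by blast
      qed
    next
      case False
      then have "\<not> fact_of ?n ?z \<tau> (K + 1) 0 c" by (simp add: fact_of_def)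
      then show ?thesis using L(1) A0 by blast
    qed
  next
    assume "fam6 ?n j l0"
    then have "j = pr 6 0" by (simp add: fam6_def)
    then have "lit ?n ?B j (2 * var 0 K 0 0 + 1)" by (simp only: lit_tag fam6_def)
    moreover have "fact_of ?n ?z 0 K 0 0" by (simp add: fact_of_def run_0)
    ultimately show ?thesis using A1 by blast
  next
    assume "fam7 ?n j l0"
    then obtain k p where k: "1 \<le> k" "k < K" "p < 2 * T ?n + 1" "j = pr 7 (pr k p)" by (auto
        simp: fam7_def)
    then have "lit ?n ?B j (2 * var 0 k p 0 + 1)" unfolding k(4) lit_tag fam7_def by auto
    moreover have "fact_of ?n ?z 0 k p 0" using k by (simp add: fact_of_def run_0)
    ultimately show ?thesis using A1 by blast
  next
    assume "fam8 ?n ?B j l0"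
    then obtain p a where p: "p < 2 * T ?n + 1" "a < 3" "fixed_cell ?n ?B p a" "j = pr 8 (pr p a)"
        by (auto simp: fam8_def)
    then have "lit ?n ?B j (2 * var 0 0 p a + 1)" unfolding p(4) lit_tag fam8_def by auto
    moreover have "fact_of ?n ?z 0 0 p a" using K cel_pair_code[OF y p(3)] by (simp add:
        fact_of_def)
    ultimately show ?thesis using A1 by blast
  next
    assume "fam9 ?n j l0"
    then obtain i where i: "i < P ?n" "j = pr 9 i" by (auto simp: fam9_def)
    define a where "a = (if i < length y then sym (y ! i) else 0)"
    have "a \<in> {..<3}" by (simp add: a_def sym_def)
    then have "lit ?n ?B j (2 * var 0 0 (T ?n + 2 * ?n + 1 + i) a + 1)"
      unfolding i(2) lit_tag fam9_def using i(1) by blast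
    moreover have "fact_of ?n ?z 0 0 (T ?n + 2 * ?n + 1 + i) a"
      unfolding fact_of_def cel_certificate using K by (simp add: a_def)
    ultimately show ?thesis using A1 by blast
  next
    assume "fam10 ?n j l0"
    then obtain i where i: "i < P ?n" "j = pr 10 i" by (auto simp: fam10_def)
    have L: "lit ?n ?B j (2 * var 0 0 (T ?n + 2 * ?n + 1 + i) 0)"
      "lit ?n ?B j (2 * var 0 0 (T ?n + 2 * ?n + 1 + Suc i) 0 + 1)"
      unfolding i(2) lit_tag fam10_def using i(1) by blast+
    show ?thesis
    proof (cases "i < length y")
      case True
      then have "\<not> fact_of ?n ?z 0 0 (T ?n + 2 * ?n + 1 + i) 0"
        unfolding fact_of_def cel_certificate using K by (simp add: sym_def)
      then show ?thesis using L(1) A0 by blast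
    next
      case False
      then have "fact_of ?n ?z 0 0 (T ?n + 2 * ?n + 1 + Suc i) 0"
        unfolding fact_of_def cel_certificate using K by simp
      then show ?thesis using L(2) A1 by blast
    qed
  next
    assume "fam11 ?n j l0"
    then obtain a where a: "a < symbols M" "a \<noteq> 2" "j = pr 11 a" by (auto simp: fam11_def)
    then have "lit ?n ?B j (2 * var (T ?n) 0 (T ?n) a)" unfolding a(3) lit_tag fam11_def by auto
    moreover have "\<not> fact_of ?n ?z (T ?n) 0 (T ?n) a" using K acc a by (simp add: fact_of_def)
    ultimately show ?thesis using A0 by blast
  qed
  then show ?thesis by blast
qed

text \<open>An assignment may also make facts true that do not hold. It suffices that it makes all
  facts of the run true: at the end the clauses of the last family then exclude every scanned symbol
  but \<open>2\<close>.\<close>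

lemma sat_imp_run:
  assumes A: "\<And>j l0. lit (length x) (bits_of x) j l0 \<Longrightarrow>
    \<exists>l. lit (length x) (bits_of x) j l \<and> A (l div 2) = odd l"
  shows "\<exists>y. length y \<le> P (length x) \<and> cel (pair_code x y) (T (length x)) 0 0 = 2"
proof -
  let ?n = "length x" and ?B = "bits_of x"
  let ?c = "\<lambda>i a. A (var 0 0 (T ?n + 2 * ?n + 1 + i) a)"
  have K: "K \<ge> 1" using wf by (simp add: wf_tm_def)
  have c9: "\<exists>a < 3. ?c i a" if i: "i < P ?n" for i
  proof -
    have "lit ?n ?B (pr 9 i) (2 * var 0 0 (T ?n + 2 * ?n + 1 + i) 0 + 1)"
      unfolding lit_tag fam9_def using i by force
    then obtain l where l: "lit ?n ?B (pr 9 i) l" "A (l div 2) = odd l" using A by blast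
    from l(1) obtain a where "a < 3" "l = 2 * var 0 0 (T ?n + 2 * ?n + 1 + i) a + 1"
      unfolding lit_tag fam9_def by auto
    then show ?thesis using l(2) by auto
  qed
  have c10: "?c (Suc i) 0" if i: "i < P ?n" "?c i 0" for i
  proof -
    have "lit ?n ?B (pr 10 i) (2 * var 0 0 (T ?n + 2 * ?n + 1 + i) 0)"
      unfolding lit_tag fam10_def using i by force
    then obtain l where l: "lit ?n ?B (pr 10 i) l" "A (l div 2) = odd l" using A by blast
    from l(1) have "l = 2 * var 0 0 (T ?n + 2 * ?n + 1 + i) 0 \<or> l = 2 * var 0 0 (T ?n + 2 * ?n
        + 1 + Suc i) 0 + 1"
      unfolding lit_tag fam10_def by auto
    then show ?thesis using l(2) i(2) by auto
  qed
  have c8: "A (var 0 0 p a)" if p: "p < 2 * T ?n + 1" "fixed_cell ?n ?B p a" for p a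
  proof -
    have "a < 3" using p(2) by (auto simp: fixed_cell_def)
    then have "lit ?n ?B (pr 8 (pr p a)) (2 * var 0 0 p a + 1)"
      unfolding lit_tag fam8_def using p by force
    then obtain l where l: "lit ?n ?B (pr 8 (pr p a)) l" "A (l div 2) = odd l" using A by blast
    from l(1) have "l = 2 * var 0 0 p a + 1" unfolding lit_tag fam8_def by auto
    then show ?thesis using l(2) by auto
  qed
  \<comment> \<open>The certificate ends at the first cell at which a blank is true. Several symbols
    may be true of one cell; \<open>y\<close> takes \<open>True\<close> where \<open>2\<close> is
    among them, and otherwise \<open>1\<close> must be true, as no blank is true before
    \<open>len\<close>.\<close>
  define len where "len = (LEAST i. i = P ?n \<or> ?c i 0)"
  have len_le: "len \<le> P ?n" unfolding len_def by (rule Least_le) simp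
  have len0: "len = P ?n \<or> ?c len 0"
    unfolding len_def by (rule LeastI[where P = "\<lambda>i. i = P ?n \<or> ?c i 0" and k = "P
        ?n"]) simp
  have before: "\<not> ?c i 0" if "i < len" for i
    using not_less_Least[of i "\<lambda>i. i = P ?n \<or> ?c i 0"] that unfolding len_def by blast
  have after: "?c i 0" if "len \<le> i" "i < P ?n" for i
    using that
  proof (induction i rule: dec_induct)
    case base
    then show ?case using len0 by auto
  next
    case (step i)
    then show ?case using c10[of i] by simp
  qed
  define y where "y = map (\<lambda>i. ?c i 2) [0..<len]"
  have ly: "length y = len" by (simp add: y_def)
  let ?z = "pair_code x y"
  have tape0: "A (var 0 0 p (cel ?z 0 0 (int p - int (T ?n))))" if p: "p < 2 * T ?n + 1" for p
  proof (cases "\<exists>a. fixed_cell ?n ?B p a")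
    case True
    then obtain a where a: "fixed_cell ?n ?B p a" by blast
    then show ?thesis using c8[OF p a] cel_pair_code[OF _ a, of y] ly len_le by simp
  next
    case False
    have "\<exists>i < P ?n. p = T ?n + 2 * ?n + 1 + i"
    proof (rule ccontr)
      assume no: "\<not> ?thesis"
      have "\<not> p < T ?n" using False by (auto simp: fixed_cell_def)
      then obtain d where d: "p = T ?n + d" by (metis le_add_diff_inverse not_less)
      have "d \<noteq> 2 * ?n" using False d by (auto simp: fixed_cell_def)
      moreover have "\<not> d < 2 * ?n"
      proof
        assume "d < 2 * ?n"
        then obtain i where i: "i < ?n" "d = 2 * i \<or> d = 2 * i + 1"
          by (metis less_mult_imp_div_less mult.commute mult_div_mod_eq not_mod_2_eq_1_eq_0
              add_0_right)
        from i(2) show False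
        proof
          assume "d = 2 * i"
          then have "fixed_cell ?n ?B p 2" using i d unfolding fixed_cell_def by blast
          then show False using False by blast
        next
          assume "d = 2 * i + 1"
          then have "p = T ?n + 2 * i + 1" using d by simp
          then have "fixed_cell ?n ?B p (if ?B i then 2 else 1)" using i unfolding fixed_cell_def
              by auto
          then show False using False by blast
        qed
      qed
      ultimately obtain i where "d = 2 * ?n + 1 + i" by (metis Suc_eq_plus1 less_iff_Suc_add
          linorder_neqE_nat add_Suc add_Suc_right)
      then have "p = T ?n + 2 * ?n + 1 + i" using d by simp
      moreover from this have "P ?n \<le> i" using no by (metis not_less)
      ultimately have "fixed_cell ?n ?B p 0" unfolding fixed_cell_def by simp
      then show False using False by blast
    qed
    then obtain i where i: "i < P ?n" "p = T ?n + 2 * ?n + 1 + i" by blast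
    show ?thesis
    proof (cases "i < len")
      case True
      then have "cel ?z 0 0 (int p - int (T ?n)) = sym (?c i 2)"
        unfolding i(2) cel_certificate by (simp add: ly y_def)
      moreover have "?c i (sym (?c i 2))"
      proof (cases "?c i 2")
        case t: True
        have "sym (?c i 2) = 2" using t by (simp add: sym_def)
        then show ?thesis using t by (simp only:)
      next
        case f: False
        obtain a where a: "a < 3" "?c i a" using c9[OF i(1)] by blast
        have "a \<noteq> 0" using a(2) before[OF True] by metis
        moreover have "a \<noteq> 2" using a(2) f by metis
        ultimately have "a = 1" using a(1) by simp
        moreover have "sym (?c i 2) = 1" using f by (simp add: sym_def)
        ultimately show ?thesis using a(2) by (simp only:)
      qed
      ultimately show ?thesis using i(2) by simp
    next
      case False
      then have "cel ?z 0 0 (int p - int (T ?n)) = 0"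
        unfolding i(2) cel_certificate by (simp add: ly)
      moreover have "?c i 0" using after[of i] False i(1) by simp
      ultimately show ?thesis using i(2) by simp
    qed
  qed
  \<comment> \<open>Each step loses one position at either end of the known window, as the tape is
    shifted by at most one. Starting from \<open>2 * T ?n + 1\<close> positions, the scanned cell is
    still known after \<open>T ?n\<close> steps.\<close>
  have inv: "A (var \<tau> K 0 (fst (run ?z \<tau>))) \<and>
      (\<forall>k < K. \<forall>p. \<tau> \<le> p \<longrightarrow> p + \<tau> \<le> 2 * T ?n
          \<longrightarrow> A (var \<tau> k p (cel ?z \<tau> k (int p - int (T ?n)))))"
    if "\<tau> \<le> T ?n" for \<tau>
    using that
  proof (induction \<tau>)
    case 0
    have "lit ?n ?B (pr 6 0) (2 * var 0 K 0 0 + 1)" unfolding lit_tag fam6_def by blast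
    then obtain l where l: "lit ?n ?B (pr 6 0) l" "A (l div 2) = odd l" using A by blast
    from l(1) have "l = 2 * var 0 K 0 0 + 1" unfolding lit_tag fam6_def by auto
    then have S: "A (var 0 K 0 (fst (run ?z 0)))" using l(2) by (simp add: run_0)
    have "A (var 0 k p (cel ?z 0 k (int p - int (T ?n))))" if k: "k < K" "p \<le> 2 * T ?n" for k p
    proof (cases "k = 0")
      case True
      then show ?thesis using tape0[of p] k by simp
    next
      case False
      then have k1: "1 \<le> k" by simp
      have "lit ?n ?B (pr 7 (pr k p)) (2 * var 0 k p 0 + 1)"
        unfolding lit_tag fam7_def using k k1 by force
      then obtain l where l: "lit ?n ?B (pr 7 (pr k p)) l" "A (l div 2) = odd l" using A by blast
      from l(1) have "l = 2 * var 0 k p 0 + 1" unfolding lit_tag fam7_def by auto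
      then show ?thesis using l(2) k k1 by (simp add: run_0)
    qed
    then show ?case using S by simp
  next
    case (Suc \<tau>)
    then have \<tau>: "\<tau> < T ?n" by simp
    from Suc have IS: "A (var \<tau> K 0 (fst (run ?z \<tau>)))"
      and IC: "\<And>k p. k < K \<Longrightarrow> \<tau> \<le> p \<Longrightarrow> p + \<tau> \<le>
          2 * T ?n \<Longrightarrow> A (var \<tau> k p (cel ?z \<tau> k (int p - int (T ?n))))"
      by auto
    obtain c where c: "c < m" "CL ! c = (fst (run ?z \<tau>), reads ?z \<tau>)" using comb_ex by
        blast
    have cq: "cq c = fst (run ?z \<tau>)" "k < K \<Longrightarrow> ca c k = cel ?z \<tau> k 0" for k
      using c(2) reads_nth(2)[of k ?z \<tau>] by (auto simp: cq_def ca_def)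
    have Tr: "A (var \<tau> (K + 1) 0 c)"
    proof -
      have "lit ?n ?B (pr 2 (pr \<tau> c)) (2 * var \<tau> (K + 1) 0 c + 1)"
        unfolding lit_tag fam2_def using \<tau> c(1) by force
      then obtain l where l: "lit ?n ?B (pr 2 (pr \<tau> c)) l" "A (l div 2) = odd l" using A by
          blast
      from l(1) consider "l = 2 * var \<tau> K 0 (cq c)" | k where "k < K" "l = 2 * var \<tau> k (T
          ?n) (ca c k)"
        | "l = 2 * var \<tau> (K + 1) 0 c + 1" unfolding lit_tag fam2_def by auto
      then show ?thesis
      proof cases
        case 1
        then show ?thesis using l(2) IS cq(1) by simp
      next
        case (2 k)
        then show ?thesis using l(2) IC[of k "T ?n"] \<tau> cq(2)[of k] by simp
      next
        case 3
        then show ?thesis using l(2) by simp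
      qed
    qed
    have "lit ?n ?B (pr 3 (pr \<tau> c)) (2 * var \<tau> (K + 1) 0 c)"
      unfolding lit_tag fam3_def using \<tau> c(1) by force
    then obtain l where l: "lit ?n ?B (pr 3 (pr \<tau> c)) l" "A (l div 2) = odd l" using A by blast
    from l(1) have "l = 2 * var \<tau> (K + 1) 0 c \<or> l = 2 * var (Suc \<tau>) K 0 (nq c) + 1"
      unfolding lit_tag fam3_def by auto
    then have S: "A (var (Suc \<tau>) K 0 (fst (run ?z (Suc \<tau>))))"
      using l(2) Tr run_Suc(1)[OF c] by auto
    have "A (var (Suc \<tau>) k p' (cel ?z (Suc \<tau>) k (int p' - int (T ?n))))"
      if k: "k < K" "Suc \<tau> \<le> p'" "p' + Suc \<tau> \<le> 2 * T ?n" for k p'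
    proof -
      define p where "p = p' + dn (nm c k) - up (nm c k)"
      have p: "p' + dn (nm c k) = p + up (nm c k)" "\<tau> \<le> p" "p + \<tau> \<le> 2 * T ?n"
        using k by (cases "nm c k"; simp add: p_def)+
      have d: "int p' - int (T ?n) + shift (nm c k) = int p - int (T ?n)" using p(1) by (simp add:
          shift_dn_up)
      show ?thesis
      proof (cases "p = T ?n")
        case True
        have "lit ?n ?B (pr 4 (pr \<tau> (pr c k))) (2 * var \<tau> (K + 1) 0 c)"
          unfolding lit_tag fam4_def using \<tau> c(1) k(1) by force
        then obtain l where l: "lit ?n ?B (pr 4 (pr \<tau> (pr c k))) l" "A (l div 2) = odd l"
            using A by blast
        from l(1) have "l = 2 * var \<tau> (K + 1) 0 c \<or> l = 2 * var (Suc \<tau>) k p' (nw c k)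
            + 1"
          unfolding lit_tag fam4_def using p(1) True by auto
        then have "A (var (Suc \<tau>) k p' (nw c k))" using l(2) Tr by auto
        then show ?thesis using run_Suc(2)[OF c k(1), of "int p' - int (T ?n)"] d True by simp
      next
        case False
        let ?a = "cel ?z \<tau> k (int p - int (T ?n))"
        have a: "?a < symbols M" by (rule run_bounds(2)[OF k(1)])
        have "p < 2 * T ?n + 1" "p' < 2 * T ?n + 2" using p(3) k(3) by auto
        then have "lit ?n ?B (pr 5 (pr \<tau> (pr c (pr k (pr p ?a))))) (2 * var \<tau> (K + 1) 0
            c)"
          unfolding lit_tag fam5_def using \<tau> c(1) k(1) a False p(1) by force
        then obtain l where l: "lit ?n ?B (pr 5 (pr \<tau> (pr c (pr k (pr p ?a))))) l" "A (l div
            2) = odd l"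
          using A by blast
        from l(1) have "l = 2 * var \<tau> (K + 1) 0 c \<or> l = 2 * var \<tau> k p ?a \<or> l = 2
            * var (Suc \<tau>) k p' ?a + 1"
          unfolding lit_tag fam5_def using p(1) by auto
        then have "A (var (Suc \<tau>) k p' ?a)" using l(2) Tr IC[OF k(1) p(2,3)] by auto
        moreover have "int p - int (T ?n) \<noteq> 0" using False by simp
        ultimately show ?thesis using run_Suc(2)[OF c k(1), of "int p' - int (T ?n)"] d by simp
      qed
    qed
    then show ?case using S by simp
  qed
  have final: "A (var (T ?n) 0 (T ?n) (cel ?z (T ?n) 0 0))"
    using inv[of "T ?n"] K by (auto dest!: spec[of _ "0 :: nat"] spec[of _ "T ?n"])
  have "cel ?z (T ?n) 0 0 = 2"
  proof (rule ccontr)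
    let ?a = "cel ?z (T ?n) 0 0"
    assume ne: "?a \<noteq> 2"
    have "?a < symbols M" using run_bounds(2)[of 0] K by simp
    then have "lit ?n ?B (pr 11 ?a) (2 * var (T ?n) 0 (T ?n) ?a)"
      unfolding lit_tag fam11_def using ne by force
    then obtain l where l: "lit ?n ?B (pr 11 ?a) l" "A (l div 2) = odd l" using A by blast
    from l(1) have "l = 2 * var (T ?n) 0 (T ?n) ?a" unfolding lit_tag fam11_def by auto
    then show False using l(2) final by simp
  qed
  then show ?thesis using ly len_le by blast
qed

lemma tableau_reduction:
  assumes L: "\<And>x. x \<in> L \<longleftrightarrow> (\<exists>y. length y \<le> P (length x)
      \<and> cel (pair_code x y) (T (length x)) 0 0 = 2)"
  shows "poly_time_reducible L
    (enc_instance ` {I \<in> int_min_max_delay. max_number I \<le> length (enc_instance I)})"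
\<comment> \<open>A number that codes no clause would be an empty and hence unsatisfiable clause.
  Such a number receives all literals instead, which makes it a tautology.\<close>
proof (rule sat_reduction[where N = nvars and C = nclauses and
      Lit = "\<lambda>n B j l. lit n B j l \<or> \<not> (\<exists>l' < 2 * nvars n. lit n B j l')"])
  show "fdef (\<lambda>n B e. lit n B (e 0) (e 1) \<or> \<not> (\<exists>l' < 2 * nvars n. lit n B
      (e 0) l'))"
    by (intro def_intros tdef_sizes fdef_sub2[OF fdef_lit])
  show "0 < nvars n" for n by (simp add: nvars_def)
  fix x :: "bool list"
  let ?n = "length x"
  let ?lit = "lit ?n (bits_of x)"
  let ?S = "\<lambda>A. \<forall>j. (\<exists>l. ?lit j l) \<longrightarrow> (\<exists>l. ?lit j l
      \<and> A (l div 2) = odd l)"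
  have eq: "(\<forall>j < nclauses ?n. \<exists>l < 2 * nvars ?n. (?lit j l \<or> \<not>
      (\<exists>l' < 2 * nvars ?n. ?lit j l')) \<and> A (l div 2) = odd l)
      \<longleftrightarrow> ?S A" for A
  proof
    assume *: "\<forall>j < nclauses ?n. \<exists>l < 2 * nvars ?n. (?lit j l \<or> \<not>
        (\<exists>l' < 2 * nvars ?n. ?lit j l')) \<and> A (l div 2) = odd l"
    show "?S A"
    proof (intro allI impI)
      fix j assume "\<exists>l. ?lit j l"
      then obtain l where "?lit j l" by blast
      then show "\<exists>l. ?lit j l \<and> A (l div 2) = odd l" using * lit_bound[of ?n "bits_of
          x" j l] by blast
    qed
  next
    assume *: "?S A"
    show "\<forall>j < nclauses ?n. \<exists>l < 2 * nvars ?n. (?lit j l \<or> \<not> (\<exists>l'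
        < 2 * nvars ?n. ?lit j l')) \<and> A (l div 2) = odd l"
    proof (intro allI impI)
      fix j
      show "\<exists>l < 2 * nvars ?n. (?lit j l \<or> \<not> (\<exists>l' < 2 * nvars ?n. ?lit j
          l')) \<and> A (l div 2) = odd l"
      proof (cases "\<exists>l. ?lit j l")
        case True
        then obtain l where l: "?lit j l" "A (l div 2) = odd l" using * by blast
        then show ?thesis using lit_bound[OF l(1)] by blast
      next
        case False
        then show ?thesis
          \<comment> \<open>The true one among the two literals of variable
            \<open>0\<close>.\<close>
          by (intro exI[of _ "if A 0 then 1 else 0"]) (auto simp: nvars_def)
      qed
    qed
  qed
  have "x \<in> L \<longleftrightarrow> (\<exists>A. ?S A)"
  proof
    assume "x \<in> L"
    then obtain y where "length y \<le> P ?n" "cel (pair_code x y) (T ?n) 0 0 = 2" unfolding L by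
        blast
    then show "\<exists>A. ?S A" by (rule run_imp_sat)
  next
    assume "\<exists>A. ?S A"
    then obtain A where A: "?S A" ..
    have "\<exists>l. ?lit j l \<and> A (l div 2) = odd l" if "?lit j l0" for j l0 using A that by
        blast
    then show "x \<in> L" unfolding L by (rule sat_imp_run)
  qed
  then show "x \<in> L \<longleftrightarrow> (\<exists>A. \<forall>j < nclauses ?n. \<exists>l < 2
      * nvars ?n.
      (?lit j l \<or> \<not> (\<exists>l' < 2 * nvars ?n. ?lit j l')) \<and> A (l div 2) = odd l)"
    by (simp only: eq)
qed (rule tdef_sizes)+

end

theorem NP_hard_restricted:
  "NP_hard (enc_instance ` {I \<in> int_min_max_delay. max_number I \<le> length (enc_instance I)})"
  unfolding NP_hard_def
proof
  fix L assume "L \<in> class_NP"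
  then obtain V p where V: "V \<in> class_P"
    and L: "\<And>x. x \<in> L \<longleftrightarrow> (\<exists>y. length y \<le> poly p (length x)
        \<and> pair_code x y \<in> V)"
    unfolding class_NP_def by blast
  then obtain M q where M: "wf_tm M" "\<And>z. computes_within M z [z \<in> V] (poly q (length z))"
    unfolding class_P_def poly_time_computable_def by blast
  define P where "P n = poly p n" for n
  \<comment> \<open>The argument of \<open>q\<close> is the length of the code of \<open>x\<close>
    with the longest admissible certificate; the successor ensures that the time is
    positive.\<close>
  define T where "T n = Suc (poly q (2 * n + 1 + poly p n))" for n
  have "finite {(q, as). q < states M \<and> length as = tapes M \<and> set as \<subseteq>
      {..<symbols M}}"
  proof -
    have "finite ({..<states M} \<times> {as. set as \<subseteq> {..<symbols M} \<and> length as =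
        tapes M})"
      by (intro finite_cartesian_product finite_lists_length_eq) auto
    then show ?thesis by (rule rev_finite_subset) auto
  qed
  from finite_list[OF this] obtain CL
    where CL: "set CL = {(q, as). q < states M \<and> length as = tapes M \<and> set as \<subseteq>
        {..<symbols M}}" ..
  interpret tableau M T P CL
  proof
    show "tdef (\<lambda>n e. T n)" "tdef (\<lambda>n e. P n)"
      unfolding T_def P_def by (intro def_intros tdef_poly)+
  qed (use M CL in \<open>auto simp: T_def\<close>)
  have "pair_code x y \<in> V \<longleftrightarrow> cel (pair_code x y) (T (length x)) 0 0 = 2" if
      "length y \<le> P (length x)" for x y
  proof -
    let ?z = "pair_code x y"
    obtain k where k: "k \<le> poly q (length ?z)" "halted M ((step M ^^ k) (init M ?z))"
      "tape_holds (hd (snd ((step M ^^ k) (init M ?z)))) [?z \<in> V]"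
      using M(2)[of ?z] unfolding computes_within_def by blast
    have "length ?z \<le> 2 * length x + 1 + poly p (length x)"
      using that by (simp add: pair_code_def length_self_delim P_def)
    then have "k \<le> T (length x)" using k(1) poly_mono_nat[of "length ?z" _ q] by (force simp:
        T_def)
    then have "run ?z (T (length x)) = (step M ^^ k) (init M ?z)"
      using funpow_halted[OF k(2), of "T (length x) - k"]
      by (simp add: run_def funpow_add[symmetric, unfolded comp_def fun_eq_iff, rule_format])
    moreover have "hd (snd (run ?z (T (length x)))) = snd (run ?z (T (length x))) ! 0"
      using run_bounds(3)[of ?z "T (length x)"] wf by (intro hd_conv_nth) (auto simp: wf_tm_def)
    ultimately have "tape_holds (snd (run ?z (T (length x))) ! 0) [?z \<in> V]" using k(3) by simp
    then have "cel ?z (T (length x)) 0 0 = sym (?z \<in> V)"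
      unfolding cel_def by (cases "snd (run ?z (T (length x))) ! 0") (auto simp: cell_at_def)
    then show ?thesis by (simp add: sym_def)
  qed
  then show "poly_time_reducible L
      (enc_instance ` {I \<in> int_min_max_delay. max_number I \<le> length (enc_instance I)})"
    by (intro tableau_reduction) (use L P_def in auto)
qed

section \<open>Sparse flows and binary sums\<close>

text \<open>With \<open>s = d * (d + 5)\<close> and \<open>d > 0\<close> it yields
  \<open>(s + 1) ^ d < 2 ^ s\<close>, the numerical condition of the following pigeonhole
  argument.\<close>

lemma subset_count_bound: "d * (d + 5) + 1 < 2 ^ (d + 5 :: nat)"
proof (induction d)
  case (Suc d)
  have "2 ^ (Suc d + 5) = 2 * (2 :: nat) ^ (d + 5)" by (simp only: add_Suc power_Suc)
  moreover have "Suc d * (Suc d + 5) + 1 = (d * (d + 5) + 1) + 2 * d + 6" by (simp add: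
      algebra_simps)
  moreover have "d = 0 \<or> 2 * d + 4 < d * (d + 5) + 1"
  proof (cases d)
    case (Suc k)
    then show ?thesis by (simp add: algebra_simps)
  qed simp
  ultimately show ?case using Suc.IH by (cases "d = 0") auto
qed simp

text \<open>There are \<open>2 ^ card U\<close> subsets but fewer incidence vectors, so two
  different subsets have the same vector. Their common part contributes equally and is
  removed.\<close>

lemma equal_weight_subsets:
  fixes w :: "'j \<Rightarrow> 'a \<Rightarrow> bool"
  assumes "finite U" "finite J" "j0 \<in> J" "\<And>p. w j0 p" "card U = card J * (card J + 5)"
  shows "\<exists>A B. A \<subseteq> U \<and> B \<subseteq> U \<and> A \<inter> B = {} \<and> A
      \<noteq> {} \<and>
    (\<forall>j \<in> J. card {p \<in> A. w j p} = card {p \<in> B. w j p})"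
proof -
  let ?d = "card J" and ?s = "card U"
  define \<phi> where "\<phi> A = restrict (\<lambda>j. card {p \<in> A. w j p}) J" for A
  have "\<phi> ` Pow U \<subseteq> J \<rightarrow>\<^sub>E {..?s}"
    using assms(1) by (auto simp: \<phi>_def intro!: card_mono)
  moreover have "card (J \<rightarrow>\<^sub>E {..?s}) = Suc ?s ^ ?d" using assms(2) by (simp add:
      card_PiE)
  moreover have "Suc ?s ^ ?d < 2 ^ ?s"
  proof -
    have "?d > 0" using assms(2,3) by (auto simp: card_gt_0_iff)
    moreover have "Suc ?s < 2 ^ (?d + 5)" using subset_count_bound[of ?d] assms(5) by simp
    ultimately have "Suc ?s ^ ?d < (2 ^ (?d + 5)) ^ ?d" by (intro power_strict_mono) auto
    also have "\<dots> = 2 ^ ?s" by (simp add: assms(5) power_mult[symmetric] mult.commute)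
    finally show ?thesis .
  qed
  moreover have "finite (J \<rightarrow>\<^sub>E {..?s})" using assms(2) by (intro finite_PiE) auto
  ultimately have "\<not> inj_on \<phi> (Pow U)"
    using card_inj_on_le[of \<phi> "Pow U" "J \<rightarrow>\<^sub>E {..?s}"] assms(1) by (auto
        simp: card_Pow)
  then obtain A B where AB: "A \<subseteq> U" "B \<subseteq> U" "A \<noteq> B" "\<phi> A = \<phi>
      B" by (auto simp: inj_on_def)
  have fin: "finite A" "finite B" using AB assms(1) finite_subset by auto
  have eq: "card {p \<in> A - B. w j p} = card {p \<in> B - A. w j p}" if "j \<in> J" for j
  proof -
    have "card {p \<in> A. w j p} = card {p \<in> B. w j p}" using fun_cong[OF AB(4), of j] that by
        (simp add: \<phi>_def)
    moreover have "card {p \<in> A. w j p} = card {p \<in> A - B. w j p} + card {p \<in> A \<inter>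
        B. w j p}"
      using fin by (subst card_Un_disjoint[symmetric]) (auto intro!: arg_cong[where f = card])
    moreover have "card {p \<in> B. w j p} = card {p \<in> B - A. w j p} + card {p \<in> A \<inter>
        B. w j p}"
      using fin by (subst card_Un_disjoint[symmetric]) (auto intro!: arg_cong[where f = card])
    ultimately show ?thesis by simp
  qed
  \<comment> \<open>The index \<open>j0\<close> counts all elements, so the two differences have
    equal size and could only be empty together.\<close>
  have "A - B \<noteq> {}"
  proof
    assume e: "A - B = {}"
    have "card (A - B) = card (B - A)" using eq[OF assms(3)] assms(4) by (simp add: set_diff_eq)
    then have "card (B - A) = 0" using e by simp
    then have "B - A = {}" using fin by simp
    then show False using e AB(3) by blast
  qed
  then show ?thesis using AB eq by (intro exI[of _ "A - B"] exI[of _ "B - A"]) auto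
qed

text \<open>
  Eisenbrand and Shmonin: shifting weight between two disjoint sets of equal incidence
  vector shrinks the support of an integral conic combination.
\<close>

lemma small_support:
  fixes w :: "'j \<Rightarrow> 'a \<Rightarrow> bool" and g :: "'a \<Rightarrow> nat"
  assumes "finite Q" "finite J" "j0 \<in> J" "\<And>p. w j0 p"
  shows "\<exists>g'. (\<forall>j \<in> J. (\<Sum>p | p \<in> Q \<and> w j p. g' p) = (\<Sum>p | p
      \<in> Q \<and> w j p. g p)) \<and>
    (\<forall>p. g' p > 0 \<longrightarrow> g p > 0) \<and> card {p \<in> Q. g' p > 0} < card J *
        (card J + 5)"
proof (induction "card {p \<in> Q. g p > 0}" arbitrary: g rule: less_induct)
  case less
  let ?s = "card J * (card J + 5)" and ?S = "{p \<in> Q. g p > 0}"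
  show ?case
  proof (cases "card ?S < ?s")
    case True
    then show ?thesis by blast
  next
    case False
    then obtain U where U: "U \<subseteq> ?S" "card U = ?s" by (meson not_less
        obtain_subset_with_card_n)
    have fU: "finite U" using U(1) assms(1) finite_subset by fastforce
    obtain A B where AB: "A \<subseteq> U" "B \<subseteq> U" "A \<inter> B = {}" "A \<noteq> {}"
      "\<forall>j \<in> J. card {p \<in> A. w j p} = card {p \<in> B. w j p}"
      using equal_weight_subsets[where w = w and ?j0.0 = j0, OF fU assms(2,3,4) U(2)] by blast
    have fin: "finite A" "finite B" using finite_subset[OF AB(1) fU] finite_subset[OF AB(2) fU] .
    \<comment> \<open>Subtracting the minimum keeps all weights on \<open>A\<close> natural and
      brings one of them to \<open>0\<close>. As \<open>B\<close> lies in the support, the support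
      loses an element and gains none.\<close>
    define \<mu> where "\<mu> = Min (g ` A)"
    have \<mu>: "\<And>p. p \<in> A \<Longrightarrow> \<mu> \<le> g p" "\<mu> \<in> g ` A"
        unfolding \<mu>_def using fin AB(4) by auto
    define g' where "g' p = (if p \<in> A then g p - \<mu> else if p \<in> B then g p + \<mu> else
        g p)" for p
    have pt: "g' p + \<mu> * of_bool (p \<in> A) = g p + \<mu> * of_bool (p \<in> B)" for p
      using \<mu>(1)[of p] AB(3) by (auto simp: g'_def)
    have sums: "(\<Sum>p | p \<in> Q \<and> w j p. g' p) = (\<Sum>p | p \<in> Q \<and> w j p. g p)"
        if j: "j \<in> J" for j
    proof -
      let ?Q = "{p. p \<in> Q \<and> w j p}"
      have cnt: "(\<Sum>p\<in>?Q. \<mu> * of_bool (p \<in> Z)) = \<mu> * card {p \<in> Z. w j p}"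
          if "Z \<subseteq> U" for Z
      proof -
        have "?Q \<inter> {p. p \<in> Z} = {p \<in> Z. w j p}" using that U(1) by auto
        then show ?thesis using assms(1) by (simp add: sum_distrib_left[symmetric]
            sum.inter_filter[symmetric] of_bool_def Int_def)
      qed
      have "(\<Sum>p\<in>?Q. g' p) + \<mu> * card {p \<in> A. w j p} = (\<Sum>p\<in>?Q. g' p +
          \<mu> * of_bool (p \<in> A))"
        using cnt[OF AB(1)] by (simp add: sum.distrib)
      also have "\<dots> = (\<Sum>p\<in>?Q. g p) + \<mu> * card {p \<in> B. w j p}"
        using cnt[OF AB(2)] by (simp add: pt sum.distrib)
      finally show ?thesis using AB(5) j by simp
    qed
    have supp: "g p > 0" if "g' p > 0" for p
    proof (cases "p \<in> U")
      case True
      then show ?thesis using U(1) by auto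
    next
      case False
      then have "g' p = g p" using AB(1,2) by (auto simp: g'_def)
      then show ?thesis using that by simp
    qed
    obtain a where a: "a \<in> A" "g a = \<mu>" using \<mu>(2) by auto
    then have "a \<in> ?S" "g' a = 0" using AB(1) U(1) by (auto simp: g'_def)
    then have "a \<in> ?S" "a \<notin> {p \<in> Q. g' p > 0}" by auto
    moreover have "{p \<in> Q. g' p > 0} \<subseteq> ?S" using supp by blast
    ultimately have "{p \<in> Q. g' p > 0} \<subset> ?S" by blast
    then have "card {p \<in> Q. g' p > 0} < card ?S" using assms(1) by (intro psubset_card_mono)
        auto
    from less[OF this] obtain g'' where
      "\<forall>j \<in> J. (\<Sum>p | p \<in> Q \<and> w j p. g'' p) = (\<Sum>p | p \<in> Q \<and>
          w j p. g' p)"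
      "\<forall>p. g'' p > 0 \<longrightarrow> g' p > 0" "card {p \<in> Q. g'' p > 0} < ?s" by blast
    then show ?thesis using sums supp by (intro exI[of _ g'']) auto
  qed
qed

text \<open>The quantities to be preserved are the total rate, indexed by \<open>None\<close>, and
  the rate of every edge \<open>e\<close>, indexed by \<open>Some e\<close>. So there are at most
  \<open>a + 1\<close> of them, and \<open>S\<close> is the corresponding bound on the
  support.\<close>

lemma flow_family:
  assumes v: "valid_instance I" and f: "feasible_flow I f" "int (max_delay I f) \<le> bound I"
    and S: "card (arcs (graph I)) \<le> a" "S = (a + 1) * (a + 6)"
  shows "\<exists>Q g. (\<forall>k < S. Q k \<in> st_paths I \<and> int (path_delay I (Q k)) \<le>
      bound I) \<and>
    (\<Sum>k<S. g k) = rate I \<and> (\<forall>e \<in> arcs (graph I). (\<Sum>k | k < S \<and> e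
        \<in> set (Q k). g k) \<le> cap I e)"
proof -
  let ?P = "st_paths I" and ?E = "arcs (graph I)"
  have fs: "finite ?P" by (rule finite_st_paths[OF v])
  have fE: "finite ?E" by (simp add: graph_def)
  let ?J = "insert None (Some ` ?E)" and ?w = "\<lambda>j p. case j of None \<Rightarrow> True |
      Some e \<Rightarrow> e \<in> set p"
  have cJ: "card ?J = card ?E + 1" using fE by (simp add: card_image)
  obtain h where h: "\<forall>j \<in> ?J. (\<Sum>p | p \<in> ?P \<and> ?w j p. h p) = (\<Sum>p | p
      \<in> ?P \<and> ?w j p. f p)"
    "\<forall>p. h p > 0 \<longrightarrow> f p > 0" "card {p \<in> ?P. h p > 0} < card ?J * (card
        ?J + 5)"
    using small_support[OF fs, of ?J None ?w f] fE by auto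
  have tot: "(\<Sum>p\<in>?P. h p) = rate I"
    using bspec[OF h(1), of None] f(1) by (simp add: feasible_flow_def)
  have edge: "(\<Sum>p | p \<in> ?P \<and> e \<in> set p. h p) \<le> cap I e" if "e \<in> ?E" for e
    using bspec[OF h(1), of "Some e"] that f(1) by (simp add: feasible_flow_def edge_rate_def)
  let ?H = "{p \<in> ?P. h p > 0}"
  have "card ?J * (card ?J + 5) \<le> S" unfolding S(2) using cJ S(1) by (intro mult_mono) auto
  then have cH: "card ?H \<le> S" using h(3) by simp
  obtain ps where ps: "set ps = ?H" "distinct ps" using finite_distinct_list[of ?H] fs by auto
  have len: "length ps \<le> S" using cH distinct_card[OF ps(2)] ps(1) by simp
  have "?H \<noteq> {}"
  proof
    assume "?H = {}"
    then have "(\<Sum>p\<in>?P. h p) = 0" by (intro sum.neutral) auto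
    then show False using tot v by (simp add: valid_instance_def)
  qed
  then have ne: "ps \<noteq> []" using ps(1) by auto
  \<comment> \<open>The family is padded to the fixed size \<open>S\<close> by copies of the first
    path at rate \<open>0\<close>, so that every index carries a path within the delay
    bound.\<close>
  define Q where "Q k = (if k < length ps then ps ! k else ps ! 0)" for k
  define g where "g k = (if k < length ps then h (ps ! k) else 0)" for k
  have QH: "Q k \<in> ?H" for k
    using ps(1) ne nth_mem[of k ps] nth_mem[of 0 ps] by (auto simp: Q_def simp del: nth_mem)
  have sum: "(\<Sum>k | k < S \<and> R (Q k). g k) = (\<Sum>p | p \<in> ?P \<and> R p. h p)" for R
  proof -
    have "(\<Sum>k | k < S \<and> R (Q k). g k) = (\<Sum>k \<in> {k \<in> {..<length ps}. R (ps !
        k)}. h (ps ! k))"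
      using len by (intro sum.mono_neutral_cong_right) (auto simp: Q_def g_def)
    also have "\<dots> = (\<Sum>p \<in> {p \<in> ?H. R p}. h p)"
      using bij_betw_nth[OF ps(2) refl ps(1)[symmetric]]
      by (intro sum.reindex_bij_betw) (auto simp: bij_betw_def inj_on_def)
    also have "\<dots> = (\<Sum>p | p \<in> ?P \<and> R p. h p)"
      using fs by (intro sum.mono_neutral_left) auto
    finally show ?thesis .
  qed
  have "int (path_delay I (Q k)) \<le> bound I" for k
  proof -
    have "Q k \<in> ?P" "f (Q k) > 0" using QH[of k] h(2) by auto
    then have "path_delay I (Q k) \<le> max_delay I f"
      unfolding max_delay_def using fs by (intro Max_ge) auto
    then show ?thesis using f(2) by linarith
  qed
  moreover have "(\<Sum>k<S. g k) = rate I" using sum[of "\<lambda>_. True"] tot by (simp add: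
      lessThan_def)
  moreover have "(\<Sum>k | k < S \<and> e \<in> set (Q k). g k) \<le> cap I e" if "e \<in> ?E" for
      e
    using sum[of "\<lambda>p. e \<in> set p"] edge[OF that] by simp
  ultimately show ?thesis using QH by blast
qed

section \<open>Binary sums\<close>

definition val :: "nat \<Rightarrow> (nat \<Rightarrow> bool) \<Rightarrow> nat" where
  "val n b = (\<Sum>i<n. of_bool (b i) * 2 ^ i)"

definition bitn :: "nat \<Rightarrow> nat \<Rightarrow> bool" where
  "bitn N i \<longleftrightarrow> odd (N div 2 ^ i)"

lemma val_Suc: "val (Suc n) b = val n b + of_bool (b n) * 2 ^ n"
  by (simp add: val_def)

lemma val_less: "val n b < 2 ^ n"
  by (induction n) (auto simp: val_Suc, simp add: val_def)

lemma val_cong: "(\<And>i. i < n \<Longrightarrow> b i = b' i) \<Longrightarrow> val n b = val n b'"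
  by (simp add: val_def)

lemma val_bitn: "N < 2 ^ n \<Longrightarrow> val n (bitn N) = N"
proof -
  have "val n (bitn N) = N mod 2 ^ n"
  proof (induction n)
    case (Suc n)
    have "N mod 2 ^ Suc n = 2 ^ n * (N div 2 ^ n mod 2) + N mod 2 ^ n"
      using mod_mult2_eq[of N "2 ^ n" 2] by (simp add: mult.commute)
    moreover have "N div 2 ^ n mod 2 = of_bool (bitn N n)" by (simp add: bitn_def mod_2_eq_odd)
    ultimately show ?case using Suc by (simp add: val_Suc mult.commute)
  qed (simp add: val_def)
  then show "N < 2 ^ n \<Longrightarrow> val n (bitn N) = N" by simp
qed

lemma bitn_val: "bitn (val n b) i \<longleftrightarrow> i < n \<and> b i"
proof (induction n)
  case 0
  show ?case by (simp add: val_def bitn_def)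
next
  case (Suc n)
  consider "i < n" | "i = n" | "n < i" by linarith
  then show ?case
  proof cases
    case 1
    then obtain k where k: "n = i + Suc k" by (metis add_Suc_right less_imp_Suc_add)
    have "(val n b + of_bool (b n) * 2 ^ n) div 2 ^ i = val n b div 2 ^ i + of_bool (b n) * 2 ^ Suc
        k"
    proof -
      have "(val n b + 2 ^ i * (of_bool (b n) * 2 ^ Suc k)) div 2 ^ i = of_bool (b n) * 2 ^ Suc k +
          val n b div 2 ^ i"
        by (rule div_mult_self2) simp
      then show ?thesis by (simp add: k power_add algebra_simps)
    qed
    then show ?thesis using Suc 1 by (simp add: val_Suc bitn_def)
  next
    case 2
    have "(val n b + of_bool (b n) * 2 ^ n) div 2 ^ n = of_bool (b n)" using val_less[of n b] by
        simp
    then show ?thesis using 2 by (simp add: val_Suc bitn_def)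
  next
    case 3
    have "val (Suc n) b < 2 ^ i" using val_less[of "Suc n" b] 3
      by (meson Suc_leI less_le_trans one_le_numeral power_increasing)
    then show ?thesis using 3 by (simp add: bitn_def)
  qed
qed

text \<open>Ripple-carry addition without overflow on \<open>n\<close> bits; the iterated equality
  is the exclusive or of three bits. The carries are an argument, because they are guessed as part
  of the certificate instead of being computed.\<close>

definition add3 :: "nat \<Rightarrow> (nat \<Rightarrow> bool) \<Rightarrow> (nat \<Rightarrow>
    bool) \<Rightarrow> (nat \<Rightarrow> bool) \<Rightarrow> (nat \<Rightarrow> bool)
        \<Rightarrow> bool" where
  "add3 n x y z c \<longleftrightarrow> \<not> c 0 \<and> \<not> c n \<and> (\<forall>i < n. z i =
      (x i = (y i = c i)) \<and>
     c (Suc i) = (x i \<and> y i \<or> x i \<and> c i \<or> y i \<and> c i))"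

lemma add3_partial:
  assumes "\<not> c 0" "\<And>i. i < n \<Longrightarrow> z i = (x i = (y i = c i)) \<and> c (Suc i)
      = (x i \<and> y i \<or> x i \<and> c i \<or> y i \<and> c i)"
  shows "val n z + of_bool (c n) * 2 ^ n = val n x + val n y"
  using assms
proof (induction n)
  case (Suc n)
  then have "val n z + of_bool (c n) * 2 ^ n = val n x + val n y" by simp
  moreover have "z n = (x n = (y n = c n))" "c (Suc n) = (x n \<and> y n \<or> x n \<and> c n \<or>
      y n \<and> c n)"
    using Suc.prems(2)[of n] by auto
  ultimately show ?case
    by (cases "x n"; cases "y n"; cases "c n") (simp_all add: val_Suc)
qed (simp add: val_def)

lemma add3_val: "add3 n x y z c \<Longrightarrow> val n z = val n x + val n y"
  using add3_partial[of c n z x y] by (auto simp: add3_def)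

primrec carry :: "nat \<Rightarrow> nat \<Rightarrow> nat \<Rightarrow> bool" where
  "carry X Y 0 = False"
| "carry X Y (Suc i) = (bitn X i \<and> bitn Y i \<or> bitn X i \<and> carry X Y i \<or> bitn Y i
    \<and> carry X Y i)"

lemma add3_bitn:
  assumes "X + Y < 2 ^ n"
  shows "add3 n (bitn X) (bitn Y) (bitn (X + Y)) (carry X Y)"
proof -
  define z where "z i = (bitn X i = (bitn Y i = carry X Y i))" for i
  have "val n z + of_bool (carry X Y n) * 2 ^ n = val n (bitn X) + val n (bitn Y)"
    by (rule add3_partial) (auto simp: z_def)
  also have "\<dots> = X + Y" using assms by (simp add: val_bitn)
  finally have e: "val n z + of_bool (carry X Y n) * 2 ^ n = X + Y" .
  then have c: "\<not> carry X Y n" using assms by (cases "carry X Y n") auto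
  then have "val n z = X + Y" using e by simp
  then have "bitn (X + Y) i = z i" if "i < n" for i using bitn_val[of n z i] that by simp
  then show ?thesis using c by (auto simp: add3_def z_def)
qed

definition sums_ok :: "nat \<Rightarrow> nat \<Rightarrow> (nat \<Rightarrow> nat \<Rightarrow>
    bool) \<Rightarrow> (nat \<Rightarrow> nat \<Rightarrow> bool) \<Rightarrow> (nat \<Rightarrow>
        nat \<Rightarrow> bool) \<Rightarrow> bool" where
  "sums_ok n m a p c \<longleftrightarrow> (\<forall>i < n. \<not> p 0 i) \<and> (\<forall>r < m.
      add3 n (p r) (a r) (p (Suc r)) (c r))"

lemma sums_ok_val: "sums_ok n m a p c \<Longrightarrow> r \<le> m \<Longrightarrow> val n (p r) =
    (\<Sum>k<r. val n (a k))"
proof (induction r)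
  case 0
  then show ?case by (simp add: sums_ok_def val_def)
next
  case (Suc r)
  then show ?case using add3_val[of n "p r" "a r" "p (Suc r)" "c r"] by (simp add: sums_ok_def)
qed

lemma sums_ok_bitn:
  assumes "(\<Sum>k<m. N k) < 2 ^ n" "\<And>k i. k < m \<Longrightarrow> i < n \<Longrightarrow> a
      k i = bitn (N k) i"
  shows "sums_ok n m a (\<lambda>r. bitn (\<Sum>k<r. N k)) (\<lambda>r. carry (\<Sum>k<r. N k) (N
      r))"
proof -
  have "add3 n (bitn (\<Sum>k<r. N k)) (a r) (bitn (\<Sum>k<Suc r. N k)) (carry (\<Sum>k<r. N k) (N
      r))" if "r < m" for r
  proof -
    have "(\<Sum>k<Suc r. N k) \<le> (\<Sum>k<m. N k)" using that by (intro sum_mono2) auto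
    then have "(\<Sum>k<r. N k) + N r < 2 ^ n" using assms(1) by simp
    from add3_bitn[OF this] show ?thesis using assms(2)[OF that] by (simp add: add3_def)
  qed
  then show ?thesis by (simp add: sums_ok_def bitn_def)
qed

text \<open>A digit is printed only if a bit at its position or above is set, which suppresses the
  leading zeros that \<open>enc_nat\<close> does not have.\<close>

definition print_bits :: "nat \<Rightarrow> (nat \<Rightarrow> bool) \<Rightarrow> bool list" where
  "print_bits n b = concat (map (\<lambda>i. if \<exists>i' < n. i \<le> i' \<and> b i' then [True,
      b i] else []) [0..<n]) @ [False]"

lemma div_power_eq_0_iff: "N div 2 ^ i = 0 \<longleftrightarrow> (\<forall>i' \<ge> i. \<not> bitn
    N i')"
proof
  assume "N div 2 ^ i = 0"
  then have "N < 2 ^ i" by (simp add: div_eq_0_iff)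
  then show "\<forall>i' \<ge> i. \<not> bitn N i'"
    by (metis bitn_def div_less even_zero less_le_trans one_le_numeral power_increasing)
next
  assume *: "\<forall>i' \<ge> i. \<not> bitn N i'"
  have "N < 2 ^ (i + N)" by (rule less_le_trans[of _ "2 ^ N"]) (auto intro: power_increasing)
  then have "N = val (i + N) (bitn N)" by (simp add: val_bitn)
  also have "\<dots> = val i (bitn N)"
    unfolding val_def using * by (intro sum.mono_neutral_right) auto
  finally show "N div 2 ^ i = 0" using val_less[of i "bitn N"] by simp
qed

lemma print_bits_val: "print_bits n b = enc_nat (val n b)"
proof -
  let ?N = "val n b" and ?L = "length (bits (val n b))"
  have ne: "(\<exists>i' < n. i \<le> i' \<and> b i') \<longleftrightarrow> i < ?L" for i
  proof -
    have "(\<exists>i' < n. i \<le> i' \<and> b i') \<longleftrightarrow> ?N div 2 ^ i \<noteq> 0"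
      unfolding div_power_eq_0_iff bitn_val by auto
    also have "\<dots> \<longleftrightarrow> i < ?L"
    proof
      assume "?N div 2 ^ i \<noteq> 0"
      then have "2 ^ i \<le> ?N" by (meson div_less not_less)
      then have "2 ^ i < (2 :: nat) ^ ?L" using bits_conv(2)[of ?N] by (rule le_less_trans)
      then show "i < ?L" using power_strict_increasing_iff[of "2 :: nat" i ?L] by simp
    next
      assume i: "i < ?L"
      then have "?N \<noteq> 0" by (cases "?N = 0") (simp_all add: bits.simps[of 0])
      then have "2 ^ ?L \<le> 2 * ?N" by (rule bits_conv(3))
      moreover have "2 ^ Suc i \<le> (2 :: nat) ^ ?L" using i by (intro power_increasing) auto
      ultimately have "2 ^ i \<le> ?N" by simp
      then show "?N div 2 ^ i \<noteq> 0" by (simp add: div_eq_0_iff)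
    qed
    finally show ?thesis .
  qed
  have L: "?L \<le> n"
  proof (cases "?N = 0")
    case False
    then have "2 ^ ?L \<le> 2 * ?N" by (rule bits_conv(3))
    also have "\<dots> < 2 ^ Suc n" using val_less[of n b] by simp
    finally show ?thesis by (simp del: power_Suc)
  qed (simp add: bits.simps[of 0])
  have "concat (map (\<lambda>i. if \<exists>i' < n. i \<le> i' \<and> b i' then [True, b i] else
      []) [0..<n]) =
      concat (map (\<lambda>i. if i < ?L then [True, b i] else []) [0..<n])" by (simp only: ne)
  also have "\<dots> = concat (map (\<lambda>i. if i < ?L then [True, b i] else []) ([0..<?L] @
      [?L..<n]))"
    using L upt_add_eq_append[of 0 ?L "n - ?L"] by simp
  also have "concat (map (\<lambda>i. if i < ?L then [True, b i] else []) ([0..<?L] @ [?L..<n])) =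
      concat (map (\<lambda>i. if i < ?L then [True, b i] else []) [0..<?L])"
    by (rule concat_map_append_Nil) simp
  also have "\<dots> = concat (map (\<lambda>i. [True, odd (?N div 2 ^ i)]) [0..<?L])"
  proof (rule concat_map_cong)
    fix i assume "i < ?L"
    then have "b i = bitn ?N i" using L by (simp add: bitn_val)
    then show "(if i < ?L then [True, b i] else []) = [True, odd (?N div 2 ^ i)]" using \<open>i <
        ?L\<close> by (simp add: bitn_def)
  qed
  also have "\<dots> = concat (map (\<lambda>b. [True, b]) (map (\<lambda>i. odd (?N div 2 ^ i))
      [0..<?L]))"
    by (simp add: comp_def)
  also have "map (\<lambda>i. odd (?N div 2 ^ i)) [0..<?L] = bits ?N" by (rule
      bits_conv(1)[symmetric])
  finally show ?thesis by (simp add: print_bits_def enc_nat_def self_delim_def)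
qed

lemma length_enc_nat_bound: "N < 2 ^ length (enc_nat N)"
proof -
  have "length (bits N) \<le> length (enc_nat N)" by (simp add: enc_nat_def length_self_delim)
  then show ?thesis using bits_conv(2)[of N]
    by (meson less_le_trans one_le_numeral power_increasing)
qed

section \<open>Certificates for instances\<close>

text \<open>The size of the family of paths in \<open>flow_family\<close> when the number of edges
  is bounded by the length \<open>n\<close> of the string.\<close>

definition SS :: "nat \<Rightarrow> nat" where
  "SS n = (n + 1) * (n + 6)"

text \<open>
  A certificate \<open>R\<close> for a string of length \<open>n\<close> consists of the following
      relations, one for each
  first argument: \<open>0\<close> vertices, \<open>1\<close> source, \<open>2\<close> sink,
      \<open>3\<close> edge indices, \<open>4\<close> tail, \<open>5\<close> head, \<open>6\<close>
          bits of
  the capacity, \<open>7\<close> bits of the delay, \<open>8\<close> bits of the rate,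
      \<open>9\<close> bits of the delay bound,
  \<open>10\<close> (path, position, edge), \<open>11\<close> bits of the rate of a path,
      \<open>12\<close>--\<open>14\<close> partial sums, carries and
  slack for the capacity of an edge, \<open>15\<close>--\<open>16\<close> partial sums and carries
      for the total rate, \<open>17\<close>--\<open>19\<close>
  partial sums, carries and slack for the delay of a path, \<open>20\<close>--\<open>21\<close>
      binary expansions of \<open>0, \<dots>, n\<close>
  and carries.
\<close>

definition named :: "nat \<Rightarrow> (nat \<Rightarrow> nat \<Rightarrow> nat \<Rightarrow> nat
    \<Rightarrow> bool) \<Rightarrow> nat \<Rightarrow> nat \<Rightarrow> nat \<Rightarrow> bool"
        where
  "named n R t a v \<longleftrightarrow> R t a v 0 \<and> R 0 v 0 0 \<and> (\<forall>v' < n. R t a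
      v' 0 \<longrightarrow> v' = v)"

definition struct_ok :: "nat \<Rightarrow> (nat \<Rightarrow> nat \<Rightarrow> nat \<Rightarrow>
    nat \<Rightarrow> bool) \<Rightarrow> bool" where
  "struct_ok n R \<longleftrightarrow> (\<forall>v < n. R 0 v 0 0 \<longrightarrow> (\<forall>v' <
      v. R 0 v' 0 0)) \<and>
     (\<exists>v < n. named n R 1 0 v) \<and> (\<exists>v < n. named n R 2 0 v) \<and> \<not>
         (\<exists>v < n. R 1 0 v 0 \<and> R 2 0 v 0) \<and>
     (\<forall>j < n. R 3 j 0 0 \<longrightarrow> (\<exists>v < n. named n R 4 j v) \<and>
         (\<exists>v < n. named n R 5 j v)) \<and>
     (\<forall>j < n. \<forall>j' < n. R 3 j 0 0 \<and> R 3 j' 0 0 \<and> j \<noteq> j'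
         \<longrightarrow>
        \<not> (\<exists>u < n. R 4 j u 0 \<and> R 4 j' u 0) \<or> \<not> (\<exists>u < n. R 5 j u
            0 \<and> R 5 j' u 0)) \<and>
     (\<exists>i < n. R 8 i 0 0)"

text \<open>The edges of an index need not form a path. It suffices that each starts at the source
  or at the head of an edge of an earlier position and that some edge enters the sink; then a walk
  can be extracted, which is all that \<open>flow_of_edge_sets\<close> requires.\<close>

definition paths_ok :: "nat \<Rightarrow> (nat \<Rightarrow> nat \<Rightarrow> nat \<Rightarrow>
    nat \<Rightarrow> bool) \<Rightarrow> bool" where
  "paths_ok n R \<longleftrightarrow> (\<forall>k < SS n.
     (\<forall>h < n. \<forall>j < n. R 10 k h j \<longrightarrow> R 3 j 0 0 \<and>
        (\<exists>u < n. R 4 j u 0 \<and> (R 1 0 u 0 \<or> (\<exists>h' < h. \<exists>j' < n. R 10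
            k h' j' \<and> R 5 j' u 0)))) \<and>
     (\<exists>h < n. \<exists>j < n. R 10 k h j \<and> (\<exists>v < n. R 5 j v 0 \<and> R 2 0 v
         0)))"

definition on_path :: "nat \<Rightarrow> (nat \<Rightarrow> nat \<Rightarrow> nat \<Rightarrow> nat
    \<Rightarrow> bool) \<Rightarrow> nat \<Rightarrow> nat \<Rightarrow> bool" where
  "on_path n R k j \<longleftrightarrow> (\<exists>h < n. R 10 k h j)"

text \<open>Upper bounds are expressed by adding a guessed slack to the last partial sum; this
  addition uses the carries with the index after those of the sum.\<close>

definition flow_ok :: "nat \<Rightarrow> (nat \<Rightarrow> nat \<Rightarrow> nat \<Rightarrow> nat
    \<Rightarrow> bool) \<Rightarrow> bool" where
  "flow_ok n R \<longleftrightarrow>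
     (\<forall>j < n. R 3 j 0 0 \<longrightarrow>
        sums_ok n (SS n) (\<lambda>k i. on_path n R k j \<and> R 11 k i 0) (\<lambda>r i. R 12 j r
            i) (\<lambda>r i. R 13 j r i) \<and>
        add3 n (\<lambda>i. R 12 j (SS n) i) (\<lambda>i. R 14 j i 0) (\<lambda>i. R 6 j i 0)
            (\<lambda>i. R 13 j (SS n) i)) \<and>
     sums_ok n (SS n) (\<lambda>k i. R 11 k i 0) (\<lambda>r i. R 15 r i 0) (\<lambda>r i. R 16 r i
         0) \<and>
     (\<forall>i < n. R 15 (SS n) i 0 = R 8 i 0 0) \<and>
     (\<forall>k < SS n.
        sums_ok n n (\<lambda>j i. on_path n R k j \<and> R 7 j i 0) (\<lambda>r i. R 17 k r i)
            (\<lambda>r i. R 18 k r i) \<and>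
        add3 n (\<lambda>i. R 17 k n i) (\<lambda>i. R 19 k i 0) (\<lambda>i. R 9 i 0 0)
            (\<lambda>i. R 18 k n i))"

text \<open>The addend with the single bit \<open>0\<close> is the number \<open>1\<close>, so the
  partial sums are \<open>0\<close>, ..., \<open>n\<close> in binary. A number is at most
  \<open>n\<close> if its bits agree with one of them.\<close>

definition small_ok :: "nat \<Rightarrow> (nat \<Rightarrow> nat \<Rightarrow> nat \<Rightarrow>
    nat \<Rightarrow> bool) \<Rightarrow> bool" where
  "small_ok n R \<longleftrightarrow> sums_ok n n (\<lambda>r i. i = 0) (\<lambda>r i. R 20 r i 0)
      (\<lambda>r i. R 21 r i 0) \<and>
     (\<forall>j < n. R 3 j 0 0 \<longrightarrow> (\<exists>v < Suc n. \<forall>i < n. R 6 j i 0 =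
         R 20 v i 0) \<and>
        (\<exists>v < Suc n. \<forall>i < n. R 7 j i 0 = R 20 v i 0)) \<and>
     (\<exists>v < Suc n. \<forall>i < n. R 8 i 0 0 = R 20 v i 0) \<and> (\<exists>v < Suc n.
         \<forall>i < n. R 9 i 0 0 = R 20 v i 0)"

definition print_vertex :: "nat \<Rightarrow> (nat \<Rightarrow> nat \<Rightarrow> nat
    \<Rightarrow> nat \<Rightarrow> bool) \<Rightarrow> nat \<Rightarrow> nat \<Rightarrow> bool
        list" where
  "print_vertex n R t a = concat (map (\<lambda>v. if R t a v 0 then enc_nat v else []) [0..<n])"

definition print_instance :: "nat \<Rightarrow> (nat \<Rightarrow> nat \<Rightarrow> nat
    \<Rightarrow> nat \<Rightarrow> bool) \<Rightarrow> bool list" where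
  "print_instance n R =
     concat (map (\<lambda>v. if R 0 v 0 0 then [True] else []) [0..<n]) @ [False] @
     (concat (map (\<lambda>j. if R 3 j 0 0 then True # print_vertex n R 4 j @ print_vertex n R 5 j
         @
        print_bits n (\<lambda>i. R 6 j i 0) @ print_bits n (\<lambda>i. R 7 j i 0) else [])
            [0..<n]) @ [False]) @
     print_vertex n R 1 0 @ print_vertex n R 2 0 @ print_bits n (\<lambda>i. R 8 i 0 0) @
     False # print_bits n (\<lambda>i. R 9 i 0 0)"

definition rel_of :: "(nat \<Rightarrow> bool) \<Rightarrow> nat \<Rightarrow> nat \<Rightarrow>
    nat \<Rightarrow> nat \<Rightarrow> bool" where
  "rel_of B t a b c = B (pr t (pr a (pr b c)))"

lemma fdef_struct_ok: "fdef (\<lambda>n B e. struct_ok n (rel_of B))"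
  unfolding struct_ok_def named_def rel_of_def by (intro def_intros)

lemma fdef_paths_ok: "fdef (\<lambda>n B e. paths_ok n (rel_of B))"
  unfolding paths_ok_def rel_of_def SS_def by (intro def_intros)

lemma fdef_flow_ok: "fdef (\<lambda>n B e. flow_ok n (rel_of B))"
  unfolding flow_ok_def on_path_def sums_ok_def add3_def rel_of_def SS_def by (intro def_intros)

lemma fdef_small_ok: "fdef (\<lambda>n B e. small_ok n (rel_of B))"
  unfolding small_ok_def sums_ok_def add3_def rel_of_def by (intro def_intros)

lemma odef_print_instance: "odef (\<lambda>n B e. print_instance n (rel_of B))"
  unfolding print_instance_def print_vertex_def print_bits_def rel_of_def by (intro def_intros)

text \<open>A failed check prints a string one longer than the input, which therefore never equals
  the input.\<close>

lemma odef_certificate: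
  "odef (\<lambda>n B e. if struct_ok n (rel_of B) \<and> paths_ok n (rel_of B) \<and> flow_ok n
      (rel_of B) \<and>
       (small \<longrightarrow> small_ok n (rel_of B))
     then print_instance n (rel_of B) else replicate (Suc n) True)"
  by (intro odef_if fdef_conj fdef_imp fdef_const fdef_struct_ok fdef_paths_ok fdef_flow_ok
      fdef_small_ok odef_print_instance odef_replicate tdef_Suc tdef_len)

section \<open>Soundness of certificates\<close>

lemma initial_segment:
  fixes A :: "nat set"
  assumes "finite A" "\<And>v v'. v \<in> A \<Longrightarrow> v' < v \<Longrightarrow> v' \<in> A"
  shows "A = {..<card A}"
proof (cases "A = {}")
  case False
  have "v \<in> A \<longleftrightarrow> v \<le> Max A" for v
    using Max_in[OF assms(1) False] Max_ge[OF assms(1), of v] assms(2)[of "Max A" v] by (cases "v =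
        Max A") auto
  then have "\<exists>m. A = {..<m}" by (intro exI[of _ "Suc (Max A)"] set_eqI) (simp add:
      less_Suc_eq_le)
  then obtain m where "A = {..<m}" ..
  then show ?thesis by simp
qed simp

lemma concat_map_filter:
  "concat (map (\<lambda>j. if P j then g j else []) xs) = concat (map g (filter P xs))"
  by (induction xs) auto

lemma print_vertex_named: "named n R t a v \<Longrightarrow> v < n \<Longrightarrow> print_vertex n
    R t a = enc_nat v"
proof -
  assume v: "named n R t a v" "v < n"
  have "(if R t a v' 0 then enc_nat v' else []) = []" if "v' < n" "v' \<noteq> v" for v'
    using v(1) that unfolding named_def by (meson)
  from concat_map_single[of v n "\<lambda>v. if R t a v 0 then enc_nat v else []", OF v(2) this]
  moreover have "R t a v 0" using v(1) unfolding named_def by blast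
  ultimately show ?thesis by (simp add: print_vertex_def)
qed

lemma val_conj: "val n (\<lambda>i. P \<and> b i) = (if P then val n b else 0)"
  by (simp add: val_def)

text \<open>The instance is read off from the relations. The printed sign of the delay bound is
  always that of a non-negative number, which loses no instance since maximum delays are natural
  numbers.\<close>

lemma certificate_sound:
  assumes ok: "struct_ok n R" "paths_ok n R" "flow_ok n R"
    and small: "small \<Longrightarrow> small_ok n R"
  shows "\<exists>I \<in> int_min_max_delay. print_instance n R = enc_instance I \<and> (small
      \<longrightarrow> max_number I \<le> n)"
proof -
  note st0 = ok(1)[unfolded struct_ok_def]
  note st1 = st0[THEN conjunct1] and st' = st0[THEN conjunct2]
  note st2 = st'[THEN conjunct1] and st' = st'[THEN conjunct2]
  note st3 = st'[THEN conjunct1] and st' = st'[THEN conjunct2]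
  note st4 = st'[THEN conjunct1] and st' = st'[THEN conjunct2]
  note st5 = st'[THEN conjunct1] and st' = st'[THEN conjunct2]
  note st6 = st'[THEN conjunct1] and st7 = st'[THEN conjunct2]
  note fl0 = ok(3)[unfolded flow_ok_def]
  note fl1 = fl0[THEN conjunct1] and fl' = fl0[THEN conjunct2]
  note fl2 = fl'[THEN conjunct1] and fl' = fl'[THEN conjunct2]
  note fl3 = fl'[THEN conjunct1] and fl4 = fl'[THEN conjunct2]
  have pa: "R 3 j 0 0" "\<exists>u < n. R 4 j u 0 \<and> (R 1 0 u 0 \<or> (\<exists>h' < h.
      \<exists>j' < n. R 10 k h' j' \<and> R 5 j' u 0))"
    if "k < SS n" "h < n" "j < n" "R 10 k h j" for k h j
    using ok(2)[unfolded paths_ok_def, rule_format, OF that(1), THEN conjunct1, rule_format, OF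
        that(2-4)] by auto
  have pb: "\<exists>h < n. \<exists>j < n. R 10 k h j \<and> (\<exists>v < n. R 5 j v 0 \<and> R 2
      0 v 0)" if "k < SS n" for k
    using ok(2)[unfolded paths_ok_def, rule_format, OF that, THEN conjunct2] .
  define V where "V = card {v. v < n \<and> R 0 v 0 0}"
  have "{v. v < n \<and> R 0 v 0 0} = {..<V}"
    unfolding V_def by (rule initial_segment) (use st1 in auto)
  then have V: "v < n \<and> R 0 v 0 0 \<longleftrightarrow> v < V" for v by auto
  have "V \<le> n" using V[of n] by (cases "n < V") auto
  from st2 obtain s where s: "s < n" "named n R 1 0 s" by blast
  from st3 obtain t where t: "t < n" "named n R 2 0 t" by blast
  have named_V: "v < V" if "named n R a b v" "v < n" for a b v
    using V[of v] that unfolding named_def by blast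
  have named_eq: "R a b v' 0 \<longleftrightarrow> v' = v" if "named n R a b v" "v' < n" for a b v
      v'
    using that unfolding named_def by blast
  have sV: "s < V" "t < V" using named_V s t by blast+
  have src: "R 1 0 v 0 \<longleftrightarrow> v = s" "R 2 0 v 0 \<longleftrightarrow> v = t" if "v <
      n" for v
    using named_eq[OF s(2) that] named_eq[OF t(2) that] .
  have ts: "t \<noteq> s" using st4 s t unfolding named_def by blast
  have "\<forall>j. \<exists>v. j < n \<and> R 3 j 0 0 \<longrightarrow> v < n \<and> named n R 4 j
      v" using st5 by blast
  from choice[OF this] obtain U where U0: "\<forall>j. j < n \<and> R 3 j 0 0 \<longrightarrow> U j
      < n \<and> named n R 4 j (U j)" ..
  have "\<forall>j. \<exists>v. j < n \<and> R 3 j 0 0 \<longrightarrow> v < n \<and> named n R 5 j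
      v" using st5 by blast
  from choice[OF this] obtain W where W0: "\<forall>j. j < n \<and> R 3 j 0 0 \<longrightarrow> W j
      < n \<and> named n R 5 j (W j)" ..
  have U: "U j < n" "named n R 4 j (U j)" "U j < V" if "j < n" "R 3 j 0 0" for j
    using U0[rule_format, OF conjI[OF that]] named_V[of 4 j "U j"] by auto
  have W: "W j < n" "named n R 5 j (W j)" "W j < V" if "j < n" "R 3 j 0 0" for j
    using W0[rule_format, OF conjI[OF that]] named_V[of 5 j "W j"] by auto
  have Ueq: "R 4 j v 0 \<longleftrightarrow> v = U j" "R 5 j v 0 \<longleftrightarrow> v = W j" if
      "j < n" "R 3 j 0 0" "v < n" for j v
    using named_eq[OF U(2)[OF that(1,2)] that(3)] named_eq[OF W(2)[OF that(1,2)] that(3)] .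
  have inj: "j = j'" if "j < n" "R 3 j 0 0" "j' < n" "R 3 j' 0 0" "(U j, W j) = (U j', W j')" for j
      j'
  proof (rule ccontr)
    assume "j \<noteq> j'"
    then have "\<not> (\<exists>u < n. R 4 j u 0 \<and> R 4 j' u 0) \<or> \<not> (\<exists>u < n. R
        5 j u 0 \<and> R 5 j' u 0)"
      using st6 that(1-4) by blast
    moreover have "R 4 j (U j) 0" "R 4 j' (U j) 0" "R 5 j (W j) 0" "R 5 j' (W j) 0"
      using Ueq[OF that(1,2) U(1)[OF that(1,2)]] Ueq[OF that(1,2) W(1)[OF that(1,2)]]
        Ueq[OF that(3,4) U(1)[OF that(1,2)]] Ueq[OF that(3,4) W(1)[OF that(1,2)]] that(5) by auto
    ultimately show False using U(1)[OF that(1,2)] W(1)[OF that(1,2)] by blast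
  qed
  define cp where "cp j = val n (\<lambda>i. R 6 j i 0)" for j
  define dl where "dl j = val n (\<lambda>i. R 7 j i 0)" for j
  define js where "js = filter (\<lambda>j. R 3 j 0 0) [0..<n]"
  have js: "j \<in> set js \<longleftrightarrow> j < n \<and> R 3 j 0 0" for j by (auto simp:
      js_def)
  define rt where "rt = val n (\<lambda>i. R 8 i 0 0)"
  define bd where "bd = val n (\<lambda>i. R 9 i 0 0)"
  define I where "I = \<lparr>nverts = V, edges = map (\<lambda>j. ((U j, W j), (cp j, dl j))) js,
      source = s, sink = t,
    rate = rt, bound = int bd\<rparr>"
  have I: "nverts I = V" "edges I = map (\<lambda>j. ((U j, W j), (cp j, dl j))) js" "source I = s"
      "sink I = t"
    "rate I = rt" "bound I = int bd" by (simp_all add: I_def)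
  have enc: "print_instance n R = enc_instance I"
  proof -
    have 1: "concat (map (\<lambda>v. if R 0 v 0 0 then [True] else []) [0..<n]) = replicate V True"
    proof -
      have lo: "R 0 v 0 0" if "v < V" for v using V[of v] that by blast
      have hi: "\<not> R 0 v 0 0" if "V \<le> v" "v < n" for v using V[of v] that by (meson
          not_less)
      have "[0..<n] = [0..<V] @ [V..<n]" using \<open>V \<le> n\<close> upt_add_eq_append[of 0 V "n
          - V"] by simp
      then have "concat (map (\<lambda>v. if R 0 v 0 0 then [True] else []) [0..<n]) =
          concat (map (\<lambda>v. if R 0 v 0 0 then [True] else []) [0..<V])"
        by (simp only:) (rule concat_map_append_Nil, simp add: hi)
      also have "\<dots> = concat (map (\<lambda>v. [True]) [0..<V])" by (rule concat_map_cong)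
          (simp add: lo)
      also have "\<dots> = replicate V True"
        using concat_map_singleton[of "\<lambda>_. True" "[0..<V]"] by (simp add:
            map_replicate_const)
      finally show ?thesis .
    qed
    have 2: "concat (map (\<lambda>j. if R 3 j 0 0 then True # print_vertex n R 4 j @ print_vertex
        n R 5 j @
        print_bits n (\<lambda>i. R 6 j i 0) @ print_bits n (\<lambda>i. R 7 j i 0) else [])
            [0..<n]) @ [False] =
        enc_list enc_edge (edges I)"
    proof -
      have "concat (map (\<lambda>j. True # print_vertex n R 4 j @ print_vertex n R 5 j @
          print_bits n (\<lambda>i. R 6 j i 0) @ print_bits n (\<lambda>i. R 7 j i 0)) js) =
        concat (map (\<lambda>j. True # enc_nat (U j) @ enc_nat (W j) @ enc_nat (cp j) @ enc_nat
            (dl j)) js)"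
        by (intro arg_cong[where f = concat] map_cong refl)
          (simp add: js print_bits_val cp_def dl_def print_vertex_named[OF U(2) U(1)]
              print_vertex_named[OF W(2) W(1)])
      then show ?thesis
        unfolding concat_map_filter js_def[symmetric] enc_list_def I by (simp add: comp_def)
    qed
    show ?thesis
      unfolding print_instance_def 1 2
      unfolding print_vertex_named[OF s(2,1)] print_vertex_named[OF t(2,1)]
        print_bits_val enc_instance_def
      by (simp add: I enc_int_def rt_def bd_def)
  qed
  have arcs: "arcs (graph I) = (\<lambda>j. (U j, W j)) ` set js" by (simp add: graph_def I
      image_image)
  have dist: "distinct (map fst (edges I))"
  proof -
    have "inj_on (\<lambda>j. (U j, W j)) (set js)" using inj by (auto simp: inj_on_def js)
    then show ?thesis by (simp add: I comp_def distinct_map js_def)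
  qed
  have w: "cap I (U j, W j) = cp j" "delay I (U j, W j) = dl j" if "j \<in> set js" for j
  proof -
    have "map_of (edges I) (U j, W j) = Some (cp j, dl j)"
      by (rule map_of_is_SomeI[OF dist]) (use that in \<open>auto simp: I\<close>)
    then show "cap I (U j, W j) = cp j" "delay I (U j, W j) = dl j" by (simp_all add: cap_def
        delay_def)
  qed
  have "rt > 0"
  proof -
    obtain i where "i < n" "R 8 i 0 0" using st7 by blast
    then have "of_bool (R 8 i 0 0) * 2 ^ i \<le> rt" unfolding rt_def val_def
      by (intro member_le_sum[of i "{..<n}" "\<lambda>i. of_bool (R 8 i 0 0) * 2 ^ i"]) auto
    then show ?thesis using \<open>R 8 i 0 0\<close> by (metis gr0I le_zero_eq mult_1 of_bool_eq(2)
        power_not_zero zero_neq_numeral)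
  qed
  have wfd: "wf_digraph (graph I)"
    by unfold_locales (use U(3) W(3) in \<open>auto simp: arcs js\<close>, auto simp: graph_def I)
  then have valid: "valid_instance I"
    using dist sV ts \<open>rt > 0\<close> by (simp add: valid_instance_def graph_def I)
  interpret wf_digraph "graph I" by (rule wfd)
  define E where "E k = {(U j, W j) | j. j < n \<and> on_path n R k j}" for k
  have op: "on_path n R k j \<Longrightarrow> k < SS n \<Longrightarrow> j < n \<Longrightarrow> j
      \<in> set js" for k j
    using pa(1) unfolding on_path_def js by blast
  have memE: "(U j, W j) \<in> E k \<longleftrightarrow> on_path n R k j" if "j \<in> set js" "k <
      SS n" for j k
  proof
    assume "(U j, W j) \<in> E k"
    then obtain j' where j': "(U j, W j) = (U j', W j')" "j' < n" "on_path n R k j'" unfolding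
        E_def by blast
    then have "j = j'" using inj[of j j'] op[of k j'] that js by auto
    then show "on_path n R k j" using j' by simp
  qed (use that js in \<open>auto simp: E_def\<close>)
  have "I \<in> int_min_max_delay"
  proof (rule flow_of_edge_sets[OF valid, where S = "SS n" and E = E and g = "\<lambda>k. val n
      (\<lambda>i. R 11 k i 0)"])
    fix k assume k: "k < SS n"
    \<comment> \<open>Positions decrease from an edge to its predecessor, so tracing predecessors
      ends at the source. The resulting walk may leave out edges of \<open>E k\<close>.\<close>
    have reach: "\<exists>p. awalk s p (W j) \<and> set p \<subseteq> E k" if "h < n" "j < n" "R 10
        k h j" for h j
      using that
    proof (induction h arbitrary: j rule: less_induct)
      case (less h)
      have opj: "on_path n R k j" using less.prems by (auto simp: on_path_def)
      then have jj: "j \<in> set js" using op k less.prems by blast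
      have e: "(U j, W j) \<in> E k" using opj memE[OF jj k] by simp
      have arc: "(U j, W j) \<in> arcs (graph I)" using jj by (auto simp: arcs)
      obtain u where u: "u < n" "R 4 j u 0" "R 1 0 u 0 \<or> (\<exists>h' < h. \<exists>j' < n. R
          10 k h' j' \<and> R 5 j' u 0)"
        using pa(2)[OF k less.prems] by blast
      have uU: "u = U j" using Ueq(1)[of j u] jj u js by blast
      have step: "awalk (U j) [(U j, W j)] (W j)" using arc wellformed[OF arc] by (simp add:
          awalk_def)
      from u(3) show ?case
      proof
        assume "R 1 0 u 0"
        then have "U j = s" using src(1)[OF u(1)] uU by simp
        then show ?thesis using step e by (intro exI[of _ "[(U j, W j)]"]) auto
      next
        assume "\<exists>h' < h. \<exists>j' < n. R 10 k h' j' \<and> R 5 j' u 0"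
        then obtain h' j' where h': "h' < h" "j' < n" "R 10 k h' j'" "R 5 j' u 0" by blast
        have "on_path n R k j'" unfolding on_path_def using h' less.prems(1) by (intro exI[of _
            h']) simp
        then have jj': "j' \<in> set js" using op k h'(2) by blast
        have "u = W j'" using Ueq(2)[of j' u] jj' u(1) h'(4) js by blast
        moreover obtain p where p: "awalk s p (W j')" "set p \<subseteq> E k"
          using less.IH[OF h'(1) _ h'(2,3)] h'(1) less.prems(1) by auto
        ultimately have "awalk s (p @ [(U j, W j)]) (W j)" using step uU by (intro awalk_appendI[OF
            p(1)]) simp_all
        then show ?thesis using p(2) e by (intro exI[of _ "p @ [(U j, W j)]"]) auto
      qed
    qed
    obtain h j v where hj: "h < n" "j < n" "R 10 k h j" "v < n" "R 5 j v 0" "R 2 0 v 0"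
      using pb[OF k] by blast
    have "j \<in> set js" using op[of k j] k hj by (auto simp: on_path_def)
    then have "W j = t" using Ueq(2)[of j v] src(2)[of v] hj js by blast
    then show "\<exists>p. awalk (source I) p (sink I) \<and> set p \<subseteq> E k" using reach[OF
        hj(1-3)] by (simp add: I)
    show "finite (E k)" unfolding E_def by simp
    have "(\<Sum>e\<in>E k. delay I e) = (\<Sum>j | j < n \<and> on_path n R k j. dl j)"
    proof -
      have "E k = (\<lambda>j. (U j, W j)) ` {j. j < n \<and> on_path n R k j}" by (auto simp:
          E_def)
      moreover have "inj_on (\<lambda>j. (U j, W j)) {j. j < n \<and> on_path n R k j}"
        using inj op[of k] k by (auto simp: inj_on_def js)
      ultimately have "(\<Sum>e\<in>E k. delay I e) = (\<Sum>j | j < n \<and> on_path n R k j.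
          delay I (U j, W j))"
        by (simp add: sum.reindex)
      also have "\<dots> = (\<Sum>j | j < n \<and> on_path n R k j. dl j)" using op[of k] k by
          (intro sum.cong) (auto simp: w)
      finally show ?thesis .
    qed
    also have "\<dots> = (\<Sum>j<n. val n (\<lambda>i. on_path n R k j \<and> R 7 j i 0))"
      unfolding val_conj dl_def[symmetric] by (simp add: sum.inter_filter[symmetric])
    also have "\<dots> \<le> bd"
    proof -
      have "sums_ok n n (\<lambda>j i. on_path n R k j \<and> R 7 j i 0) (\<lambda>r i. R 17 k r i)
          (\<lambda>r i. R 18 k r i)"
        "add3 n (\<lambda>i. R 17 k n i) (\<lambda>i. R 19 k i 0) (\<lambda>i. R 9 i 0 0)
            (\<lambda>i. R 18 k n i)"
        using fl4 k by blast+
      from sums_ok_val[OF this(1) order_refl] add3_val[OF this(2)] show ?thesis by (simp add: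
          bd_def)
    qed
    finally show "int (\<Sum>e\<in>E k. delay I e) \<le> bound I" unfolding I(6) by (rule
        of_nat_mono)
  next
    fix e assume "e \<in> arcs (graph I)"
    then obtain j where j: "j \<in> set js" "e = (U j, W j)" by (auto simp: arcs)
    have "(\<Sum>k | k < SS n \<and> e \<in> E k. val n (\<lambda>i. R 11 k i 0)) =
        (\<Sum>k | k < SS n \<and> on_path n R k j. val n (\<lambda>i. R 11 k i 0))"
      using memE[OF j(1)] j(2) by (intro sum.cong) auto
    also have "\<dots> = (\<Sum>k<SS n. val n (\<lambda>i. on_path n R k j \<and> R 11 k i 0))"
      unfolding val_conj by (simp add: sum.inter_filter[symmetric])
    also have "\<dots> \<le> cp j"
    proof -
      have "sums_ok n (SS n) (\<lambda>k i. on_path n R k j \<and> R 11 k i 0) (\<lambda>r i. R 12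
          j r i) (\<lambda>r i. R 13 j r i)"
        "add3 n (\<lambda>i. R 12 j (SS n) i) (\<lambda>i. R 14 j i 0) (\<lambda>i. R 6 j i 0)
            (\<lambda>i. R 13 j (SS n) i)"
        using fl1 j(1) js by blast+
      from sums_ok_val[OF this(1) order_refl] add3_val[OF this(2)] show ?thesis by (simp add:
          cp_def)
    qed
    finally show "(\<Sum>k | k < SS n \<and> e \<in> E k. val n (\<lambda>i. R 11 k i 0)) \<le> cap
        I e" using w(1)[OF j(1)] j(2) by simp
  next
    have "val n (\<lambda>i. R 15 (SS n) i 0) = rt" unfolding rt_def by (rule val_cong) (use fl3 in
        blast)
    then show "(\<Sum>k<SS n. val n (\<lambda>i. R 11 k i 0)) = rate I" using sums_ok_val[OF fl2
        order_refl] by (simp add: I)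
  qed
  moreover have "max_number I \<le> n" if small
  proof -
    note sm = small[OF that, unfolded small_ok_def]
    have one: "val n (\<lambda>i. i = 0) \<le> 1" by (cases n) (simp_all add: val_def
        sum.lessThan_Suc_shift)
    have num: "val n (\<lambda>i. R 20 v i 0) \<le> n" if "v < Suc n" for v
    proof -
      have "val n (\<lambda>i. R 20 v i 0) = (\<Sum>k<v. val n (\<lambda>i. i = 0))"
        by (rule sums_ok_val[OF conjunct1[OF sm]]) (use that in simp)
      also have "\<dots> \<le> (\<Sum>k<v. 1)" using one by (intro sum_mono) simp
      finally show ?thesis using that by simp
    qed
    have le: "val n b \<le> n" if ex: "\<exists>v < Suc n. \<forall>i < n. b i = R 20 v i 0" for b
    proof -
      obtain v where v: "v < Suc n" "\<forall>i < n. b i = R 20 v i 0" using ex by blast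
      have "val n b = val n (\<lambda>i. R 20 v i 0)" by (rule val_cong) (use v in blast)
      then show ?thesis using num[OF v(1)] by simp
    qed
    note sm1 = sm[THEN conjunct2, THEN conjunct1] and sm2 = sm[THEN conjunct2, THEN conjunct2, THEN
        conjunct1]
      and sm3 = sm[THEN conjunct2, THEN conjunct2, THEN conjunct2]
    have "cp j \<le> n \<and> dl j \<le> n" if "j \<in> set js" for j
    proof -
      have "(\<exists>v < Suc n. \<forall>i < n. R 6 j i 0 = R 20 v i 0) \<and> (\<exists>v < Suc
          n. \<forall>i < n. R 7 j i 0 = R 20 v i 0)"
        using sm1[rule_format, of j] that js by blast
      then show ?thesis unfolding cp_def dl_def using le[of "\<lambda>i. R 6 j i 0"] le[of
          "\<lambda>i. R 7 j i 0"] by blast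
    qed
    then have "cap I e \<le> n \<and> delay I e \<le> n" if "e \<in> arcs (graph I)" for e
      using that w by (auto simp: arcs)
    moreover have "rt \<le> n" "bd \<le> n" unfolding rt_def bd_def
      using le[of "\<lambda>i. R 8 i 0 0", OF sm2] le[of "\<lambda>i. R 9 i 0 0", OF sm3] .
    moreover have "finite (arcs (graph I))" by (simp add: arcs)
    ultimately show ?thesis unfolding max_number_def by (subst Max_le_iff) (auto simp: I)
  qed
  ultimately show ?thesis using enc by blast
qed

section \<open>Completeness of certificates\<close>

lemma length_enc_list_member: "x \<in> set xs \<Longrightarrow> length (enc x) \<le> length
    (enc_list enc xs)"
  by (induction xs) (auto simp: enc_list_def)

lemma length_le_enc_list: "length xs \<le> length (enc_list enc xs)"
  by (induction xs) (auto simp: enc_list_def)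

text \<open>All indices of a certificate range below polynomials in \<open>n\<close> and all numbers
  have \<open>n\<close> bits. This is enough because the number of vertices is written in unary,
  each edge contributes at least one bit, and every number is written in binary within the
  string.\<close>

lemma enc_instance_bounds:
  assumes n: "n = length (enc_instance I)"
  shows "nverts I < n" "length (edges I) \<le> n" "rate I < 2 ^ n" "nat \<bar>bound I\<bar> < 2 ^ n"
    "((u, v), (c, d)) \<in> set (edges I) \<Longrightarrow> c < 2 ^ n \<and> d < 2 ^ n"
proof -
  have big: "N < 2 ^ n" if "length (enc_nat N) \<le> n" for N :: nat
    using length_enc_nat_bound[of N] that by (meson less_le_trans one_le_numeral power_increasing)
  show "nverts I < n" by (simp add: n enc_instance_def)
  show "rate I < 2 ^ n" by (rule big) (simp add: n enc_instance_def)
  show "nat \<bar>bound I\<bar> < 2 ^ n" by (rule big) (simp add: n enc_instance_def enc_int_def)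
  show "length (edges I) \<le> n"
    using length_le_enc_list[of "edges I" enc_edge] n by (simp add: enc_instance_def)
  show "c < 2 ^ n \<and> d < 2 ^ n" if "((u, v), (c, d)) \<in> set (edges I)"
    using length_enc_list_member[OF that, of enc_edge] n
    by (intro conjI big) (simp_all add: enc_instance_def)
qed

lemma bitn_one: "bitn 1 i \<longleftrightarrow> i = 0"
proof (cases i)
  case (Suc j)
  have "1 div 2 ^ Suc j = (0 :: nat)" by (rule div_less, rule one_less_power) simp_all
  then show ?thesis using Suc by (simp add: bitn_def)
qed (simp add: bitn_def)

lemma sum_if_filter:
  fixes g :: "nat \<Rightarrow> nat"
  shows "(\<Sum>k<m. if P k then g k else 0) = (\<Sum>k | k < m \<and> P k. g k)"
  by (simp add: sum.inter_filter[symmetric])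

lemma certificate_complete:
  assumes I: "I \<in> int_min_max_delay" and n: "n = length (enc_instance I)"
  shows "\<exists>R. struct_ok n R \<and> paths_ok n R \<and> flow_ok n R \<and> (max_number I
      \<le> n \<longrightarrow> small_ok n R) \<and>
    print_instance n R = enc_instance I"
proof -
  have v: "valid_instance I" using I by (simp add: int_min_max_delay_def)
  obtain f where f: "feasible_flow I f" "int (max_delay I f) \<le> bound I"
    using I by (auto simp: int_min_max_delay_def)
  interpret wf_digraph "graph I" using v by (simp add: valid_instance_def)
  interpret fin_digraph "graph I" by unfold_locales (simp_all add: graph_def)
  define es where "es = edges I"
  define m where "m = length es"
  define eu where "eu j = fst (fst (es ! j))" for j
  define ev where "ev j = snd (fst (es ! j))" for j
  define cp where "cp j = fst (snd (es ! j))" for j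
  define dl where "dl j = snd (snd (es ! j))" for j
  have es_nth: "es ! j = ((eu j, ev j), (cp j, dl j))" for j by (simp add: eu_def ev_def cp_def
      dl_def)
  note B = enc_instance_bounds[OF n]
  have mn: "m \<le> n" using B(2) by (simp add: m_def es_def)
  have dist: "distinct (map fst es)" using v by (simp add: valid_instance_def es_def)
  have edge_mem: "((eu j, ev j), (cp j, dl j)) \<in> set es" if "j < m" for j
    using that nth_mem[of j es] by (simp add: m_def es_nth)
  have small_num: "cp j < 2 ^ n" "dl j < 2 ^ n" if "j < m" for j
    using B(5) edge_mem[OF that] by (auto simp: es_def)
  have arc: "(eu j, ev j) \<in> arcs (graph I)" if "j < m" for j
    using edge_mem[OF that] by (force simp: graph_def es_def)
  have arcs: "arcs (graph I) = (\<lambda>j. (eu j, ev j)) ` {..<m}"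
  proof -
    have "set es = (\<lambda>j. es ! j) ` {..<m}" by (simp add: set_conv_nth m_def
        setcompr_eq_image lessThan_def)
    then show ?thesis by (simp add: graph_def es_def[symmetric] image_image es_nth)
  qed
  have ends: "eu j < nverts I" "ev j < nverts I" if "j < m" for j
    using wellformed[OF arc[OF that]] by (auto simp: graph_def)
  have key_inj: "j = j'" if "j < m" "j' < m" "(eu j, ev j) = (eu j', ev j')" for j j'
  proof -
    have "map fst es ! j = map fst es ! j'" using that by (simp add: m_def es_nth)
    then show ?thesis using nth_eq_iff_index_eq[OF dist] that by (simp add: m_def)
  qed
  have w: "cap I (eu j, ev j) = cp j" "delay I (eu j, ev j) = dl j" if "j < m" for j
    using map_of_is_SomeI[OF dist edge_mem[OF that]] by (simp_all add: cap_def delay_def es_def)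
  have st: "source I < nverts I" "sink I < nverts I" "sink I \<noteq> source I" "rate I > 0"
    using v by (auto simp: valid_instance_def graph_def)
  have bd: "bound I \<ge> 0" using f(2) by linarith
  define S where "S = SS n"
  have "card (arcs (graph I)) \<le> n" using card_image_le[of "{..<m}" "\<lambda>j. (eu j, ev j)"]
      mn by (simp add: arcs)
  from flow_family[OF v f this, of S] obtain Q g where
    Q: "\<forall>k < S. Q k \<in> st_paths I \<and> int (path_delay I (Q k)) \<le> bound I"
    and rate: "(\<Sum>k<S. g k) = rate I"
    and capQ: "\<forall>e \<in> arcs (graph I). (\<Sum>k | k < S \<and> e \<in> set (Q k). g k)
        \<le> cap I e"
    by (auto simp: S_def SS_def)
  have ap: "apath (source I) (Q k) (sink I)" if "k < S" for k using Q that by (simp add: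
      st_paths_def)
  \<comment> \<open>A simple path has fewer edges than there are vertices, so its positions are
    below \<open>n\<close>.\<close>
  have lenQ: "length (Q k) < n" if "k < S" for k
    using length_apath_less[OF ap[OF that]] B(1) by (simp add: graph_def)
  have Qarcs: "set (Q k) \<subseteq> arcs (graph I)" "cas (source I) (Q k) (sink I)" if "k < S" for
      k
    using ap[OF that] by (auto simp: apath_def awalk_def)
  define on where "on k j \<longleftrightarrow> j < m \<and> (eu j, ev j) \<in> set (Q k)" for k j
  define ga where "ga j k = (if on k j then g k else 0)" for j k
  define da where "da k j = (if on k j then dl j else 0)" for k j
  have ga_sum: "(\<Sum>k<S. ga j k) \<le> cp j" if "j < m" for j
    unfolding ga_def sum_if_filter using capQ arc[OF that] w(1)[OF that] that by (auto simp: on_def)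
  have g_sum: "(\<Sum>k<S. g k) < 2 ^ n" using rate B(3) by simp
  have gk: "g k < 2 ^ n" if "k < S" for k
  proof -
    have "g k \<le> (\<Sum>k<S. g k)" using that by (intro member_le_sum) auto
    then show ?thesis using g_sum by simp
  qed
  define D where "D = nat (bound I)"
  have D: "D < 2 ^ n" using B(4) bd by (simp add: D_def)
  have da_sum: "(\<Sum>j<n. da k j) \<le> D" if k: "k < S" for k
  proof -
    have "(\<Sum>j<n. da k j) = (\<Sum>j | j < n \<and> on k j. dl j)" unfolding da_def
        sum_if_filter ..
    also have "\<dots> = (\<Sum>j | j < n \<and> on k j. delay I (eu j, ev j))" by (intro sum.cong)
        (auto simp: on_def w)
    also have "\<dots> = (\<Sum>e \<in> (\<lambda>j. (eu j, ev j)) ` {j. j < n \<and> on k j}.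
        delay I e)"
      by (subst sum.reindex) (use key_inj in \<open>auto simp: inj_on_def on_def\<close>)
    also have "\<dots> \<le> path_delay I (Q k)"
      unfolding path_delay_def by (intro sum_mono2) (auto simp: on_def)
    also have "\<dots> \<le> D" using Q k bd by (auto simp: D_def)
    finally show ?thesis .
  qed
  \<comment> \<open>One carry relation serves a sum and the addition of its slack: indices below the
    number of summands belong to the sum, and the index equal to that number to the slack.\<close>
  define rs :: "(nat \<Rightarrow> nat \<Rightarrow> nat \<Rightarrow> bool) list" where "rs =
    [\<lambda>v _ _. v < nverts I, \<lambda>_ v _. v = source I, \<lambda>_ v _. v = sink I,
        \<lambda>j _ _. j < m,
     \<lambda>j v _. v = eu j, \<lambda>j v _. v = ev j, \<lambda>j i _. bitn (cp j) i, \<lambda>j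
         i _. bitn (dl j) i,
     \<lambda>i _ _. bitn (rate I) i, \<lambda>i _ _. bitn D i,
     \<lambda>k h j. h < length (Q k) \<and> j < m \<and> Q k ! h = (eu j, ev j), \<lambda>k i _.
         bitn (g k) i,
     \<lambda>j r i. bitn (\<Sum>k<r. ga j k) i,
     \<lambda>j r i. carry (\<Sum>k<r. ga j k) (if r < S then ga j r else cp j - (\<Sum>k<S. ga j
         k)) i,
     \<lambda>j i _. bitn (cp j - (\<Sum>k<S. ga j k)) i,
     \<lambda>r i _. bitn (\<Sum>k<r. g k) i, \<lambda>r i _. carry (\<Sum>k<r. g k) (g r) i,
     \<lambda>k r i. bitn (\<Sum>j<r. da k j) i,
     \<lambda>k r i. carry (\<Sum>j<r. da k j) (if r < n then da k r else D - (\<Sum>j<n. da k j))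
         i,
     \<lambda>k i _. bitn (D - (\<Sum>j<n. da k j)) i,
     \<lambda>r i _. bitn r i, \<lambda>r i _. carry r 1 i]"
  define R where "R t = rs ! t" for t
  have R: "R 0 a b c = (a < nverts I)" "R 1 a b c = (b = source I)" "R 2 a b c = (b = sink I)"
    "R 3 a b c = (a < m)" "R 4 a b c = (b = eu a)" "R 5 a b c = (b = ev a)"
    "R 6 a b c = bitn (cp a) b" "R 7 a b c = bitn (dl a) b" "R 8 a b c = bitn (rate I) a" "R 9 a b
        c = bitn D a"
    "R 10 a b c = (b < length (Q a) \<and> c < m \<and> Q a ! b = (eu c, ev c))" "R 11 a b c = bitn
        (g a) b"
    "R 12 a b c = bitn (\<Sum>k<b. ga a k) c"
    "R 13 a b c = carry (\<Sum>k<b. ga a k) (if b < S then ga a b else cp a - (\<Sum>k<S. ga a k))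
        c"
    "R 14 a b c = bitn (cp a - (\<Sum>k<S. ga a k)) b"
    "R 15 a b c = bitn (\<Sum>k<a. g k) b" "R 16 a b c = carry (\<Sum>k<a. g k) (g a) b"
    "R 17 a b c = bitn (\<Sum>j<b. da a j) c"
    "R 18 a b c = carry (\<Sum>j<b. da a j) (if b < n then da a b else D - (\<Sum>j<n. da a j)) c"
    "R 19 a b c = bitn (D - (\<Sum>j<n. da a j)) b" "R 20 a b c = bitn a b" "R 21 a b c = carry a 1
        b" for a b c
    unfolding R_def rs_def by simp_all
  have named: "named n R 1 0 (source I)" "named n R 2 0 (sink I)"
    "j < m \<Longrightarrow> named n R 4 j (eu j)" "j < m \<Longrightarrow> named n R 5 j (ev j)"
        for j
    unfolding named_def R using st ends by auto
  have less_n: "source I < n" "sink I < n" "j < m \<Longrightarrow> eu j < n" "j < m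
      \<Longrightarrow> ev j < n" for j
    using st ends[of j] B(1) by auto
  have "struct_ok n R"
    unfolding struct_ok_def
  proof (intro conjI allI impI)
    show "\<exists>v < n. named n R 1 0 v" "\<exists>v < n. named n R 2 0 v" using named(1,2)
        less_n(1,2) by blast+
    show "\<not> (\<exists>v < n. R 1 0 v 0 \<and> R 2 0 v 0)" unfolding R using st by auto
    show "\<exists>v < n. named n R 4 j v" "\<exists>v < n. named n R 5 j v" if "R 3 j 0 0" for j
      using that named(3,4)[of j] less_n(3,4)[of j] unfolding R by blast+
    show "\<not> (\<exists>u < n. R 4 j u 0 \<and> R 4 j' u 0) \<or> \<not> (\<exists>u < n. R 5 j
        u 0 \<and> R 5 j' u 0)"
      if "R 3 j 0 0 \<and> R 3 j' 0 0 \<and> j \<noteq> j'" for j j'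
      using that key_inj[of j j'] unfolding R by auto
    show "\<exists>i < n. R 8 i 0 0"
    proof (rule ccontr)
      assume "\<not> ?thesis"
      then have "val n (bitn (rate I)) = 0" unfolding R by (auto simp: val_def)
      then show False using val_bitn[OF B(3)] st(4) by simp
    qed
  qed (auto simp: R)
  moreover have onp: "on_path n R k j \<longleftrightarrow> on k j" if "k < S" for k j
  proof
    assume "on_path n R k j"
    then show "on k j" unfolding on_path_def R on_def by (metis nth_mem)
  next
    assume "on k j"
    then obtain h where "h < length (Q k)" "Q k ! h = (eu j, ev j)" "j < m"
      unfolding on_def by (auto simp: in_set_conv_nth)
    then show "on_path n R k j" unfolding on_path_def R using lenQ[OF that] by (intro exI[of _ h])
        simp
  qed
  have "paths_ok n R"
    unfolding paths_ok_def S_def[symmetric]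
  proof (intro allI impI conjI)
    fix k assume k: "k < S"
    have idx: "\<exists>j < m. Q k ! h = (eu j, ev j)" if "h < length (Q k)" for h
      using Qarcs(1)[OF k] nth_mem[OF that] unfolding arcs by auto
    {
      fix h j assume hj: "h < n" "j < n" "R 10 k h j"
      then have h: "h < length (Q k)" "j < m" "Q k ! h = (eu j, ev j)" unfolding R by auto
      show "R 3 j 0 0" using h unfolding R by simp
      have "eu j = source I \<or> (\<exists>h' < h. \<exists>j' < n. R 10 k h' j' \<and> eu j = ev
          j')"
      proof (cases h)
        case 0
        then have "eu j = source I" using h Qarcs(2)[OF k] by (cases "Q k") auto
        then show ?thesis by simp
      next
        case (Suc h')
        obtain j' where j': "j' < m" "Q k ! h' = (eu j', ev j')" using idx[of h'] h(1) Suc by auto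
        have "Q k = take h' (Q k) @ Q k ! h' # Q k ! Suc h' # drop (Suc (Suc h')) (Q k)"
          using h(1) Suc by (metis Cons_nth_drop_Suc Suc_lessD append_take_drop_id)
        then have "cas (source I) (take h' (Q k) @ Q k ! h' # Q k ! Suc h' # drop (Suc (Suc h')) (Q
            k)) (sink I)"
          using Qarcs(2)[OF k] by simp
        then have "eu j = ev j'" using j'(2) h(3) Suc by simp
        moreover have "R 10 k h' j'" unfolding R using j' h(1) Suc by simp
        ultimately show ?thesis using Suc j'(1) mn by (intro disjI2 exI[of _ h'] exI[of _ j']
            conjI) auto
      qed
      then show "\<exists>u < n. R 4 j u 0 \<and> (R 1 0 u 0 \<or> (\<exists>h' < h. \<exists>j' <
          n. R 10 k h' j' \<and> R 5 j' u 0))"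
        using less_n(3)[OF h(2)] unfolding R(2,5,6) by (intro exI[of _ "eu j"]) auto
    }
    have "Q k \<noteq> []" using Qarcs(2)[OF k] st(3) by auto
    then obtain q e where qe: "Q k = q @ [e]" by (metis rev_exhaust)
    let ?h = "length q"
    have h: "?h < length (Q k)" using qe by simp
    obtain j where j: "j < m" "Q k ! ?h = (eu j, ev j)" using idx[OF h] by blast
    have "snd e = sink I" using Qarcs(2)[OF k] qe by simp
    then have "ev j = sink I" using j(2) qe by (simp add: nth_append)
    moreover have "R 10 k ?h j" unfolding R using h j by simp
    ultimately show "\<exists>h < n. \<exists>j < n. R 10 k h j \<and> (\<exists>v < n. R 5 j v 0
        \<and> R 2 0 v 0)"
      using h lenQ[OF k] j(1) mn less_n(2) unfolding R(3,6)
      by (intro exI[of _ ?h] exI[of _ j] exI[of _ "sink I"] conjI) auto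
  qed
  moreover have "flow_ok n R"
    unfolding flow_ok_def S_def[symmetric]
  proof (intro conjI allI impI)
    fix j assume "R 3 j 0 0"
    then have j: "j < m" unfolding R .
    have le: "(\<Sum>k<S. ga j k) \<le> cp j" by (rule ga_sum[OF j])
    have "sums_ok n S (\<lambda>k i. on_path n R k j \<and> R 11 k i 0) (\<lambda>r. bitn
        (\<Sum>k<r. ga j k)) (\<lambda>r. carry (\<Sum>k<r. ga j k) (ga j r))"
      using le small_num(1)[OF j] by (intro sums_ok_bitn) (auto simp: onp R ga_def bitn_def)
    then show "sums_ok n S (\<lambda>k i. on_path n R k j \<and> R 11 k i 0) (\<lambda>r i. R 12 j
        r i) (\<lambda>r i. R 13 j r i)"
      unfolding R sums_ok_def add3_def by auto
    have "add3 n (bitn (\<Sum>k<S. ga j k)) (bitn (cp j - (\<Sum>k<S. ga j k)))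
        (bitn ((\<Sum>k<S. ga j k) + (cp j - (\<Sum>k<S. ga j k)))) (carry (\<Sum>k<S. ga j k) (cp
            j - (\<Sum>k<S. ga j k)))"
      using le small_num(1)[OF j] by (intro add3_bitn) simp
    then show "add3 n (\<lambda>i. R 12 j S i) (\<lambda>i. R 14 j i 0) (\<lambda>i. R 6 j i 0)
        (\<lambda>i. R 13 j S i)"
      using le unfolding R by simp
  next
    have "sums_ok n S (\<lambda>k i. R 11 k i 0) (\<lambda>r. bitn (\<Sum>k<r. g k)) (\<lambda>r.
        carry (\<Sum>k<r. g k) (g r))"
      using g_sum by (intro sums_ok_bitn) (auto simp: R)
    then show "sums_ok n S (\<lambda>k i. R 11 k i 0) (\<lambda>r i. R 15 r i 0) (\<lambda>r i. R
        16 r i 0)" unfolding R .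
    show "R 15 S i 0 = R 8 i 0 0" for i unfolding R using rate by simp
  next
    fix k assume k: "k < S"
    have le: "(\<Sum>j<n. da k j) \<le> D" by (rule da_sum[OF k])
    have "sums_ok n n (\<lambda>j i. on_path n R k j \<and> R 7 j i 0) (\<lambda>r. bitn
        (\<Sum>j<r. da k j)) (\<lambda>r. carry (\<Sum>j<r. da k j) (da k r))"
      using le D by (intro sums_ok_bitn) (auto simp: onp[OF k] R da_def bitn_def)
    then show "sums_ok n n (\<lambda>j i. on_path n R k j \<and> R 7 j i 0) (\<lambda>r i. R 17 k r
        i) (\<lambda>r i. R 18 k r i)"
      unfolding R sums_ok_def add3_def by auto
    have "add3 n (bitn (\<Sum>j<n. da k j)) (bitn (D - (\<Sum>j<n. da k j)))
        (bitn ((\<Sum>j<n. da k j) + (D - (\<Sum>j<n. da k j)))) (carry (\<Sum>j<n. da k j) (D -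
            (\<Sum>j<n. da k j)))"
      using le D by (intro add3_bitn) simp
    then show "add3 n (\<lambda>i. R 17 k n i) (\<lambda>i. R 19 k i 0) (\<lambda>i. R 9 i 0 0)
        (\<lambda>i. R 18 k n i)"
      using le unfolding R by simp
  qed
  moreover have "small_ok n R" if mx: "max_number I \<le> n"
  proof -
    have fin: "finite (arcs (graph I))" by simp
    have bounds: "rate I \<le> n" "D \<le> n" "j < m \<Longrightarrow> cp j \<le> n \<and> dl j
        \<le> n" for j
    proof -
      have all: "x \<le> n" if "x \<in> {rate I, nat \<bar>bound I\<bar>} \<union> (\<Union>e \<in>
          arcs (graph I). {cap I e, delay I e})" for x
      proof -
        have "x \<le> max_number I" unfolding max_number_def by (rule Max_ge) (use fin that in auto)
        then show ?thesis using mx by simp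
      qed
      show "rate I \<le> n" by (rule all) simp
      show "D \<le> n" by (rule all) (use bd in \<open>simp add: D_def\<close>)
      show "j < m \<Longrightarrow> cp j \<le> n \<and> dl j \<le> n" using w[of j] arc[of j] by
          (auto intro!: all)
    qed
    have "sums_ok n n (\<lambda>r i. i = 0) (\<lambda>r. bitn (\<Sum>k<r. 1)) (\<lambda>r. carry
        (\<Sum>k<r. 1) 1)"
      by (intro sums_ok_bitn) (simp_all add: bitn_one del: One_nat_def)
    then have "sums_ok n n (\<lambda>r i. i = 0) (\<lambda>r i. R 20 r i 0) (\<lambda>r i. R 21 r i
        0)" unfolding R by simp
    then show ?thesis
      unfolding small_ok_def R(4,7,8,9,10,21) using bounds by (auto simp: less_Suc_eq_le)
  qed
  moreover have "print_instance n R = enc_instance I"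
  proof -
    have 1: "concat (map (\<lambda>v. if R 0 v 0 0 then [True] else []) [0..<n]) = replicate
        (nverts I) True"
    proof -
      have "[0..<n] = [0..<nverts I] @ [nverts I..<n]"
        using B(1) upt_add_eq_append[of 0 "nverts I" "n - nverts I"] by simp
      then have "concat (map (\<lambda>v. if R 0 v 0 0 then [True] else []) [0..<n]) =
          concat (map (\<lambda>v. if R 0 v 0 0 then [True] else []) [0..<nverts I])"
        by (simp only:) (rule concat_map_append_Nil, simp add: R)
      also have "\<dots> = concat (map (\<lambda>v. [True]) [0..<nverts I])" by (rule
          concat_map_cong) (simp add: R)
      also have "\<dots> = replicate (nverts I) True"
        using concat_map_singleton[of "\<lambda>_. True" "[0..<nverts I]"] by (simp add:
            map_replicate_const)
      finally show ?thesis .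
    qed
    have pb: "print_bits n (\<lambda>i. bitn N i) = enc_nat N" if "N < 2 ^ n" for N
      using val_bitn[OF that] by (simp add: print_bits_val)
    let ?g = "\<lambda>j. True # print_vertex n R 4 j @ print_vertex n R 5 j @
        print_bits n (\<lambda>i. R 6 j i 0) @ print_bits n (\<lambda>i. R 7 j i 0)"
    have 2: "concat (map (\<lambda>j. if R 3 j 0 0 then ?g j else []) [0..<n]) = concat (map
        (\<lambda>x. True # enc_edge x) es)"
    proof -
      have "[0..<n] = [0..<m] @ [m..<n]" using mn upt_add_eq_append[of 0 m "n - m"] by simp
      then have "concat (map (\<lambda>j. if R 3 j 0 0 then ?g j else []) [0..<n]) =
          concat (map (\<lambda>j. if R 3 j 0 0 then ?g j else []) [0..<m])"
        by (simp only:) (rule concat_map_append_Nil, simp add: R(4))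
      also have "\<dots> = concat (map (\<lambda>j. True # enc_edge (es ! j)) [0..<m])"
      proof (rule concat_map_cong)
        fix j assume j: "j < m"
        have "print_vertex n R 4 j = enc_nat (eu j)" "print_vertex n R 5 j = enc_nat (ev j)"
          using print_vertex_named[OF named(3)[OF j] less_n(3)[OF j]]
            print_vertex_named[OF named(4)[OF j] less_n(4)[OF j]] .
        then show "(if R 3 j 0 0 then ?g j else []) = True # enc_edge (es ! j)"
          using j pb[OF small_num(1)[OF j]] pb[OF small_num(2)[OF j]] by (simp add: R(4,7,8) es_nth)
      qed
      also have "\<dots> = concat (map (\<lambda>x. True # enc_edge x) es)"
      proof -
        have "map (\<lambda>j. True # enc_edge (es ! j)) [0..<m] = map (\<lambda>x. True # enc_edge
            x) es"
          by (rule nth_equalityI) (simp_all add: m_def)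
        then show ?thesis by simp
      qed
      finally show ?thesis .
    qed
    show ?thesis
      unfolding print_instance_def 1 2
      unfolding print_vertex_named[OF named(1) less_n(1)] print_vertex_named[OF named(2) less_n(2)]
        R(9,10) pb[OF B(3)] pb[OF D] enc_instance_def enc_list_def enc_int_def es_def
      using bd by (simp add: D_def)
  qed
  ultimately show ?thesis by blast
qed

text \<open>With the flag off this is membership of the whole problem, with the flag on that of its
  restriction to small numbers. The certificate and the printing program are shared; the flag only
  adds \<open>small_ok\<close>.\<close>

lemma instances_in_NP:
  "enc_instance ` {I \<in> int_min_max_delay. small \<longrightarrow> max_number I \<le> length
      (enc_instance I)} \<in> class_NP"
proof -
  define ok where "ok n R \<longleftrightarrow> struct_ok n R \<and> paths_ok n R \<and> flow_ok n
      R \<and> (small \<longrightarrow> small_ok n R)" for n R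
  define F where "F n B = (if ok n (rel_of B) then print_instance n (rel_of B) else replicate (Suc
      n) True)" for n B
  have "odef (\<lambda>n B e. F n B)" unfolding F_def ok_def by (rule odef_certificate)
  from odef_NP[OF this] have "{x. \<exists>Y. x = F (length x) Y} \<in> class_NP" .
  moreover have "{x. \<exists>Y. x = F (length x) Y} =
      enc_instance ` {I \<in> int_min_max_delay. small \<longrightarrow> max_number I \<le> length
          (enc_instance I)}"
  proof (intro set_eqI iffI)
    fix x assume "x \<in> {x. \<exists>Y. x = F (length x) Y}"
    then obtain Y where Y: "x = F (length x) Y" by blast
    have ok: "ok (length x) (rel_of Y)"
    proof (rule ccontr)
      assume "\<not> ?thesis"
      then have "x = replicate (Suc (length x)) True" using Y by (simp add: F_def)
      then have "length x = Suc (length x)" by (metis length_replicate)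
      then show False by simp
    qed
    then have x: "x = print_instance (length x) (rel_of Y)" using Y by (simp add: F_def)
    obtain I where I: "I \<in> int_min_max_delay" "print_instance (length x) (rel_of Y) =
        enc_instance I"
      "small \<longrightarrow> max_number I \<le> length x"
      using certificate_sound[of "length x" "rel_of Y" small] ok unfolding ok_def by blast
    then have "x = enc_instance I" using x by simp
    then show "x \<in> enc_instance ` {I \<in> int_min_max_delay. small \<longrightarrow>
        max_number I \<le> length (enc_instance I)}"
      using I by blast
  next
    fix x assume "x \<in> enc_instance ` {I \<in> int_min_max_delay. small \<longrightarrow>
        max_number I \<le> length (enc_instance I)}"
    then obtain I where I: "I \<in> int_min_max_delay" "x = enc_instance I" "small
        \<longrightarrow> max_number I \<le> length x" by blast
    obtain R where R: "struct_ok (length x) R" "paths_ok (length x) R" "flow_ok (length x) R"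
      "max_number I \<le> length x \<longrightarrow> small_ok (length x) R" "print_instance (length
          x) R = x"
      using certificate_complete[OF I(1), of "length x"] I(2) by blast
    \<comment> \<open>The relations are packed into one predicate of bits; \<open>rel_of\<close>
      recovers them because \<open>pr\<close> is injective.\<close>
    define Y where "Y w \<longleftrightarrow> (\<exists>t a b c. w = pr t (pr a (pr b c)) \<and> R
        t a b c)" for w
    have "rel_of Y = R" by (auto simp: rel_of_def Y_def fun_eq_iff)
    then have "x = F (length x) Y" using R I(3) by (simp add: F_def ok_def)
    then show "x \<in> {x. \<exists>Y. x = F (length x) Y}" by blast
  qed
  ultimately show ?thesis by simp
qed

theorem theorem2:
  shows "strongly_NP_complete int_min_max_delay enc_instance max_number"
proof -
  have "enc_instance ` int_min_max_delay \<in> class_NP" using instances_in_NP[of False] by simp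
  \<comment> \<open>The polynomial is the identity, under which the restriction is exactly the one
    treated by the two preceding results.\<close>
  moreover have "NP_complete (enc_instance ` {I \<in> int_min_max_delay. max_number I \<le> poly
      [:0, 1:] (length (enc_instance I))})"
    using instances_in_NP[of True] NP_hard_restricted by (simp add: NP_complete_def)
  ultimately show ?thesis unfolding strongly_NP_complete_def by blast
qed

end
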